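(* Let $(M,G)$ be a proper $G$-manifold which admits a minimal $G$-tubular cover. Decompose $M$ into its orbit-type strata $\{M_\beta\mid\beta\in\mathcal{B}\}$. Let $\mathcal{B}'$ be the biggest subset of $\mathcal{B}$ such that $M_\beta$ is a minimal orbit-type stratum for every $\beta\in\mathcal{B}'$. Then $$\mathrm{Cat}_G(M)=\sum_{\beta\in\mathcal{B}'}\mathrm{Cat}_G(M_\beta).$$
   Context: A proper $G$-manifold $(M,G)$ is a smooth manifold $M$ with a smooth proper action of a Lie group $G$. Write $G_m$ for the stabilizer of $m\in M$, $G\cdot m$ for its orbit, and $\mathfrak{g}\cdot m=T_m(G\cdot m)$. Equivariant LS-category. For $G$-invariant subsets $B\subset A$ of $M$, a $G$-deformation retract of $A$ onto $B$ is a homotopy $H:A\times[0,1]\to A$, $H_t(a)=H(a,t)$, with $H(g\cdot a,t)=g\cdot H(a,t)$ for all $g\in G$, $a\in A$, $t\in[0,1]$, such that $H_0(a)=a$ and $H_1(a)\in B$ for all $a\in A$, and $H(b,1)=b$ for all $b\in B$. A $G$-invariant subset $U$ is $G$-categorical if there is a $G$-deformation retract of $U$ onto the orbit $G\cdot x$ of some $x\in U$. $\mathrm{Cat}_G(M)$ is the least number of $G$-categorical open subsets of $M$ required to cover $M$ ($\infty$ if no such cover exists). $\mathrm{Cat}_G(M_\beta)$ is defined in the same way for the $G$-space $M_\beta$ with the subset topology. Orbit-type strata (modified definition). For a closed subgroup $H\subset G$ let $(H)$ be its conjugacy class and $M_H=\{m\in M\mid G_m=H\}$, and write $M_H=\coprod_{b\in\mathcal{B}_H}M_{H,b}$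 as the disjoint union of its connected components. For $b\in\mathcal{B}_H$, $(b)$ denotes the set of $a\in\mathcal{B}_H$ with $G\cdot M_{H,a}=G\cdot M_{H,b}$. $\mathcal{B}$ is the set of pairs $\beta=((H),(b))$, and the orbit-type stratum $M_\beta$ is $G\cdot M_{H,b}$ (it need not be connected). Distinct indices correspond to distinct strata, and $M$ is the disjoint union of the $M_\beta$, $\beta\in\mathcal{B}$. The strict partial order on $\mathcal{B}$ is: $\alpha\prec\beta$ if and only if $\alpha\neq\beta$ and $M_\alpha\cap\overline{M_\beta}\neq\varnothing$. A stratum $M_\beta$ is minimal if there is no $\alpha\in\mathcal{B}$ with $\alpha\prec\beta$. $G$-tubular open subsets. Let $m\in M$, let $N\subset T_mM$ be a $G_m$-invariant complement to $\mathfrak{g}\cdot m$, and let $N_0\subset N$ be a $G_m$-invariant open neighbourhood of $0$ with $(1-t)\nu\in N_0$ for $\nu\in N_0$, $t\in[0,1]$. Let $G\times_{G_m}N_0$ be the quotient of $G\times N_0$ by the action $k\cdot(g,\nu)=(gk^{-1},k\cdot\nu)$ of $G_m$, with $G$ acting by left multiplication on the first factor. A $G$-invariant open neighbourhood $U$ of $m$ is a $G$-tubular open subset if there is a $G$-equivariant diffeomorphism $\varphi:G\times_{G_m}N_0\to U$ with $\varphi([(e,0)])=m$; its associated $G$-deformation retract (onto $G\cdot m$) is $H(p,t)=\varphi(F(\varphi^{-1}(p),t))$ where $F([(g,\nu)],t)=[(g,(1-t)\nu)]$. A $G$-tubular cover of $M$ is a cover of $M$ by $G$-tubular open subsets. Minimal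 $G$-tubular cover. Let $\mathcal{U}$ be a $G$-tubular cover of $M$ and let $M'$ be the union of all minimal orbit-type strata. Extract from $\mathcal{U}$ a subset $\mathcal{U}'\subset\mathcal{U}$, chosen as small as possible such that $\mathcal{U}'$ covers $M'$. Such a $\mathcal{U}'$ is called a minimal $G$-tubular cover if (i) $\mathcal{U}'$ is a cover of $M$; and (ii) for each minimal orbit-type stratum $M_\beta$, the set $\{U\cap M_\beta\mid U\in\mathcal{U}'\}$ (empty intersections disregarded) is the smallest cover of $M_\beta$ (i.e. with the fewest members) by $G$-categorical open subsets of $M_\beta$, where $M_\beta$ has the subset topology. *)

theory Defs
  imports
    "HOL-Analysis.Analysis"
    "HOL-Algebra.Group_Action"
    "HOL-Library.Function_Algebras"
begin

section \<open>Smooth manifolds\<close>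

text \<open>
  \<open>\<real>\<^sup>n\<close> is \<^const>\<open>Euclidean_space\<close>, i.e. the sequences that vanish from index \<open>n\<close> on, so that the
  dimension is a natural number and \<open>n = 0\<close> is allowed (finite and discrete groups are Lie groups).
\<close>

definition partial_deriv :: "nat \<Rightarrow> ((nat \<Rightarrow> real) \<Rightarrow> real) \<Rightarrow> (nat \<Rightarrow> real) \<Rightarrow> real" where
  "partial_deriv i f x = deriv (\<lambda>t. f (x(i := t))) (x i)"

text \<open>For \<open>W\<close> open in \<open>\<real>\<^sup>n\<close>: all partial derivatives of order \<open>\<le> k\<close> exist and are continuous on \<open>W\<close>.\<close>

fun Ck_on :: "nat \<Rightarrow> nat \<Rightarrow> (nat \<Rightarrow> real) set \<Rightarrow> ((nat \<Rightarrow> real) \<Rightarrow> real) \<Rightarrow> bool" where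
  "Ck_on n 0 W f \<longleftrightarrow> continuous_on W f"
| "Ck_on n (Suc k) W f \<longleftrightarrow> continuous_on W f \<and>
     (\<forall>i<n. (\<forall>x\<in>W. (\<lambda>t. f (x(i := t))) differentiable at (x i)) \<and>
            Ck_on n k W (partial_deriv i f))"

definition smooth_on :: "nat \<Rightarrow> (nat \<Rightarrow> real) set \<Rightarrow> ((nat \<Rightarrow> real) \<Rightarrow> real) \<Rightarrow> bool" where
  "smooth_on n W f \<longleftrightarrow> (\<forall>k. Ck_on n k W f)"

definition smooth_vec_on ::
  "nat \<Rightarrow> nat \<Rightarrow> (nat \<Rightarrow> real) set \<Rightarrow> ((nat \<Rightarrow> real) \<Rightarrow> nat \<Rightarrow> real) \<Rightarrow> bool" where
  "smooth_vec_on n k W F \<longleftrightarrow> (\<forall>i<k. smooth_on n W (\<lambda>x. F x i))"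

type_synonym 'a chart = "'a set \<times> ('a \<Rightarrow> nat \<Rightarrow> real)"

record 'a manifold =
  mtop :: "'a topology"
  mdim :: nat
  atlas :: "'a chart set"

definition chart_on :: "'a topology \<Rightarrow> nat \<Rightarrow> 'a chart \<Rightarrow> bool" where
  "chart_on X n = (\<lambda>(V, \<psi>). openin X V \<and> openin (Euclidean_space n) (\<psi> ` V) \<and>
     homeomorphic_map (subtopology X V) (subtopology (Euclidean_space n) (\<psi> ` V)) \<psi>)"

text \<open>The atlas need not be maximal; the notions below depend only on the maximal atlas it generates.\<close>

definition smooth_manifold :: "'a manifold \<Rightarrow> bool" where
  "smooth_manifold M \<longleftrightarrow>
     Hausdorff_space (mtop M) \<and> second_countable (mtop M) \<and>
     (\<forall>c\<in>atlas M. chart_on (mtop M) (mdim M) c) \<and>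
     (\<Union>(V, \<psi>)\<in>atlas M. V) = topspace (mtop M) \<and>
     (\<forall>(V, \<psi>)\<in>atlas M. \<forall>(V', \<psi>')\<in>atlas M.
        smooth_vec_on (mdim M) (mdim M) (\<psi> ` (V \<inter> V')) (\<lambda>y. \<psi>' (inv_into V \<psi> y)))"

definition smooth_map :: "'a manifold \<Rightarrow> 'b manifold \<Rightarrow> ('a \<Rightarrow> 'b) \<Rightarrow> bool" where
  "smooth_map M N F \<longleftrightarrow> continuous_map (mtop M) (mtop N) F \<and>
     (\<forall>x\<in>topspace (mtop M). \<exists>(V, \<psi>)\<in>atlas M. \<exists>(V', \<psi>')\<in>atlas N. x \<in> V \<and> F x \<in> V' \<and>
        smooth_vec_on (mdim M) (mdim N) (\<psi> ` (V \<inter> F -` V')) (\<lambda>y. \<psi>' (F (inv_into V \<psi> y))))"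

definition diffeomorphism :: "'a manifold \<Rightarrow> 'b manifold \<Rightarrow> ('a \<Rightarrow> 'b) \<Rightarrow> bool" where
  "diffeomorphism M N F \<longleftrightarrow> bij_betw F (topspace (mtop M)) (topspace (mtop N)) \<and>
     smooth_map M N F \<and> smooth_map N M (inv_into (topspace (mtop M)) F)"

definition open_submanifold :: "'a manifold \<Rightarrow> 'a set \<Rightarrow> 'a manifold" where
  "open_submanifold M W = \<lparr>mtop = subtopology (mtop M) W, mdim = mdim M,
     atlas = (\<lambda>(V, \<psi>). (V \<inter> W, \<psi>)) ` atlas M\<rparr>"

definition prod_manifold :: "'a manifold \<Rightarrow> 'b manifold \<Rightarrow> ('a \<times> 'b) manifold" where
  "prod_manifold M N = \<lparr>mtop = prod_topology (mtop M) (mtop N), mdim = mdim M + mdim N,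
     atlas = {(V \<times> V', \<lambda>(x, y) i. if i < mdim M then \<psi> x i else \<psi>' y (i - mdim M)) | V \<psi> V' \<psi>'.
                (V, \<psi>) \<in> atlas M \<and> (V', \<psi>') \<in> atlas N}\<rparr>"

definition smooth_fun_on :: "'a manifold \<Rightarrow> 'a set \<Rightarrow> ('a \<Rightarrow> real) \<Rightarrow> bool" where
  "smooth_fun_on M W f \<longleftrightarrow>
     (\<forall>(V, \<psi>)\<in>atlas M. smooth_on (mdim M) (\<psi> ` (V \<inter> W)) (\<lambda>y. f (inv_into V \<psi> y)))"

text \<open>Quotient topology and quotient smooth structure on \<open>\<pi> ` topspace (mtop M)\<close>: a function on an
  open subset of the quotient is smooth iff its pull-back along \<open>\<pi>\<close> is, and the atlas consists of the
  charts into \<open>\<real>\<^sup>n\<close> that identify these functions with the usual smooth functions.\<close>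

definition quotient_top :: "'a topology \<Rightarrow> ('a \<Rightarrow> 'b) \<Rightarrow> 'b topology" where
  "quotient_top X \<pi> =
     topology (\<lambda>S. S \<subseteq> \<pi> ` topspace X \<and> openin X {x \<in> topspace X. \<pi> x \<in> S})"

lemma istopology_quotient_top:
  "istopology (\<lambda>S. S \<subseteq> \<pi> ` topspace X \<and> openin X {x \<in> topspace X. \<pi> x \<in> S})"
proof -
  have "{x \<in> topspace X. \<pi> x \<in> S \<inter> T} = {x \<in> topspace X. \<pi> x \<in> S} \<inter> {x \<in> topspace X. \<pi> x \<in> T}"
    for S T by auto
  moreover have "{x \<in> topspace X. \<pi> x \<in> \<Union>\<K>} = (\<Union>K\<in>\<K>. {x \<in> topspace X. \<pi> x \<in> K})" for \<K>
    by auto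
  ultimately show ?thesis
    unfolding istopology_def by (auto simp del: Union_iff Int_iff)
qed

lemma openin_quotient_top:
  "openin (quotient_top X \<pi>) S \<longleftrightarrow>
     S \<subseteq> \<pi> ` topspace X \<and> openin X {x \<in> topspace X. \<pi> x \<in> S}"
  unfolding quotient_top_def by (simp add: topology_inverse'[OF istopology_quotient_top])

definition quotient_manifold :: "nat \<Rightarrow> 'a manifold \<Rightarrow> ('a \<Rightarrow> 'b) \<Rightarrow> 'b manifold" where
  "quotient_manifold n M \<pi> = \<lparr>mtop = quotient_top (mtop M) \<pi>, mdim = n,
     atlas = {(V, \<psi>). chart_on (quotient_top (mtop M) \<pi>) n (V, \<psi>) \<and>
       (\<forall>W f. W \<subseteq> V \<and> openin (quotient_top (mtop M) \<pi>) W \<longrightarrow>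
          (smooth_fun_on M {x \<in> topspace (mtop M). \<pi> x \<in> W} (\<lambda>x. f (\<pi> x)) \<longleftrightarrow>
           smooth_on n (\<psi> ` W) (\<lambda>y. f (inv_into V \<psi> y))))}\<rparr>"

section \<open>Tangent spaces\<close>

instantiation "fun" :: (type, real_vector) real_vector
begin

definition scaleR_fun :: "real \<Rightarrow> ('a \<Rightarrow> 'b) \<Rightarrow> 'a \<Rightarrow> 'b" where
  "scaleR_fun c f = (\<lambda>x. c *\<^sub>R f x)"

instance
  by standard
    (auto simp: scaleR_fun_def plus_fun_def fun_eq_iff scaleR_add_right scaleR_add_left)

end

text \<open>Functions are normalised to vanish off the manifold, and functionals to vanish off
  \<open>smooth_funs M\<close>; this makes the two spaces below subspaces of full function spaces.\<close>

definition smooth_funs :: "'a manifold \<Rightarrow> ('a \<Rightarrow> real) set" where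
  "smooth_funs M = {f. (\<forall>x. x \<notin> topspace (mtop M) \<longrightarrow> f x = 0) \<and> smooth_fun_on M (topspace (mtop M)) f}"

type_synonym 'a tangent = "('a \<Rightarrow> real) \<Rightarrow> real"

text \<open>Tangent vectors are derivations at \<open>m\<close>. The canonical topology of this finite-dimensional space
  is that of pointwise convergence, i.e. the one induced by the function type.\<close>

definition tangent_space :: "'a manifold \<Rightarrow> 'a \<Rightarrow> 'a tangent set" where
  "tangent_space M m = {v.
     (\<forall>f. f \<notin> smooth_funs M \<longrightarrow> v f = 0) \<and>
     (\<forall>f\<in>smooth_funs M. \<forall>g\<in>smooth_funs M. v (\<lambda>x. f x + g x) = v f + v g) \<and>
     (\<forall>f\<in>smooth_funs M. \<forall>c. v (\<lambda>x. c * f x) = c * v f) \<and>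
     (\<forall>f\<in>smooth_funs M. \<forall>g\<in>smooth_funs M. v (\<lambda>x. f x * g x) = f m * v g + v f * g m)}"

definition differential :: "'a manifold \<Rightarrow> 'b manifold \<Rightarrow> ('a \<Rightarrow> 'b) \<Rightarrow> 'a tangent \<Rightarrow> 'b tangent" where
  "differential M N F v = (\<lambda>f. if f \<in> smooth_funs N
     then v (\<lambda>x. if x \<in> topspace (mtop M) then f (F x) else 0) else 0)"

text \<open>An open subset of the finite-dimensional vector space \<open>N\<close>, with the linear coordinates as atlas.\<close>

definition vector_manifold ::
  "('b::{topological_space,real_vector}) set \<Rightarrow> 'b set \<Rightarrow> 'b manifold" where
  "vector_manifold N W = \<lparr>mtop = subtopology euclidean W, mdim = dim N,
     atlas = {(W, L) | L. linear L \<and> bij_betw L N (topspace (Euclidean_space (dim N)))}\<rparr>"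

section \<open>Proper \<open>G\<close>-manifolds\<close>

locale lie_group = group G for G :: "('g, 'z) monoid_scheme" (structure) +
  fixes L :: "'g manifold"
  assumes manifold_L: "smooth_manifold L"
    and topspace_L: "topspace (mtop L) = carrier G"
    and smooth_mult: "smooth_map (prod_manifold L L) L (\<lambda>(g, h). g \<otimes> h)"
    and smooth_inv: "smooth_map L L (\<lambda>g. inv g)"

locale proper_G_manifold =
  lie_group G L + group_action G "topspace (mtop M)" \<phi>
  for G :: "('g, 'z) monoid_scheme" (structure) and L :: "'g manifold"
    and M :: "'a manifold" and \<phi> :: "'g \<Rightarrow> 'a \<Rightarrow> 'a" +
  assumes manifold_M: "smooth_manifold M"
    and smooth_action: "smooth_map (prod_manifold L M) M (\<lambda>(g, x). \<phi> g x)"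
    and proper_action: "proper_map (prod_topology (mtop L) (mtop M))
                          (prod_topology (mtop M) (mtop M)) (\<lambda>(g, x). (\<phi> g x, x))"

definition G_invariant :: "('g, 'z) monoid_scheme \<Rightarrow> ('g \<Rightarrow> 'a \<Rightarrow> 'a) \<Rightarrow> 'a set \<Rightarrow> bool" where
  "G_invariant G \<phi> A \<longleftrightarrow> (\<forall>g\<in>carrier G. \<forall>a\<in>A. \<phi> g a \<in> A)"

definition G_saturation :: "('g, 'z) monoid_scheme \<Rightarrow> ('g \<Rightarrow> 'a \<Rightarrow> 'a) \<Rightarrow> 'a set \<Rightarrow> 'a set" where
  "G_saturation G \<phi> A = (\<Union>a\<in>A. orbit G \<phi> a)"

section \<open>Equivariant LS-category\<close>

definition G_deformation_retract ::
  "('g, 'z) monoid_scheme \<Rightarrow> ('g \<Rightarrow> 'a \<Rightarrow> 'a) \<Rightarrow> 'a topology \<Rightarrow> 'a set \<Rightarrow> 'a set \<Rightarrow>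
   ('a \<times> real \<Rightarrow> 'a) \<Rightarrow> bool" where
  "G_deformation_retract G \<phi> X A B H \<longleftrightarrow>
     B \<subseteq> A \<and> A \<subseteq> topspace X \<and> G_invariant G \<phi> A \<and> G_invariant G \<phi> B \<and>
     continuous_map (prod_topology (subtopology X A) (top_of_set {0..1})) (subtopology X A) H \<and>
     (\<forall>g\<in>carrier G. \<forall>a\<in>A. \<forall>t\<in>{0..1}. H (\<phi> g a, t) = \<phi> g (H (a, t))) \<and>
     (\<forall>a\<in>A. H (a, 0) = a \<and> H (a, 1) \<in> B) \<and> (\<forall>b\<in>B. H (b, 1) = b)"

definition G_categorical ::
  "('g, 'z) monoid_scheme \<Rightarrow> ('g \<Rightarrow> 'a \<Rightarrow> 'a) \<Rightarrow> 'a topology \<Rightarrow> 'a set \<Rightarrow> bool" where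
  "G_categorical G \<phi> X U \<longleftrightarrow> (\<exists>x\<in>U. \<exists>H. G_deformation_retract G \<phi> X U (orbit G \<phi> x) H)"

definition G_categorical_open_cover ::
  "('g, 'z) monoid_scheme \<Rightarrow> ('g \<Rightarrow> 'a \<Rightarrow> 'a) \<Rightarrow> 'a topology \<Rightarrow> 'a set set \<Rightarrow> bool" where
  "G_categorical_open_cover G \<phi> X \<C> \<longleftrightarrow>
     (\<forall>U\<in>\<C>. openin X U \<and> G_categorical G \<phi> X U) \<and> \<Union>\<C> = topspace X"

text \<open>The infimum of the empty set is \<open>\<infinity>\<close>; an infinite cover counts as \<open>\<infinity>\<close> as well.\<close>

definition Cat_G :: "('g, 'z) monoid_scheme \<Rightarrow> ('g \<Rightarrow> 'a \<Rightarrow> 'a) \<Rightarrow> 'a topology \<Rightarrow> enat" where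
  "Cat_G G \<phi> X = (INF \<C> \<in> {\<C>. G_categorical_open_cover G \<phi> X \<C>}.
     if finite \<C> then enat (card \<C>) else \<infinity>)"

section \<open>Orbit-type strata\<close>

definition fixed_type :: "('g, 'z) monoid_scheme \<Rightarrow> 'a manifold \<Rightarrow> ('g \<Rightarrow> 'a \<Rightarrow> 'a) \<Rightarrow> 'g set \<Rightarrow> 'a set" where
  "fixed_type G M \<phi> H = {m \<in> topspace (mtop M). stabilizer G \<phi> m = H}"

definition conj_class :: "('g, 'z) monoid_scheme \<Rightarrow> 'g set \<Rightarrow> 'g set set" where
  "conj_class G H = {g <#\<^bsub>G\<^esub> H #>\<^bsub>G\<^esub> inv\<^bsub>G\<^esub> g | g. g \<in> carrier G}"

text \<open>Indices \<open>b \<in> \<B>\<^sub>H\<close> are the connected components of \<open>M\<^sub>H\<close> themselves. So that \<open>((H), (b))\<close> does not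
  depend on the representative \<open>H\<close>, \<open>(b)\<close> collects the components of all \<open>M\<^bsub>H'\<^esub>\<close> with \<open>H' \<in> (H)\<close>
  that have the same saturation as \<open>b\<close>.\<close>

definition component_class ::
  "('g, 'z) monoid_scheme \<Rightarrow> 'a manifold \<Rightarrow> ('g \<Rightarrow> 'a \<Rightarrow> 'a) \<Rightarrow> 'g set \<Rightarrow> 'a set \<Rightarrow> 'a set set" where
  "component_class G M \<phi> H b = {a. \<exists>H'\<in>conj_class G H.
     a \<in> connected_components_of (subtopology (mtop M) (fixed_type G M \<phi> H')) \<and>
     G_saturation G \<phi> a = G_saturation G \<phi> b}"

definition strata_index ::
  "('g, 'z) monoid_scheme \<Rightarrow> 'g manifold \<Rightarrow> 'a manifold \<Rightarrow> ('g \<Rightarrow> 'a \<Rightarrow> 'a) \<Rightarrow>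
   ('g set set \<times> 'a set set) set" where
  "strata_index G L M \<phi> = {(conj_class G H, component_class G M \<phi> H b) | H b.
     subgroup H G \<and> closedin (mtop L) H \<and>
     b \<in> connected_components_of (subtopology (mtop M) (fixed_type G M \<phi> H))}"

text \<open>All members of \<open>snd \<beta>\<close> have the same saturation \<open>G \<cdot> M\<^bsub>H,b\<^esub>\<close>, so this union is that set.\<close>

definition stratum ::
  "('g, 'z) monoid_scheme \<Rightarrow> ('g \<Rightarrow> 'a \<Rightarrow> 'a) \<Rightarrow> 'g set set \<times> 'a set set \<Rightarrow> 'a set" where
  "stratum G \<phi> \<beta> = (\<Union>b\<in>snd \<beta>. G_saturation G \<phi> b)"

definition strata_less ::
  "('g, 'z) monoid_scheme \<Rightarrow> 'a manifold \<Rightarrow> ('g \<Rightarrow> 'a \<Rightarrow> 'a) \<Rightarrow>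
   'g set set \<times> 'a set set \<Rightarrow> 'g set set \<times> 'a set set \<Rightarrow> bool" where
  "strata_less G M \<phi> \<alpha> \<beta> \<longleftrightarrow>
     \<alpha> \<noteq> \<beta> \<and> stratum G \<phi> \<alpha> \<inter> (mtop M closure_of stratum G \<phi> \<beta>) \<noteq> {}"

definition minimal_index ::
  "('g, 'z) monoid_scheme \<Rightarrow> 'g manifold \<Rightarrow> 'a manifold \<Rightarrow> ('g \<Rightarrow> 'a \<Rightarrow> 'a) \<Rightarrow>
   ('g set set \<times> 'a set set) set" where
  "minimal_index G L M \<phi> =
     {\<beta> \<in> strata_index G L M \<phi>. \<not> (\<exists>\<alpha>\<in>strata_index G L M \<phi>. strata_less G M \<phi> \<alpha> \<beta>)}"

section \<open>\<open>G\<close>-tubular open subsets\<close>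

text \<open>\<open>\<gg> \<cdot> m = T\<^sub>m (G \<cdot> m)\<close>, as the image of \<open>\<gg> = T\<^sub>e G\<close> under the differential of the orbit map.\<close>

definition orbit_tangent ::
  "('g, 'z) monoid_scheme \<Rightarrow> 'g manifold \<Rightarrow> 'a manifold \<Rightarrow> ('g \<Rightarrow> 'a \<Rightarrow> 'a) \<Rightarrow> 'a \<Rightarrow> 'a tangent set" where
  "orbit_tangent G L M \<phi> m = differential L M (\<lambda>g. \<phi> g m) ` tangent_space L \<one>\<^bsub>G\<^esub>"

definition isotropy_complement ::
  "('g, 'z) monoid_scheme \<Rightarrow> 'g manifold \<Rightarrow> 'a manifold \<Rightarrow> ('g \<Rightarrow> 'a \<Rightarrow> 'a) \<Rightarrow> 'a \<Rightarrow>
   'a tangent set \<Rightarrow> bool" where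
  "isotropy_complement G L M \<phi> m N \<longleftrightarrow>
     subspace N \<and> N \<subseteq> tangent_space M m \<and>
     (\<forall>k\<in>stabilizer G \<phi> m. \<forall>\<nu>\<in>N. differential M M (\<phi> k) \<nu> \<in> N) \<and>
     N \<inter> orbit_tangent G L M \<phi> m = {0} \<and>
     {\<nu> + \<xi> | \<nu> \<xi>. \<nu> \<in> N \<and> \<xi> \<in> orbit_tangent G L M \<phi> m} = tangent_space M m"

definition tube_nhd ::
  "('g, 'z) monoid_scheme \<Rightarrow> 'a manifold \<Rightarrow> ('g \<Rightarrow> 'a \<Rightarrow> 'a) \<Rightarrow> 'a \<Rightarrow>
   'a tangent set \<Rightarrow> 'a tangent set \<Rightarrow> bool" where
  "tube_nhd G M \<phi> m N N\<^sub>0 \<longleftrightarrow>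
     openin (top_of_set N) N\<^sub>0 \<and> 0 \<in> N\<^sub>0 \<and>
     (\<forall>k\<in>stabilizer G \<phi> m. \<forall>\<nu>\<in>N\<^sub>0. differential M M (\<phi> k) \<nu> \<in> N\<^sub>0) \<and>
     (\<forall>\<nu>\<in>N\<^sub>0. \<forall>t\<in>{0..1}. (1 - t) *\<^sub>R \<nu> \<in> N\<^sub>0)"

text \<open>The class \<open>[(g, \<nu>)]\<close>, as an orbit of \<open>G\<^sub>m\<close> in \<open>G \<times> N\<^sub>0\<close>.\<close>

definition tube_class ::
  "('g, 'z) monoid_scheme \<Rightarrow> 'a manifold \<Rightarrow> ('g \<Rightarrow> 'a \<Rightarrow> 'a) \<Rightarrow> 'a \<Rightarrow>
   'g \<times> 'a tangent \<Rightarrow> ('g \<times> 'a tangent) set" where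
  "tube_class G M \<phi> m = (\<lambda>(g, \<nu>).
     {(g \<otimes>\<^bsub>G\<^esub> inv\<^bsub>G\<^esub> k, differential M M (\<phi> k) \<nu>) | k. k \<in> stabilizer G \<phi> m})"

text \<open>\<open>G \<times>\<^bsub>G\<^sub>m\<^esub> N\<^sub>0\<close> has dimension \<open>dim (\<gg> \<cdot> m) + dim N = dim M\<close>.\<close>

definition tube ::
  "('g, 'z) monoid_scheme \<Rightarrow> 'g manifold \<Rightarrow> 'a manifold \<Rightarrow> ('g \<Rightarrow> 'a \<Rightarrow> 'a) \<Rightarrow> 'a \<Rightarrow>
   'a tangent set \<Rightarrow> 'a tangent set \<Rightarrow> ('g \<times> 'a tangent) set manifold" where
  "tube G L M \<phi> m N N\<^sub>0 =
     quotient_manifold (mdim M) (prod_manifold L (vector_manifold N N\<^sub>0)) (tube_class G M \<phi> m)"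

definition G_tubular ::
  "('g, 'z) monoid_scheme \<Rightarrow> 'g manifold \<Rightarrow> 'a manifold \<Rightarrow> ('g \<Rightarrow> 'a \<Rightarrow> 'a) \<Rightarrow> 'a set \<Rightarrow> bool" where
  "G_tubular G L M \<phi> U \<longleftrightarrow> openin (mtop M) U \<and> G_invariant G \<phi> U \<and>
     (\<exists>m N N\<^sub>0 \<Phi>. m \<in> U \<and> isotropy_complement G L M \<phi> m N \<and> tube_nhd G M \<phi> m N N\<^sub>0 \<and>
        diffeomorphism (tube G L M \<phi> m N N\<^sub>0) (open_submanifold M U) \<Phi> \<and>
        (\<forall>h\<in>carrier G. \<forall>g\<in>carrier G. \<forall>\<nu>\<in>N\<^sub>0.
           \<Phi> (tube_class G M \<phi> m (h \<otimes>\<^bsub>G\<^esub> g, \<nu>)) = \<phi> h (\<Phi> (tube_class G M \<phi> m (g, \<nu>)))) \<and>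
        \<Phi> (tube_class G M \<phi> m (\<one>\<^bsub>G\<^esub>, 0)) = m)"

definition G_tubular_cover ::
  "('g, 'z) monoid_scheme \<Rightarrow> 'g manifold \<Rightarrow> 'a manifold \<Rightarrow> ('g \<Rightarrow> 'a \<Rightarrow> 'a) \<Rightarrow> 'a set set \<Rightarrow> bool" where
  "G_tubular_cover G L M \<phi> \<U> \<longleftrightarrow> (\<forall>U\<in>\<U>. G_tubular G L M \<phi> U) \<and> \<Union>\<U> = topspace (mtop M)"

text \<open>``As small as possible'' and ``fewest members'' mean least cardinality (\<open>\<lesssim>\<close>).\<close>

definition minimal_G_tubular_cover ::
  "('g, 'z) monoid_scheme \<Rightarrow> 'g manifold \<Rightarrow> 'a manifold \<Rightarrow> ('g \<Rightarrow> 'a \<Rightarrow> 'a) \<Rightarrow> 'a set set \<Rightarrow> bool" where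
  "minimal_G_tubular_cover G L M \<phi> \<V> \<longleftrightarrow>
     (\<exists>\<U>. G_tubular_cover G L M \<phi> \<U> \<and> \<V> \<subseteq> \<U> \<and>
        (let M' = (\<Union>\<beta>\<in>minimal_index G L M \<phi>. stratum G \<phi> \<beta>)
         in M' \<subseteq> \<Union>\<V> \<and> (\<forall>\<W>. \<W> \<subseteq> \<U> \<and> M' \<subseteq> \<Union>\<W> \<longrightarrow> \<V> \<lesssim> \<W>))) \<and>
     \<Union>\<V> = topspace (mtop M) \<and>
     (\<forall>\<beta>\<in>minimal_index G L M \<phi>.
        let M\<^sub>\<beta> = stratum G \<phi> \<beta>; X\<^sub>\<beta> = subtopology (mtop M) M\<^sub>\<beta>; \<V>\<^sub>\<beta> = {U \<inter> M\<^sub>\<beta> | U. U \<in> \<V>} - {{}}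
        in G_categorical_open_cover G \<phi> X\<^sub>\<beta> \<V>\<^sub>\<beta> \<and>
           (\<forall>\<C>. G_categorical_open_cover G \<phi> X\<^sub>\<beta> \<C> \<longrightarrow> \<V>\<^sub>\<beta> \<lesssim> \<C>))"

end

theory Submission
  imports Defs
begin

text \<open>
  The heart of the matter is that an equivariant deformation retraction \<open>H\<close> of an invariant set \<open>U\<close> onto an
  orbit cannot leave a minimal stratum \<open>M\<^sub>\<beta>\<close> (\<open>retraction_preserves_minimal_stratum\<close>). Along a path
  \<open>t \<mapsto> H(y, t)\<close> the stabilizer always contains that of \<open>y\<close>, by equivariance. Minimal strata are closed,
  so only openness of the set of times spent in \<open>M\<^sub>\<beta>\<close> is in question. Near a point \<open>z\<close> of \<open>M\<^sub>\<beta>\<close> every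
  stabilizer is contained in a conjugate of \<open>G\<^sub>z\<close>: a tube of the given cover that contains \<open>z\<close> retracts onto
  an orbit that also lies in \<open>M\<^sub>\<beta>\<close>. Hence near \<open>z\<close> the stabilizer along the path is caught between \<open>G\<^sub>z\<close>
  and a conjugate of \<open>G\<^sub>z\<close>, so it is constant, and a connected set with constant stabilizer that
  meets a stratum is contained in it.

  The last step uses that a compact subgroup of a Lie group is not a proper subgroup of any of its
  conjugates (\<open>stabilizer_not_properly_in_conjugate\<close>). This follows from the descending chain condition for
  compact subgroups (\<open>descending_chain_condition\<close>), which is obtained by elementary means: in a chart at
  the identity the product is the sum of the coordinates up to a second order error
  (\<open>local_norm_exists\<close>), so high powers of short elements can be followed along straight lines.

  Two consequences give the lower bound for the category of \<open>M\<close>: a categorical open set meets at most one minimal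
  stratum, since the core orbit lies in each one that it meets, and its trace on this stratum is again
  categorical. So the members of a categorical cover of \<open>M\<close> that meet a given minimal stratum cover it
  categorically, and these subfamilies are disjoint (\<open>sum_Cat_strata_le\<close>). For the upper bound, tubes are
  categorical (\<open>tubular_deformation_retract\<close>), and a minimal tubular cover has no more members than all
  its traces on minimal strata together (\<open>Cat_le_sum_Cat_strata\<close>).
\<close>

section \<open>Mean value estimates in coordinates\<close>

definition coord_box :: "nat \<Rightarrow> (nat \<Rightarrow> real) \<Rightarrow> real \<Rightarrow> (nat \<Rightarrow> real) set" where
  "coord_box N c \<delta> = {y \<in> topspace (Euclidean_space N). \<forall>i<N. \<bar>y i - c i\<bar> < \<delta>}"

lemma coord_box_mono: "\<delta> \<le> \<delta>' \<Longrightarrow> coord_box N c \<delta> \<subseteq> coord_box N c \<delta>'"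
  by (auto simp: coord_box_def intro: less_le_trans)

lemma coord_box_in_open:
  assumes S: "openin (Euclidean_space N) S" and c: "c \<in> S"
  shows "\<exists>\<delta>>0. coord_box N c \<delta> \<subseteq> S"
proof -
  obtain T where T: "openin (powertop_real UNIV) T" "S = T \<inter> {x. \<forall>i\<ge>N. x i = 0}"
    using S unfolding Euclidean_space_def openin_subtopology by blast
  then have "\<exists>U. finite {i. U i \<noteq> (UNIV :: real set)} \<and> (\<forall>i. open (U i)) \<and> c \<in> PiE UNIV U \<and> PiE UNIV U \<subseteq> T"
    using c by (simp add: openin_product_topology_alt)
  then obtain U where U: "\<And>i. open (U i)" "c \<in> PiE UNIV U" "PiE UNIV U \<subseteq> T"
    by blast
  have "\<exists>d. \<forall>i<N. d i > 0 \<and> ball (c i) (d i) \<subseteq> U i"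
    using U by (intro choice allI) (metis PiE_UNIV_domain UNIV_I PiE_E openE)
  then obtain d where d: "\<And>i. i < N \<Longrightarrow> d i > 0" "\<And>i. i < N \<Longrightarrow> ball (c i) (d i) \<subseteq> U i"
    by blast
  define \<delta> where "\<delta> = Min (insert 1 (d ` {..<N}))"
  have \<delta>: "\<delta> > 0" "\<And>i. i < N \<Longrightarrow> \<delta> \<le> d i"
    using d by (auto simp: \<delta>_def)
  have "y \<in> S" if y: "y \<in> coord_box N c \<delta>" for y
  proof -
    have "y i \<in> U i" for i
    proof (cases "i < N")
      case True
      then have "dist (c i) (y i) < d i"
        using y \<delta>(2)[OF True] by (auto simp: coord_box_def dist_real_def abs_minus_commute
            intro: less_le_trans)
      then show ?thesis using d(2)[OF True] by auto
    next
      case False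
      then have "y i = c i"
        using y c T(2) by (auto simp: coord_box_def topspace_Euclidean_space)
      then show ?thesis using U(2) by (auto simp: PiE_def Pi_def)
    qed
    then show ?thesis
      using U(3) y T(2) by (auto simp: coord_box_def topspace_Euclidean_space PiE_def Pi_def)
  qed
  then show ?thesis using \<delta> by blast
qed

lemma continuous_on_locally_bounded:
  assumes W: "openin (Euclidean_space N) W" and c: "c \<in> W" and g: "continuous_on W g"
  shows "\<exists>\<delta>>0. coord_box N c \<delta> \<subseteq> W \<and> (\<forall>y\<in>coord_box N c \<delta>. \<bar>g y\<bar> \<le> \<bar>g c\<bar> + (1::real))"
proof -
  have WE: "W \<subseteq> topspace (Euclidean_space N)"
    using W by (rule openin_subset)
  have "top_of_set W = subtopology (Euclidean_space N) W"
    using WE by (simp add: Euclidean_space_def subtopology_subtopology euclidean_product_topology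
        topspace_Euclidean_space inf_absorb2)
  moreover have "openin (top_of_set W) (W \<inter> g -` ball (g c) 1)"
    using g by (auto intro: continuous_openin_preimage_gen)
  ultimately have "openin (Euclidean_space N) (W \<inter> g -` ball (g c) 1)"
    using W openin_trans_full by metis
  then obtain \<delta> where "\<delta> > 0" "coord_box N c \<delta> \<subseteq> W \<inter> g -` ball (g c) 1"
    using coord_box_in_open c by (metis Int_iff centre_in_ball vimage_eq zero_less_one)
  then show ?thesis
    by (intro exI[of _ \<delta>]) (force simp: dist_real_def)
qed

text \<open>
  Moving from \<open>z'\<close> to \<open>z\<close> one coordinate at a time stays inside the box, and each move is an instance of
  the mean value theorem in one variable. The bound is demanded only at points that agree with \<open>z'\<close>
  beyond \<open>m\<close>, so that for mixed differences \<open>B\<close> may depend on the fixed last coordinates.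
\<close>

lemma coordinatewise_mean_value:
  fixes h :: "(nat \<Rightarrow> real) \<Rightarrow> real"
  assumes "z \<in> coord_box N c \<delta>" "z' \<in> coord_box N c \<delta>" "m \<le> N" "\<And>i. m \<le> i \<Longrightarrow> z i = z' i"
    and "\<And>y j. y \<in> coord_box N c \<delta> \<Longrightarrow> (\<And>i. m \<le> i \<Longrightarrow> y i = z' i) \<Longrightarrow> j < m \<Longrightarrow>
           (\<lambda>t. h (y(j := t))) differentiable at (y j) \<and> \<bar>partial_deriv j h y\<bar> \<le> B"
  shows "\<bar>h z - h z'\<bar> \<le> B * (\<Sum>i<m. \<bar>z i - z' i\<bar>)"
  using assms
proof (induction m arbitrary: z)
  case 0
  then have "z = z'" by auto
  then show ?case by simp
next
  case (Suc m)
  define w where "w = z(m := z' m)"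
  have w: "w \<in> coord_box N c \<delta>"
    using Suc.prems(1-3) by (auto simp: w_def coord_box_def topspace_Euclidean_space)
  have "\<bar>h w - h z'\<bar> \<le> B * (\<Sum>i<m. \<bar>w i - z' i\<bar>)"
  proof (rule Suc.IH[OF w Suc.prems(2)])
    show "w i = z' i" if "m \<le> i" for i
      using that Suc.prems(4)[of i] by (cases "i = m") (auto simp: w_def)
    show "(\<lambda>t. h (y(j := t))) differentiable at (y j) \<and> \<bar>partial_deriv j h y\<bar> \<le> B"
      if "y \<in> coord_box N c \<delta>" "\<And>i. m \<le> i \<Longrightarrow> y i = z' i" "j < m" for y j
      using Suc.prems(5)[OF that(1) _ less_SucI[OF that(3)]] that(2) Suc_leD by blast
  qed (use Suc.prems in auto)
  moreover have "\<bar>h z - h w\<bar> \<le> B * \<bar>z m - z' m\<bar>"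
  proof -
    let ?S = "{t. \<bar>t - c m\<bar> < \<delta>}"
    let ?s = "\<lambda>t. h (z(m := t))"
    have "?S = ball (c m) \<delta>" by (auto simp: dist_real_def)
    then have "convex ?S" by (metis convex_ball)
    moreover have "(?s has_field_derivative deriv ?s t) (at t within ?S) \<and> \<bar>deriv ?s t\<bar> \<le> B"
      if "t \<in> ?S" for t
    proof -
      have "z(m := t) \<in> coord_box N c \<delta>"
        using Suc.prems(1,3) that by (auto simp: coord_box_def topspace_Euclidean_space)
      then have "(\<lambda>r. h ((z(m := t))(m := r))) differentiable at ((z(m := t)) m)
          \<and> \<bar>partial_deriv m h (z(m := t))\<bar> \<le> B"
        by (rule Suc.prems(5)) (use Suc.prems(4) in auto)
      then have "?s differentiable at t" "\<bar>deriv ?s t\<bar> \<le> B"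
        by (simp_all only: partial_deriv_def fun_upd_upd fun_upd_same)
      then show ?thesis
        by (metis DERIV_deriv_iff_real_differentiable has_field_derivative_at_within)
    qed
    moreover have "z m \<in> ?S" "z' m \<in> ?S"
      using Suc.prems(1-3) by (auto simp: coord_box_def)
    ultimately have "norm (?s (z m) - ?s (z' m)) \<le> B * norm (z m - z' m)"
      by (intro field_differentiable_bound[where S = ?S and f' = "deriv ?s"])
         (simp_all only: real_norm_def)
    then show ?thesis by (simp add: w_def)
  qed
  moreover have "(\<Sum>i<m. \<bar>w i - z' i\<bar>) = (\<Sum>i<m. \<bar>z i - z' i\<bar>)"
    by (intro sum.cong) (auto simp: w_def)
  ultimately show ?case by (simp add: algebra_simps)
qed

lemma C1_locally_Lipschitz:
  assumes W: "openin (Euclidean_space N) W" and c: "c \<in> W" and f: "Ck_on N (Suc 0) W f"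
  shows "\<exists>\<delta>>0. \<exists>B\<ge>0. coord_box N c \<delta> \<subseteq> W \<and>
           (\<forall>z\<in>coord_box N c \<delta>. \<forall>z'\<in>coord_box N c \<delta>. \<bar>f z - f z'\<bar> \<le> B * (\<Sum>i<N. \<bar>z i - z' i\<bar>))"
proof -
  have "\<forall>j. \<exists>\<delta>. j < N \<longrightarrow> \<delta> > 0 \<and> coord_box N c \<delta> \<subseteq> W \<and>
          (\<forall>y\<in>coord_box N c \<delta>. \<bar>partial_deriv j f y\<bar> \<le> \<bar>partial_deriv j f c\<bar> + 1)"
    using continuous_on_locally_bounded[OF W c] f by auto
  then obtain d where d: "\<And>j. j < N \<Longrightarrow> d j > 0"
    "\<And>j y. j < N \<Longrightarrow> y \<in> coord_box N c (d j) \<Longrightarrow> \<bar>partial_deriv j f y\<bar> \<le> \<bar>partial_deriv j f c\<bar> + 1"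
    by metis
  obtain e where e: "e > 0" "coord_box N c e \<subseteq> W"
    using coord_box_in_open[OF W c] by blast
  define \<delta> where "\<delta> = Min (insert e (d ` {..<N}))"
  have \<delta>: "\<delta> > 0" "\<delta> \<le> e" "\<And>i. i < N \<Longrightarrow> \<delta> \<le> d i"
    using d e by (auto simp: \<delta>_def)
  define B where "B = (\<Sum>j<N. \<bar>partial_deriv j f c\<bar> + 1)"
  have B: "\<bar>partial_deriv j f c\<bar> + 1 \<le> B" if "j < N" for j
    unfolding B_def using that by (intro member_le_sum) auto
  have sub: "coord_box N c \<delta> \<subseteq> W"
    using e coord_box_mono[OF \<delta>(2)] by blast
  have "\<bar>f z - f z'\<bar> \<le> B * (\<Sum>i<N. \<bar>z i - z' i\<bar>)"
    if z: "z \<in> coord_box N c \<delta>" "z' \<in> coord_box N c \<delta>" for z z'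
  proof (rule coordinatewise_mean_value[OF z])
    show "z i = z' i" if "N \<le> i" for i
      using z that by (auto simp: coord_box_def topspace_Euclidean_space)
    show "(\<lambda>t. f (y(j := t))) differentiable at (y j) \<and> \<bar>partial_deriv j f y\<bar> \<le> B"
      if y: "y \<in> coord_box N c \<delta>" and j: "j < N" for y j
    proof
      show "(\<lambda>t. f (y(j := t))) differentiable at (y j)"
        using f j y sub by auto
      show "\<bar>partial_deriv j f y\<bar> \<le> B"
        using d(2)[OF j] B[OF j] y coord_box_mono[OF \<delta>(3)[OF j], of N c] by force
    qed
  qed simp
  moreover have "B \<ge> 0"
    by (auto simp: B_def intro: sum_nonneg)
  ultimately show ?thesis using \<delta> sub by blast
qed

text \<open>
  Here \<open>c\<close> is the base point, and a point \<open>z\<close> splits into a head of \<open>n\<close> and a tail of \<open>m\<close> coordinates.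
  With the tail fixed, the function \<open>f z - f (r z)\<close>, where \<open>r\<close> resets the tail to that of \<open>c\<close>, has
  partial derivatives that are differences of values of \<open>partial_deriv j f\<close>; these are of the order of
  the tail by the Lipschitz estimate. The mean value theorem in the head contributes the second factor.
\<close>

lemma C2_mixed_second_difference:
  assumes W: "openin (Euclidean_space (n + m)) W" and c: "c \<in> W"
    and f: "Ck_on (n + m) (Suc (Suc 0)) W f"
  shows "\<exists>\<delta>>0. \<exists>B\<ge>0. coord_box (n + m) c \<delta> \<subseteq> W \<and> (\<forall>z\<in>coord_box (n + m) c \<delta>.
           \<bar>f z - f (\<lambda>i. if i < n then z i else c i) - f (\<lambda>i. if i < n then c i else z i) + f c\<bar>
             \<le> B * (\<Sum>i<n. \<bar>z i - c i\<bar>) * (\<Sum>i<m. \<bar>z (n + i) - c (n + i)\<bar>))"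
proof -
  let ?N = "n + m"
  have cE: "c \<in> topspace (Euclidean_space ?N)"
    using c openin_subset[OF W] by blast
  have "\<forall>j. \<exists>\<delta> B. j < n \<longrightarrow> \<delta> > 0 \<and> B \<ge> 0 \<and> coord_box ?N c \<delta> \<subseteq> W \<and>
         (\<forall>z\<in>coord_box ?N c \<delta>. \<forall>z'\<in>coord_box ?N c \<delta>.
            \<bar>partial_deriv j f z - partial_deriv j f z'\<bar> \<le> B * (\<Sum>i<?N. \<bar>z i - z' i\<bar>))"
    using C1_locally_Lipschitz[OF W c] f by (meson Ck_on.simps(2) trans_less_add1)
  then obtain d where "\<forall>j. \<exists>B. j < n \<longrightarrow> d j > 0 \<and> B \<ge> 0 \<and> coord_box ?N c (d j) \<subseteq> W \<and>
         (\<forall>z\<in>coord_box ?N c (d j). \<forall>z'\<in>coord_box ?N c (d j).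
            \<bar>partial_deriv j f z - partial_deriv j f z'\<bar> \<le> B * (\<Sum>i<?N. \<bar>z i - z' i\<bar>))"
    unfolding choice_iff by blast
  then obtain b where db: "\<forall>j. j < n \<longrightarrow> d j > 0 \<and> b j \<ge> 0 \<and> coord_box ?N c (d j) \<subseteq> W \<and>
         (\<forall>z\<in>coord_box ?N c (d j). \<forall>z'\<in>coord_box ?N c (d j).
            \<bar>partial_deriv j f z - partial_deriv j f z'\<bar> \<le> b j * (\<Sum>i<?N. \<bar>z i - z' i\<bar>))"
    unfolding choice_iff by blast
  then have d: "\<And>j. j < n \<Longrightarrow> d j > 0" and b: "\<And>j. j < n \<Longrightarrow> b j \<ge> (0::real)"
    and Lip: "\<And>j z z'. j < n \<Longrightarrow> z \<in> coord_box ?N c (d j) \<Longrightarrow> z' \<in> coord_box ?N c (d j) \<Longrightarrow>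
       \<bar>partial_deriv j f z - partial_deriv j f z'\<bar> \<le> b j * (\<Sum>i<?N. \<bar>z i - z' i\<bar>)"
    by blast+
  obtain e where e: "e > 0" "coord_box ?N c e \<subseteq> W"
    using coord_box_in_open[OF W c] by blast
  define \<delta> where "\<delta> = Min (insert e (d ` {..<n}))"
  have \<delta>: "\<delta> > 0" "\<delta> \<le> e" "\<And>i. i < n \<Longrightarrow> \<delta> \<le> d i"
    using d e by (auto simp: \<delta>_def)
  have sub: "coord_box ?N c \<delta> \<subseteq> W"
    using e coord_box_mono[OF \<delta>(2)] by blast
  define B where "B = (\<Sum>j<n. b j)"
  have B: "b j \<le> B" if "j < n" for j
    unfolding B_def using that b by (intro member_le_sum) auto
  have "B \<ge> 0"
    using b by (auto simp: B_def intro: sum_nonneg)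
  define r where "r = (\<lambda>z i. if i < n then z i else c i)"
  have r_box: "r y \<in> coord_box ?N c \<delta>" if "y \<in> coord_box ?N c \<delta>" for y
    using that cE \<delta>(1) by (auto simp: r_def coord_box_def topspace_Euclidean_space)
  define h where "h = (\<lambda>z. f z - f (r z))"
  have main: "\<bar>f z - f (r z) - f (\<lambda>i. if i < n then c i else z i) + f c\<bar>
     \<le> B * (\<Sum>i<n. \<bar>z i - c i\<bar>) * (\<Sum>i<m. \<bar>z (n + i) - c (n + i)\<bar>)"
    if z: "z \<in> coord_box ?N c \<delta>" for z
  proof -
    define z' where "z' = (\<lambda>i. if i < n then c i else z i)"
    define T where "T = (\<Sum>i<m. \<bar>z (n + i) - c (n + i)\<bar>)"
    have z': "z' \<in> coord_box ?N c \<delta>"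
      using z cE \<delta>(1) by (auto simp: z'_def coord_box_def topspace_Euclidean_space)
    have "\<bar>h z - h z'\<bar> \<le> (B * T) * (\<Sum>i<n. \<bar>z i - z' i\<bar>)"
    proof (rule coordinatewise_mean_value[OF z z'])
      show "z i = z' i" if "n \<le> i" for i
        using that by (simp add: z'_def)
      show "(\<lambda>t. h (y(j := t))) differentiable at (y j) \<and> \<bar>partial_deriv j h y\<bar> \<le> B * T"
        if y: "y \<in> coord_box ?N c \<delta>" "\<And>i. n \<le> i \<Longrightarrow> y i = z' i" and j: "j < n" for y j
      proof -
        have ry: "r (y(j := t)) = (r y)(j := t)" for t
          using j by (auto simp: r_def)
        have d1: "(\<lambda>t. f (y(j := t))) differentiable at (y j)"
          using f j y sub by auto
        have "(\<lambda>t. f ((r y)(j := t))) differentiable at (r y j)"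
          using f j r_box[OF y(1)] sub by auto
        then have d2: "(\<lambda>t. f ((r y)(j := t))) differentiable at (y j)"
          using j by (simp add: r_def)
        have "partial_deriv j h y = partial_deriv j f y - partial_deriv j f (r y)"
        proof -
          have "((\<lambda>t. h (y(j := t))) has_field_derivative
              deriv (\<lambda>t. f (y(j := t))) (y j) - deriv (\<lambda>t. f ((r y)(j := t))) (y j)) (at (y j))"
            unfolding h_def ry using d1 d2
            by (intro derivative_intros) (simp_all add: DERIV_deriv_iff_real_differentiable)
          then show ?thesis
            using j by (simp add: partial_deriv_def DERIV_imp_deriv r_def)
        qed
        moreover have "\<bar>partial_deriv j f y - partial_deriv j f (r y)\<bar> \<le> b j * (\<Sum>i<?N. \<bar>y i - r y i\<bar>)"
          using Lip[OF j] y(1) r_box[OF y(1)] coord_box_mono[OF \<delta>(3)[OF j], of ?N c] by blast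
        moreover have "(\<Sum>i<?N. \<bar>y i - r y i\<bar>) = T"
        proof -
          have split: "(\<Sum>i<n + k. g i) = (\<Sum>i<n. g i) + (\<Sum>i<k. g (n + i))" for g :: "nat \<Rightarrow> real" and k
            by (induction k) auto
          show ?thesis
            unfolding T_def split using y(2) by (simp add: r_def z'_def)
        qed
        moreover have "b j * T \<le> B * T"
          using B[OF j] by (intro mult_right_mono) (auto simp: T_def intro: sum_nonneg)
        ultimately have "\<bar>partial_deriv j h y\<bar> \<le> B * T" by simp
        moreover have "(\<lambda>t. h (y(j := t))) differentiable at (y j)"
          unfolding h_def ry using d1 d2 by (rule differentiable_diff)
        ultimately show ?thesis by blast
      qed
    qed simp
    moreover have "(\<Sum>i<n. \<bar>z i - z' i\<bar>) = (\<Sum>i<n. \<bar>z i - c i\<bar>)"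
      by (simp add: z'_def)
    moreover have "r z' = c"
      by (auto simp: r_def z'_def)
    ultimately show ?thesis
      by (simp add: h_def z'_def T_def algebra_simps)
  qed
  then show ?thesis
    using \<delta>(1) \<open>B \<ge> 0\<close> sub unfolding r_def by blast
qed

section \<open>The descending chain condition for compact subgroups of a Lie group\<close>

lemma bounded_coordinates_convergent_subseq:
  fixes u :: "nat \<Rightarrow> nat \<Rightarrow> real"
  assumes "\<And>k i. \<bar>u k i\<bar> \<le> 1"
  shows "\<exists>l \<sigma>. strict_mono \<sigma> \<and> (\<forall>i. (\<lambda>k. u (\<sigma> k) i) \<longlonglongrightarrow> l i)"
proof -
  have "compactin (powertop_real UNIV) (PiE UNIV (\<lambda>i. {-1..1}))"
    by (simp add: compactin_PiE)
  then have "compact (PiE UNIV (\<lambda>i::nat. {-1..1::real}))"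
    by (simp add: euclidean_product_topology)
  moreover have "\<forall>k. u k \<in> PiE UNIV (\<lambda>i. {-1..1})"
    using assms by (auto simp: abs_le_iff minus_le_iff)
  ultimately obtain l \<sigma> where "strict_mono \<sigma>" "(u \<circ> \<sigma>) \<longlonglongrightarrow> l"
    unfolding compact_def by metis
  then have "(\<lambda>k. u (\<sigma> k) i) \<longlonglongrightarrow> l i" for i
    using continuous_on_tendsto_compose[OF continuous_on_product_coordinates[of i], of "u \<circ> \<sigma>" l]
    by (simp add: o_def)
  then show ?thesis using \<open>strict_mono \<sigma>\<close> by blast
qed

lemma compact_decreasing_meets_closed:
  assumes "\<And>j. compactin X (K j)" "Hausdorff_space X" "\<And>j. K (Suc j) \<subseteq> K j"
    and "closedin X E" "\<And>N. \<exists>j\<ge>N. K j \<inter> E \<noteq> {}"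
  shows "(\<Inter>j. K j) \<inter> E \<noteq> {}"
proof -
  have dec: "K j \<subseteq> K i" if "i \<le> j" for i j :: nat
    using that assms(3) by (rule lift_Suc_antimono_le[rotated])
  have "compact_space (subtopology X (K 0))"
    using assms(1)[of 0] compactin_subspace by blast
  moreover have "closedin (subtopology X (K 0)) (K j \<inter> E)" for j
    using closedin_subset_topspace[of X "K j \<inter> E" "K 0"] closedin_Int[of X "K j" E]
      compactin_imp_closedin[OF assms(2,1)] assms(4) dec[of 0 j] by blast
  moreover have "K j \<inter> E \<noteq> {}" for j
    using assms(5)[of j] dec by blast
  moreover have "decseq (\<lambda>j. K j \<inter> E)"
    using dec by (auto simp: decseq_def)
  ultimately have "(\<Inter>j. K j \<inter> E) \<noteq> {}"
    by (rule compact_space_imp_nest)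
  then show ?thesis by blast
qed

context lie_group
begin

lemma Hausdorff_L: "Hausdorff_space (mtop L)"
  using manifold_L by (simp add: smooth_manifold_def)

lemma continuous_mult:
  "continuous_map X (mtop L) f \<Longrightarrow> continuous_map X (mtop L) h \<Longrightarrow> continuous_map X (mtop L) (\<lambda>x. f x \<otimes> h x)"
  using continuous_map_compose[of X "prod_topology (mtop L) (mtop L)" "\<lambda>x. (f x, h x)" "mtop L" "\<lambda>(g, h). g \<otimes> h"]
    smooth_mult by (simp add: smooth_map_def prod_manifold_def continuous_map_paired o_def)

lemma continuous_inv:
  "continuous_map X (mtop L) f \<Longrightarrow> continuous_map X (mtop L) (\<lambda>x. inv (f x))"
  using continuous_map_compose[of X "mtop L" f "mtop L" "\<lambda>g. inv g"] smooth_inv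
  by (simp add: smooth_map_def o_def)

lemma one_in_topspace: "\<one> \<in> topspace (mtop L)"
  by (simp add: topspace_L)

end

text \<open>
  A local norm consists of \<open>n\<close> real coordinates \<open>P\<close> on a neighbourhood \<open>V\<close> of the identity, centred at
  it, for which multiplication is addition up to an error of second order. This is all of the smooth
  structure that the descending chain condition needs; the length of a group element is the
  sum of the absolute values of its coordinates.
\<close>

locale local_norm = lie_group G L for G :: "('g, 'z) monoid_scheme" (structure) and L :: "'g manifold" +
  fixes n :: nat and P :: "'g \<Rightarrow> nat \<Rightarrow> real" and V :: "'g set" and \<rho> A :: real
  assumes V: "openin (mtop L) V" "\<one> \<in> V"
    and \<rho>: "0 < \<rho>" and A: "0 \<le> A"
    and P_one: "\<And>i. P \<one> i = 0"
    and P_cont: "\<And>i. i < n \<Longrightarrow> continuous_map (subtopology (mtop L) V) euclideanreal (\<lambda>g. P g i)"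
    and small: "\<And>W. openin (mtop L) W \<Longrightarrow> \<one> \<in> W \<Longrightarrow> \<exists>r>0. {g \<in> V. (\<Sum>i<n. \<bar>P g i\<bar>) < r} \<subseteq> W"
    and almost_additive: "\<And>g h. g \<in> V \<Longrightarrow> h \<in> V \<Longrightarrow> (\<Sum>i<n. \<bar>P g i\<bar>) < \<rho> \<Longrightarrow> (\<Sum>i<n. \<bar>P h i\<bar>) < \<rho> \<Longrightarrow>
      g \<otimes> h \<in> V \<and> (\<Sum>i<n. \<bar>P (g \<otimes> h) i - P g i - P h i\<bar>) \<le> A * (\<Sum>i<n. \<bar>P g i\<bar>) * (\<Sum>i<n. \<bar>P h i\<bar>)"
begin

definition len :: "'g \<Rightarrow> real" where
  "len g = (\<Sum>i<n. \<bar>P g i\<bar>)"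

lemma len_nonneg: "0 \<le> len g"
  by (auto simp: len_def intro: sum_nonneg)

lemma len_one: "len \<one> = 0"
  by (simp add: len_def P_one)

lemma V_carrier: "V \<subseteq> carrier G"
  using openin_subset[OF V(1)] topspace_L by simp

lemma dist_cont: "continuous_map (subtopology (mtop L) V) euclideanreal (\<lambda>g. \<Sum>i<n. \<bar>P g i - b i\<bar>)"
  using P_cont by (intro continuous_map_sum continuous_map_real_abs continuous_map_diff) auto

lemma len_cont: "continuous_map (subtopology (mtop L) V) euclideanreal len"
  using dist_cont[of "\<lambda>i. 0"] by (simp add: len_def[abs_def])

lemma open_in_V:
  assumes "continuous_map (subtopology (mtop L) V) euclideanreal f" "open S"
  shows "openin (mtop L) {g \<in> V. f g \<in> S}"
proof -
  have "openin (subtopology (mtop L) V) {g \<in> topspace (subtopology (mtop L) V). f g \<in> S}"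
    using assms by (intro openin_continuous_map_preimage) auto
  moreover have "topspace (subtopology (mtop L) V) = V"
    using openin_subset[OF V(1)] by auto
  ultimately show ?thesis
    using V(1) openin_trans_full by metis
qed

lemma small_open: "0 < r \<Longrightarrow> openin (mtop L) {g \<in> V. len g < r} \<and> \<one> \<in> {g \<in> V. len g < r}"
  using open_in_V[OF len_cont, of "{..<r}"] V(2) len_one by simp

lemma eq_one_if_len_zero:
  assumes "g \<in> V" "len g = 0"
  shows "g = \<one>"
proof (rule ccontr)
  assume "g \<noteq> \<one>"
  then obtain U W where "openin (mtop L) U" "openin (mtop L) W" "\<one> \<in> U" "g \<in> W" "disjnt U W"
    using Hausdorff_L[unfolded Hausdorff_space_def, rule_format, of \<one> g] one_in_topspace
      assms(1) V_carrier topspace_L by blast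
  then show False
    using small[of U] assms by (force simp: len_def disjnt_iff)
qed

text \<open>
  A ball is closed in \<open>V\<close>, but its closure in the group might leave \<open>V\<close>. It does not if the radius is
  small: a point \<open>x\<close> of the closure is a product of some \<open>y\<close> in the ball and \<open>y\<^sup>-\<^sup>1x\<close> near the
  identity, and products of elements near the identity lie in \<open>V\<close>.
\<close>

lemma closed_balls: "\<exists>r>0. \<forall>s\<le>r. closedin (mtop L) {g \<in> V. len g \<le> s}"
proof -
  have "openin (prod_topology (mtop L) (mtop L))
      {z \<in> topspace (prod_topology (mtop L) (mtop L)). (case z of (g, h) \<Rightarrow> g \<otimes> h) \<in> V}"
    using smooth_mult V(1)
    by (intro openin_continuous_map_preimage) (auto simp: smooth_map_def prod_manifold_def)
  moreover have "(\<one>, \<one>) \<in> {z \<in> topspace (prod_topology (mtop L) (mtop L)). (case z of (g, h) \<Rightarrow> g \<otimes> h) \<in> V}"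
    using V(2) by (simp add: one_in_topspace)
  ultimately obtain O1 O2 where O: "openin (mtop L) O1" "openin (mtop L) O2" "\<one> \<in> O1" "\<one> \<in> O2"
    "O1 \<times> O2 \<subseteq> {z \<in> topspace (prod_topology (mtop L) (mtop L)). (case z of (g, h) \<Rightarrow> g \<otimes> h) \<in> V}"
    unfolding openin_prod_topology_alt by meson
  obtain r where r: "r > 0" "{g \<in> V. len g < r} \<subseteq> O1"
    using small[OF O(1,3)] by (auto simp: len_def)
  have "closedin (mtop L) {g \<in> V. len g \<le> s}" if "s \<le> r / 2" for s
  proof -
    let ?B = "{g \<in> V. len g \<le> s}"
    have "\<exists>N. openin (mtop L) N \<and> x \<in> N \<and> N \<subseteq> topspace (mtop L) - ?B"
      if x: "x \<in> topspace (mtop L) - ?B" for x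
    proof (cases "x \<in> V")
      case True
      then show ?thesis
        using x open_in_V[OF len_cont, of "{s<..}"] openin_subset[OF V(1)]
        by (intro exI[of _ "{g \<in> V. len g \<in> {s<..}}"]) auto
    next
      case False
      let ?N = "{y \<in> topspace (mtop L). inv y \<otimes> x \<in> O2}"
      have xc: "x \<in> carrier G" using x topspace_L by auto
      have "openin (mtop L) ?N"
        using O(2) x
        by (intro openin_continuous_map_preimage[of _ "mtop L"] continuous_mult continuous_inv)
           (auto simp: continuous_map_const)
      moreover have "x \<in> ?N" using x xc O(4) by (simp add: topspace_L)
      moreover have "y \<notin> ?B" if "y \<in> ?N" for y
      proof
        assume "y \<in> ?B"
        then have "y \<in> O1" using r \<open>s \<le> r / 2\<close> by (auto simp: subset_iff)
        then have "y \<otimes> (inv y \<otimes> x) \<in> V"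
          using O(5) that by (auto simp: subset_iff)
        moreover have "y \<otimes> (inv y \<otimes> x) = x"
          using that xc by (simp add: topspace_L m_assoc[symmetric])
        ultimately show False using False by simp
      qed
      ultimately show ?thesis by blast
    qed
    then have "openin (mtop L) (topspace (mtop L) - ?B)"
      by (subst openin_subopen) blast
    then show ?thesis
      using openin_subset[OF V(1)] by (auto simp: closedin_def)
  qed
  then show ?thesis using r(1) by (intro exI[of _ "r/2"]) auto
qed

text \<open>
  Up to a second order error, taking powers multiplies coordinates. Each new factor contributes an
  error of at most \<open>2 A m (len x)\<^sup>2\<close>, and these add up to \<open>A (m len x)\<^sup>2\<close>. The bounds on
  \<open>\<tau>\<close> keep the powers no longer than \<open>2 m len x\<close>, within the range of the second order estimate.
\<close>

lemma power_estimate: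
  assumes x: "x \<in> V" and m: "real m * len x \<le> \<tau>" and \<tau>: "2 * \<tau> < \<rho>" "A * \<tau> \<le> 1"
  shows "x [^] m \<in> V \<and> (\<Sum>i<n. \<bar>P (x [^] m) i - real m * P x i\<bar>) \<le> A * (real m * len x)\<^sup>2"
  using m
proof (induction m)
  case 0
  then show ?case using V by (simp add: P_one)
next
  case (Suc m)
  let ?e = "real m * len x" and ?y = "x [^] m"
  have xc: "x \<in> carrier G" using x V_carrier by blast
  have e: "?e \<le> \<tau>" "0 \<le> ?e" "len x \<le> \<tau>"
    using Suc.prems len_nonneg[of x] by (auto simp: algebra_simps intro: order_trans[OF _ Suc.prems])
  then have y: "?y \<in> V" "(\<Sum>i<n. \<bar>P ?y i - real m * P x i\<bar>) \<le> A * ?e\<^sup>2"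
    using Suc.IH by auto
  have "len ?y \<le> (\<Sum>i<n. \<bar>P ?y i - real m * P x i\<bar> + real m * \<bar>P x i\<bar>)"
    unfolding len_def
  proof (intro sum_mono)
    show "\<bar>P ?y i\<bar> \<le> \<bar>P ?y i - real m * P x i\<bar> + real m * \<bar>P x i\<bar>" for i
      using abs_triangle_ineq[of "P ?y i - real m * P x i" "real m * P x i"] by (simp add: abs_mult)
  qed
  also have "\<dots> = (\<Sum>i<n. \<bar>P ?y i - real m * P x i\<bar>) + ?e"
    by (simp add: sum.distrib sum_distrib_left len_def)
  also have "\<dots> \<le> A * ?e\<^sup>2 + ?e" using y by simp
  also have "A * ?e\<^sup>2 \<le> ?e"
  proof -
    have "A * ?e \<le> 1" using e A \<tau>(2) by (meson mult_left_mono order_trans)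
    then have "(A * ?e) * ?e \<le> 1 * ?e" using e(2) by (intro mult_right_mono) auto
    then show ?thesis by (simp add: power2_eq_square)
  qed
  finally have leny: "len ?y \<le> 2 * ?e" by simp
  have "len ?y < \<rho>" "len x < \<rho>" using leny e \<tau>(1) by linarith+
  then have st: "?y \<otimes> x \<in> V" "(\<Sum>i<n. \<bar>P (?y \<otimes> x) i - P ?y i - P x i\<bar>) \<le> A * len ?y * len x"
    using almost_additive[OF y(1) x] by (auto simp: len_def)
  have "(\<Sum>i<n. \<bar>P (?y \<otimes> x) i - real (Suc m) * P x i\<bar>)
      \<le> (\<Sum>i<n. \<bar>P (?y \<otimes> x) i - P ?y i - P x i\<bar> + \<bar>P ?y i - real m * P x i\<bar>)"
    by (intro sum_mono) (auto simp: algebra_simps)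
  also have "\<dots> \<le> A * len ?y * len x + A * ?e\<^sup>2"
    using st y by (simp add: sum.distrib)
  also have "\<dots> \<le> A * (2 * ?e) * len x + A * ?e\<^sup>2"
    using leny A len_nonneg[of x] by (intro add_right_mono mult_right_mono mult_left_mono) auto
  also have "\<dots> \<le> A * (real (Suc m) * len x)\<^sup>2"
  proof -
    have "2 * ?e * len x + ?e\<^sup>2 \<le> (real (Suc m) * len x)\<^sup>2"
      by (simp add: power2_eq_square algebra_simps)
    then have "A * (2 * ?e * len x + ?e\<^sup>2) \<le> A * (real (Suc m) * len x)\<^sup>2"
      using A by (rule mult_left_mono)
    then show ?thesis by (simp add: algebra_simps)
  qed
  finally show ?case using st xc by simp
qed


text \<open>
  If the decreasing compact groups never reach their intersection \<open>C\<close>, then each of them contains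
  arbitrarily short elements that are transversal to \<open>C\<close>, in the sense that no element of their coset
  of \<open>C\<close> is shorter.
\<close>

lemma coset_representative_of_minimal_length:
  assumes K: "\<And>j. subgroup (K j) G" "\<And>j. compactin (mtop L) (K j)" "\<And>j. K (Suc j) \<subseteq> K j"
    and ne: "\<And>j. K j \<noteq> (\<Inter>i. K i)"
    and r: "0 < r" "closedin (mtop L) {g \<in> V. len g \<le> r}"
  shows "\<exists>w\<in>K k. w \<in> V \<and> w \<notin> (\<Inter>i. K i) \<and> len w < r \<and>
           (\<forall>c\<in>\<Inter>i. K i. w \<otimes> c \<in> V \<longrightarrow> len w \<le> len (w \<otimes> c))"
proof -
  define C where "C = (\<Inter>i. K i)"
  have Kc: "K j \<subseteq> carrier G" for j using K(1) by (rule subgroup.subset)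
  have C: "subgroup C G"
    unfolding C_def by (rule subgroups_Inter) (use K(1) in auto)
  have CK: "C \<subseteq> K j" for j unfolding C_def by blast
  have Kcl: "closedin (mtop L) (K j)" for j
    using compactin_imp_closedin Hausdorff_L K(2) by blast
  have Ccl: "closedin (mtop L) C"
    unfolding C_def using Kcl by blast
  have dec: "K j \<subseteq> K i" if "i \<le> j" for i j :: nat
    using that K(3) by (rule lift_Suc_antimono_le[rotated])
  let ?O = "{g \<in> V. len g < r}" and ?B = "{g \<in> V. len g \<le> r}"
  have O: "openin (mtop L) ?O" "\<one> \<in> ?O" using small_open[OF r(1)] by auto
  \<comment> \<open>\<open>C \<cdot> O\<close> is an open neighbourhood of \<open>C\<close>, so it swallows \<open>K\<^sub>j\<close> for large \<open>j\<close>\<close>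
  define N where "N = (\<Union>c\<in>C. {y \<in> topspace (mtop L). inv c \<otimes> y \<in> ?O})"
  have N: "openin (mtop L) N"
    unfolding N_def
  proof (intro openin_Union ballI, clarify)
    fix c assume "c \<in> C"
    then have "inv c \<in> topspace (mtop L)"
      using C topspace_L subgroup.mem_carrier by fastforce
    then show "openin (mtop L) {y \<in> topspace (mtop L). inv c \<otimes> y \<in> ?O}"
      by (intro openin_continuous_map_preimage[OF _ O(1)] continuous_mult) auto
  qed
  have CN: "C \<subseteq> N"
    using C O(2) topspace_L subgroup.mem_carrier[OF C] by (force simp: N_def)
  have "\<exists>j\<ge>k. K j \<subseteq> N"
  proof (rule ccontr)
    assume "\<not> (\<exists>j\<ge>k. K j \<subseteq> N)"
    then have "\<not> K (max M k) \<subseteq> N" for M by (meson max.cobounded2)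
    then have "K (max M k) \<inter> (topspace (mtop L) - N) \<noteq> {}" for M
      using Kc topspace_L by blast
    then have "\<exists>j\<ge>M. K j \<inter> (topspace (mtop L) - N) \<noteq> {}" for M
      by (meson max.cobounded1)
    then have "(\<Inter>j. K j) \<inter> (topspace (mtop L) - N) \<noteq> {}"
      by (intro compact_decreasing_meets_closed[where K = K, OF K(2) Hausdorff_L K(3)])
         (use N in auto)
    then show False using CN by (auto simp: C_def)
  qed
  then obtain j where j: "k \<le> j" "K j \<subseteq> N" by blast
  obtain x where x: "x \<in> K j" "x \<notin> C" using ne[of j] CK[of j] by (auto simp: C_def)
  then obtain c where c: "c \<in> C" "inv c \<otimes> x \<in> ?O" using j by (auto simp: N_def)
  define w0 where "w0 = inv c \<otimes> x"
  have cc: "c \<in> carrier G" by (rule subgroup.mem_carrier[OF C c(1)])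
  have xc: "x \<in> carrier G" using x Kc by blast
  have "c \<in> K j" using c CK by blast
  then have "w0 \<in> K j"
    unfolding w0_def
    by (intro subgroup.m_closed[OF K(1)[of j]] subgroup.m_inv_closed[OF K(1)[of j]] x(1))
  then have w0: "w0 \<in> K j" "w0 \<in> ?O" "w0 \<in> carrier G"
    using c(2) Kc unfolding w0_def by blast+
  have w0C: "w0 \<notin> C"
  proof
    assume "w0 \<in> C"
    then have "c \<otimes> w0 \<in> C" by (rule subgroup.m_closed[OF C c(1)])
    moreover have "c \<otimes> w0 = x" using cc xc by (simp add: w0_def m_assoc[symmetric])
    ultimately show False using x by simp
  qed
  \<comment> \<open>the part of the coset \<open>w\<^sub>0 C\<close> in the closed ball is compact, so the length attains its minimum there\<close>
  define D where "D = ?B \<inter> {y \<in> topspace (mtop L). inv w0 \<otimes> y \<in> C}"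
  have "closedin (mtop L) {y \<in> topspace (mtop L). inv w0 \<otimes> y \<in> C}"
    using w0 by (intro closedin_continuous_map_preimage[OF _ Ccl] continuous_mult) (auto simp: topspace_L)
  then have Dcl: "closedin (mtop L) D" unfolding D_def using r(2) by blast
  have DK: "D \<subseteq> K j"
  proof
    fix y assume "y \<in> D"
    then have y: "inv w0 \<otimes> y \<in> K j" "y \<in> carrier G"
      using CK[of j] topspace_L by (auto simp: D_def)
    have "w0 \<otimes> (inv w0 \<otimes> y) \<in> K j"
      by (rule subgroup.m_closed[OF K(1)[of j] w0(1) y(1)])
    then show "y \<in> K j" using w0(3) y(2) by (simp add: m_assoc[symmetric])
  qed
  have "compactin (mtop L) D" using closed_compactin[OF K(2) DK Dcl] .
  then have "compactin (subtopology (mtop L) V) D"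
    by (auto simp: compactin_subtopology D_def)
  then have "compact (len ` D)"
    using image_compactin[OF _ len_cont] by simp
  moreover have "w0 \<in> D"
    using w0 subgroup.one_closed[OF C] by (auto simp: D_def topspace_L)
  ultimately obtain w where w: "w \<in> D" "\<And>y. y \<in> D \<Longrightarrow> len w \<le> len y"
    using compact_attains_inf[of "len ` D"] by blast
  have lw: "len w < r" using w(2)[OF \<open>w0 \<in> D\<close>] w0 by auto
  have wc: "w \<in> carrier G" "inv w0 \<otimes> w \<in> C" "w \<in> V" using w(1) topspace_L by (auto simp: D_def)
  have "w \<notin> C"
  proof
    assume "w \<in> C"
    then have "w \<otimes> inv (inv w0 \<otimes> w) \<in> C"
      by (rule subgroup.m_closed[OF C _ subgroup.m_inv_closed[OF C wc(2)]])
    moreover have "w \<otimes> inv (inv w0 \<otimes> w) = w0"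
      using wc w0 by (simp add: inv_mult_group m_assoc[symmetric])
    ultimately show False using w0C by simp
  qed
  moreover have "len w \<le> len (w \<otimes> c)" if "c \<in> C" "w \<otimes> c \<in> V" for c
  proof (cases "len (w \<otimes> c) \<le> r")
    case True
    have cG: "c \<in> carrier G" by (rule subgroup.mem_carrier[OF C that(1)])
    have "inv w0 \<otimes> (w \<otimes> c) = (inv w0 \<otimes> w) \<otimes> c" using wc w0 cG by (simp add: m_assoc)
    then have "inv w0 \<otimes> (w \<otimes> c) \<in> C" using subgroup.m_closed[OF C wc(2) that(1)] by simp
    then have "w \<otimes> c \<in> D" using True that wc cG by (simp add: D_def topspace_L)
    then show ?thesis using w by blast
  qed (use lw in auto)
  ultimately show ?thesis
    using w(1) DK dec[OF j(1)] lw wc(3) unfolding C_def by blast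
qed

text \<open>
  Suppose that the chain never reaches its intersection \<open>C\<close>, and let \<open>w\<^sub>k \<in> K\<^sub>k\<close> be short elements that
  are shortest in their cosets of \<open>C\<close>. After passing to a subsequence their directions converge. Fix a
  late \<open>k\<close>. For \<open>j\<close> much later still, \<open>w\<^sub>j\<close> is far shorter than \<open>w\<^sub>k\<close> but points in almost the same
  direction, so that a suitable power of it lies close to \<open>w\<^sub>k\<close>, at a distance that is small compared
  with the length of \<open>w\<^sub>k\<close>. These powers lie in \<open>K\<^sub>j\<close>; by compactness \<open>C\<close> itself has an element \<open>c\<close> this
  close to \<open>w\<^sub>k\<close>. Then \<open>w\<^sub>k c\<^sup>-\<^sup>1\<close> lies in the same coset as \<open>w\<^sub>k\<close> and is shorter, a contradiction. The
  argument is the one that turns a closed subgroup into a Lie subgroup, with powers in the role of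
  the exponential map.
\<close>

lemma descending_chain_condition:
  assumes K: "\<And>j. subgroup (K j) G" "\<And>j. compactin (mtop L) (K j)" "\<And>j. K (Suc j) \<subseteq> K j"
  shows "\<exists>j. K j = (\<Inter>i. K i)"
proof (rule ccontr)
  assume "\<not> ?thesis"
  then have ne: "K j \<noteq> (\<Inter>i. K i)" for j by blast
  define C where "C = (\<Inter>i. K i)"
  have Kc: "K j \<subseteq> carrier G" for j using K(1) by (rule subgroup.subset)
  have C: "subgroup C G"
    unfolding C_def by (rule subgroups_Inter) (use K(1) in auto)
  have CK: "C \<subseteq> K j" for j unfolding C_def by blast
  have dec: "K j \<subseteq> K i" if "i \<le> j" for i j :: nat
    using that K(3) by (rule lift_Suc_antimono_le[rotated])
  obtain r1 where r1: "r1 > 0" "\<And>s. s \<le> r1 \<Longrightarrow> closedin (mtop L) {g \<in> V. len g \<le> s}"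
    using closed_balls by blast
  \<comment> \<open>\<open>2 r\<^sub>0 < \<rho>\<close> is for the power estimate; with \<open>A r\<^sub>0 \<le> 1/4\<close> the second order term in the final
    comparison costs at most a quarter of the length\<close>
  define r0 where "r0 = min r1 (min (\<rho> / 3) (1 / (4 * A + 1)))"
  have r0: "0 < r0" "r0 \<le> r1" "2 * r0 < \<rho>" "A * r0 \<le> 1/4"
  proof -
    show "0 < r0" using r1 \<rho> A by (auto simp: r0_def)
    show "r0 \<le> r1" "2 * r0 < \<rho>" using \<rho> by (auto simp: r0_def min_def)
    have "r0 \<le> 1 / (4 * A + 1)" by (simp add: r0_def)
    then have "A * r0 \<le> A * (1 / (4 * A + 1))" using A by (rule mult_left_mono)
    also have "\<dots> \<le> 1/4" using A by (simp add: field_simps)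
    finally show "A * r0 \<le> 1/4" .
  qed
  let ?B = "{g \<in> V. len g \<le> r0}"
  have Bcl: "closedin (mtop L) ?B" using r1(2) r0(2) by blast
  obtain r2 where r2: "r2 > 0" "\<And>g h. g \<in> V \<Longrightarrow> h \<in> V \<Longrightarrow> len g < r2 \<Longrightarrow> len h < r2 \<Longrightarrow>
      g \<otimes> inv h \<in> V \<and> len (g \<otimes> inv h) < r0"
  proof -
    let ?O = "{g \<in> V. len g < r0}"
    let ?X = "prod_topology (mtop L) (mtop L)"
    let ?Z = "{z \<in> topspace ?X. fst z \<otimes> inv (snd z) \<in> ?O}"
    have O: "openin (mtop L) ?O" "\<one> \<in> ?O" using small_open[OF r0(1)] by auto
    have "openin ?X ?Z"
      by (intro openin_continuous_map_preimage[OF _ O(1)] continuous_mult continuous_inv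
          continuous_map_fst continuous_map_snd)
    moreover have "(\<one>, \<one>) \<in> ?Z" using O(2) one_in_topspace by simp
    ultimately obtain O1 O2 where O12: "openin (mtop L) O1" "openin (mtop L) O2" "\<one> \<in> O1" "\<one> \<in> O2"
      "O1 \<times> O2 \<subseteq> ?Z"
      unfolding openin_prod_topology_alt by meson
    obtain a where a: "a > 0" "{g \<in> V. len g < a} \<subseteq> O1" using small[OF O12(1,3)] by (auto simp: len_def)
    obtain b where b: "b > 0" "{g \<in> V. len g < b} \<subseteq> O2" using small[OF O12(2,4)] by (auto simp: len_def)
    show ?thesis
    proof (rule that[of "min a b"])
      show "g \<otimes> inv h \<in> V \<and> len (g \<otimes> inv h) < r0"
        if "g \<in> V" "h \<in> V" "len g < min a b" "len h < min a b" for g h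
      proof -
        have "(g, h) \<in> O1 \<times> O2" using that a b by auto
        then show ?thesis using O12(5) by auto
      qed
    qed (use a b in auto)
  qed
  define R where "R = (\<lambda>k. r0 / Suc k)"
  have R: "0 < R k" "R k \<le> r0" for k using r0(1) by (auto simp: R_def field_simps)
  have "\<forall>k. \<exists>w\<in>K k. w \<in> V \<and> w \<notin> C \<and> len w < R k \<and> (\<forall>c\<in>C. w \<otimes> c \<in> V \<longrightarrow> len w \<le> len (w \<otimes> c))"
    using coset_representative_of_minimal_length[OF K ne] R r1(2) r0(2) order_trans
    unfolding C_def by meson
  then obtain W0 where W0: "\<And>k. W0 k \<in> K k" "\<And>k. W0 k \<in> V" "\<And>k. W0 k \<notin> C" "\<And>k. len (W0 k) < R k"
    "\<And>k c. c \<in> C \<Longrightarrow> W0 k \<otimes> c \<in> V \<Longrightarrow> len (W0 k) \<le> len (W0 k \<otimes> c)"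
    by metis
  have pos0: "len (W0 k) > 0" for k
    using eq_one_if_len_zero[OF W0(2)] W0(3) subgroup.one_closed[OF C] len_nonneg[of "W0 k"]
    by (metis less_eq_real_def)
  \<comment> \<open>the directions of the \<open>w\<^sub>k\<close>, padded with \<open>0\<close> because lengths control only the first \<open>n\<close> coordinates\<close>
  define u0 where "u0 = (\<lambda>k i. if i < n then P (W0 k) i / len (W0 k) else 0)"
  have "\<bar>u0 k i\<bar> \<le> 1" for k i
  proof (cases "i < n")
    case True
    then have "\<bar>P (W0 k) i\<bar> \<le> len (W0 k)" unfolding len_def by (intro member_le_sum) auto
    then show ?thesis using pos0[of k] True by (simp add: u0_def)
  qed (simp add: u0_def)
  then obtain l \<sigma> where \<sigma>: "strict_mono \<sigma>" "\<And>i. (\<lambda>k. u0 (\<sigma> k) i) \<longlonglongrightarrow> l i"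
    using bounded_coordinates_convergent_subseq[of u0] by blast
  define W where "W = W0 \<circ> \<sigma>"
  define s where "s = (\<lambda>k. len (W k))"
  define u where "u = (\<lambda>k i. P (W k) i / s k)"
  have \<sigma>k: "k \<le> \<sigma> k" for k using seq_suble[OF \<sigma>(1)] .
  have W: "W k \<in> K k" "W k \<in> V" "W k \<notin> C" "W k \<in> carrier G" for k
    using W0 dec[OF \<sigma>k[of k]] V_carrier unfolding W_def by auto
  have Wmin: "s k \<le> len (W k \<otimes> c)" if "c \<in> C" "W k \<otimes> c \<in> V" for k c
    using W0(5)[OF that(1)] that(2) by (simp add: W_def s_def)
  have pos: "0 < s k" for k using pos0 by (simp add: s_def W_def)
  have Pu: "P (W k) i = s k * u k i" for k i using pos[of k] by (simp add: u_def)
  have "s \<longlonglongrightarrow> 0"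
  proof (rule tendsto_sandwich[of "\<lambda>k. 0" _ _ "\<lambda>k. r0 / Suc k"])
    have "s k \<le> r0 / Suc k" for k
    proof -
      have "s k \<le> R (\<sigma> k)" using W0(4)[of "\<sigma> k"] by (simp add: s_def W_def)
      also have "\<dots> \<le> r0 / Suc k" using r0(1) \<sigma>k[of k] by (auto simp: R_def intro!: divide_left_mono)
      finally show ?thesis .
    qed
    then show "\<forall>\<^sub>F k in sequentially. s k \<le> r0 / Suc k" by simp
    show "(\<lambda>k. r0 / Suc k) \<longlonglongrightarrow> 0" by (rule LIMSEQ_Suc[OF lim_const_over_n])
  qed (use pos in \<open>simp_all add: less_imp_le\<close>)
  have "(\<lambda>k. \<Sum>i<n. \<bar>u k i - l i\<bar>) \<longlonglongrightarrow> (\<Sum>i<n. \<bar>l i - l i\<bar>)"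
  proof (intro tendsto_intros)
    fix i assume "i \<in> {..<n}"
    then show "(\<lambda>k. u k i) \<longlonglongrightarrow> l i"
      using \<sigma>(2)[of i] by (simp add: u_def u0_def W_def s_def)
  qed
  then have udir: "\<forall>\<^sub>F k in sequentially. (\<Sum>i<n. \<bar>u k i - l i\<bar>) < 1/16"
    by (rule order_tendstoD(2)) simp
  have "\<forall>\<^sub>F k in sequentially. s k < min (r0 / 2) (min (r2 / 2) (1 / (16 * A + 1)))"
    using r0(1) r2(1) A by (intro order_tendstoD(2)[OF \<open>s \<longlonglongrightarrow> 0\<close>]) auto
  with udir have "\<exists>k. (\<Sum>i<n. \<bar>u k i - l i\<bar>) < 1/16 \<and> s k < min (r0 / 2) (min (r2 / 2) (1 / (16 * A + 1)))"
    using eventually_conj eventually_happens' sequentially_bot by blast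
  then obtain k where k: "(\<Sum>i<n. \<bar>u k i - l i\<bar>) < 1/16" "s k < r0 / 2" "s k < r2 / 2"
    "s k < 1 / (16 * A + 1)"
    by auto
  have Ask: "A * s k \<le> 1/16"
  proof -
    have "A * s k \<le> A * (1 / (16 * A + 1))" using A k(4) by (intro mult_left_mono) auto
    also have "\<dots> \<le> 1/16" using A by (simp add: field_simps)
    finally show ?thesis .
  qed
  let ?w = "W k"
  \<comment> \<open>high powers of later \<open>w\<^sub>j\<close> come close to \<open>w\<^sub>k\<close>\<close>
  define E where "E = {y \<in> ?B. (\<Sum>i<n. \<bar>P y i - P ?w i\<bar>) \<le> s k / 4}"
  have powers: "K j \<inter> E \<noteq> {}" if j: "(\<Sum>i<n. \<bar>u j i - l i\<bar>) < 1/16" "s j < s k / 16" for j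
  proof -
    \<comment> \<open>the largest exponent with \<open>m s\<^sub>j \<le> s\<^sub>k\<close>; the four errors below are the second order term
      of the power, the rounding of the exponent, and twice the deviation from the limit direction, each
      at most \<open>s\<^sub>k/16\<close>\<close>
    define m where "m = nat \<lfloor>s k / s j\<rfloor>"
    define y where "y = W j [^] m"
    have "real m \<le> s k / s j" "s k / s j < real m + 1"
      using pos[of j] pos[of k] by (auto simp: m_def)
    then have m: "real m * s j \<le> s k" "s k < real m * s j + s j"
      using pos[of j] by (auto simp: field_simps)
    have "2 * s k < \<rho>" "A * s k \<le> 1" using k(2) r0(1,3) Ask by linarith+
    then have y: "y \<in> V" "(\<Sum>i<n. \<bar>P y i - real m * P (W j) i\<bar>) \<le> A * (real m * s j)\<^sup>2"
      using power_estimate[OF W(2)[of j], of m "s k"] m(1) by (auto simp: y_def s_def)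
    have "A * (real m * s j)\<^sup>2 \<le> A * (s k)\<^sup>2"
      using m(1) pos[of j] A by (intro mult_left_mono power_mono) auto
    also have "\<dots> = (A * s k) * s k" by (simp add: power2_eq_square)
    also have "\<dots> \<le> 1/16 * s k" using Ask pos[of k] by (intro mult_right_mono) auto
    finally have e1: "(\<Sum>i<n. \<bar>P y i - real m * P (W j) i\<bar>) \<le> s k / 16" using y by simp
    have uj: "(\<Sum>i<n. \<bar>u j i\<bar>) = 1"
      using pos[of j] by (simp add: u_def s_def len_def sum_divide_distrib[symmetric])
    have term_bound: "\<bar>P y i - P ?w i\<bar> \<le> \<bar>P y i - real m * P (W j) i\<bar>
        + \<bar>real m * s j - s k\<bar> * \<bar>u j i\<bar> + s k * \<bar>u j i - l i\<bar> + s k * \<bar>u k i - l i\<bar>" for i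
    proof -
      have "P y i - P ?w i = (P y i - real m * P (W j) i) + (real m * s j - s k) * u j i
          + s k * (u j i - l i) - s k * (u k i - l i)"
        unfolding Pu by (simp add: algebra_simps)
      moreover have "\<bar>a + b + c - d\<bar> \<le> \<bar>a\<bar> + \<bar>b\<bar> + \<bar>c\<bar> + \<bar>d\<bar>" for a b c d :: real by linarith
      ultimately show ?thesis using pos[of k] by (metis abs_mult abs_of_pos)
    qed
    have "(\<Sum>i<n. \<bar>P y i - P ?w i\<bar>) \<le> (\<Sum>i<n. \<bar>P y i - real m * P (W j) i\<bar>
        + \<bar>real m * s j - s k\<bar> * \<bar>u j i\<bar> + s k * \<bar>u j i - l i\<bar> + s k * \<bar>u k i - l i\<bar>)"
      by (intro sum_mono term_bound)
    also have "\<dots> = (\<Sum>i<n. \<bar>P y i - real m * P (W j) i\<bar>) + \<bar>real m * s j - s k\<bar> * (\<Sum>i<n. \<bar>u j i\<bar>)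
        + s k * (\<Sum>i<n. \<bar>u j i - l i\<bar>) + s k * (\<Sum>i<n. \<bar>u k i - l i\<bar>)"
      by (simp add: sum.distrib sum_distrib_left)
    also have "\<dots> \<le> s k / 16 + s k / 16 * 1 + s k * (1/16) + s k * (1/16)"
      unfolding uj using e1 m j(2) j(1) k(1) pos[of k] by (intro add_mono mult_left_mono mult_right_mono) auto
    finally have d: "(\<Sum>i<n. \<bar>P y i - P ?w i\<bar>) \<le> s k / 4" by simp
    have "len y \<le> (\<Sum>i<n. \<bar>P y i - P ?w i\<bar> + \<bar>P ?w i\<bar>)"
      unfolding len_def by (intro sum_mono) linarith
    also have "\<dots> = (\<Sum>i<n. \<bar>P y i - P ?w i\<bar>) + s k" by (simp add: sum.distrib s_def len_def)
    finally have "len y \<le> r0" using d k(2) pos[of k] by linarith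
    then have "y \<in> E" using d y by (simp add: E_def)
    moreover have "y \<in> K j"
      unfolding y_def using W(1)[of j] K(1)[of j]
      by (induction m) (auto intro: subgroup.one_closed subgroup.m_closed)
    ultimately show ?thesis by blast
  qed
  have "closedin (mtop L) E"
  proof -
    have "closedin (subtopology (mtop L) V)
       {y \<in> topspace (subtopology (mtop L) V). (\<Sum>i<n. \<bar>P y i - P ?w i\<bar>) \<in> {..s k / 4}}"
      by (intro closedin_continuous_map_preimage[OF dist_cont]) auto
    then obtain F where "closedin (mtop L) F"
      "{y \<in> topspace (subtopology (mtop L) V). (\<Sum>i<n. \<bar>P y i - P ?w i\<bar>) \<in> {..s k / 4}} = F \<inter> V"
      unfolding closedin_subtopology by blast
    moreover have "topspace (subtopology (mtop L) V) = V" using openin_subset[OF V(1)] by auto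
    ultimately have "E = ?B \<inter> F" by (auto simp: E_def)
    then show ?thesis using Bcl \<open>closedin (mtop L) F\<close> closedin_Int by metis
  qed
  moreover have "\<exists>j\<ge>N. K j \<inter> E \<noteq> {}" for N
  proof -
    have "\<forall>\<^sub>F j in sequentially. s j < s k / 16"
      using pos[of k] by (intro order_tendstoD(2)[OF \<open>s \<longlonglongrightarrow> 0\<close>]) auto
    then have "\<forall>\<^sub>F j in sequentially. (\<Sum>i<n. \<bar>u j i - l i\<bar>) < 1/16 \<and> s j < s k / 16 \<and> N \<le> j"
      using udir eventually_ge_at_top[of N] by eventually_elim simp
    then obtain j where "(\<Sum>i<n. \<bar>u j i - l i\<bar>) < 1/16" "s j < s k / 16" "N \<le> j"
      using eventually_happens' sequentially_bot by blast
    then show ?thesis using powers by blast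
  qed
  ultimately have "(\<Inter>j. K j) \<inter> E \<noteq> {}"
    by (rule compact_decreasing_meets_closed[where K = K, OF K(2) Hausdorff_L K(3)])
  then obtain c where c: "c \<in> C" "c \<in> V" "len c \<le> r0" "(\<Sum>i<n. \<bar>P c i - P ?w i\<bar>) \<le> s k / 4"
    by (auto simp: C_def E_def)
  \<comment> \<open>so \<open>w\<^sub>k c\<^sup>-\<^sup>1\<close> is a shorter representative of its coset\<close>
  define v where "v = ?w \<otimes> inv c"
  have cG: "c \<in> carrier G" using c V_carrier by blast
  have "len c \<le> (\<Sum>i<n. \<bar>P c i - P ?w i\<bar> + \<bar>P ?w i\<bar>)"
    unfolding len_def by (intro sum_mono) linarith
  also have "\<dots> = (\<Sum>i<n. \<bar>P c i - P ?w i\<bar>) + s k" by (simp add: sum.distrib s_def len_def)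
  finally have "len c < r2" using c(4) k(3) pos[of k] by linarith
  then have v: "v \<in> V" "len v < r0"
    using r2(2)[OF W(2)[of k] c(2)] k(3) r2(1) pos[of k] by (auto simp: v_def s_def)
  have vc: "v \<otimes> c = ?w" using W(4)[of k] cG by (simp add: v_def m_assoc)
  have add: "(\<Sum>i<n. \<bar>P ?w i - P v i - P c i\<bar>) \<le> A * len v * len c"
    using almost_additive[OF v(1) c(2)] v(2) c(3) r0(1,3) unfolding vc by (auto simp: len_def)
  have "len v \<le> (\<Sum>i<n. \<bar>P ?w i - P v i - P c i\<bar> + \<bar>P c i - P ?w i\<bar>)"
    unfolding len_def by (intro sum_mono) linarith
  also have "\<dots> \<le> A * len v * len c + s k / 4"
    unfolding sum.distrib using add c(4) by linarith
  also have "A * len v * len c \<le> len v * (1/4)"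
  proof -
    have "A * len c \<le> 1/4" using c(3) A r0(4) by (meson mult_left_mono order_trans)
    then have "len v * (A * len c) \<le> len v * (1/4)" using len_nonneg by (rule mult_left_mono)
    then show ?thesis by (simp add: algebra_simps)
  qed
  finally have "len v < s k" using pos[of k] by linarith
  moreover have "s k \<le> len v"
    unfolding v_def by (intro Wmin) (use v c C in \<open>auto simp: v_def subgroup.m_inv_closed\<close>)
  ultimately show False by simp
qed

end

section \<open>Multiplication of a Lie group in charts\<close>

lemma chart_onD:
  assumes "chart_on X n (V, \<psi>)"
  shows chart_domain: "openin X V"
    and chart_range: "\<psi> ` V \<subseteq> topspace (Euclidean_space n)"
    and chart_inj: "inj_on \<psi> V"
    and chart_open: "openin X W \<Longrightarrow> openin (Euclidean_space n) (\<psi> ` (V \<inter> W))"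
    and chart_coord_continuous: "continuous_map (subtopology X V) euclideanreal (\<lambda>g. \<psi> g i)"
    and chart_inv_continuous: "continuous_map (subtopology (Euclidean_space n) (\<psi> ` V)) X (inv_into V \<psi>)"
proof -
  let ?XV = "subtopology X V" and ?EV = "subtopology (Euclidean_space n) (\<psi> ` V)"
  have h: "openin X V" "openin (Euclidean_space n) (\<psi> ` V)" "homeomorphic_map ?XV ?EV \<psi>"
    using assms by (auto simp: chart_on_def)
  have tX: "topspace ?XV = V" using openin_subset[OF h(1)] by auto
  show "openin X V" by (rule h)
  show "\<psi> ` V \<subseteq> topspace (Euclidean_space n)" using openin_subset[OF h(2)] .
  show inj: "inj_on \<psi> V" using homeomorphic_imp_injective_map[OF h(3)] tX by simp
  show "openin (Euclidean_space n) (\<psi> ` (V \<inter> W))" if "openin X W"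
  proof -
    have "openin ?XV (V \<inter> W)" using that by (auto simp: openin_subtopology)
    then have "openin ?EV (\<psi> ` (V \<inter> W))"
      using homeomorphic_imp_open_map[OF h(3)] by (auto simp: open_map_def)
    then show ?thesis using h(2) openin_trans_full by blast
  qed
  have "continuous_map ?XV (powertop_real UNIV) \<psi>"
    using homeomorphic_imp_continuous_map[OF h(3)]
    by (simp add: Euclidean_space_def continuous_map_in_subtopology)
  then show "continuous_map ?XV euclideanreal (\<lambda>g. \<psi> g i)"
    by (simp add: continuous_map_componentwise_UNIV)
  obtain \<theta> where \<theta>: "continuous_map ?EV ?XV \<theta>" "\<And>x. x \<in> V \<Longrightarrow> \<theta> (\<psi> x) = x"
    using h(3) tX by (auto simp: homeomorphic_map_maps homeomorphic_maps_def)
  have "continuous_map ?EV ?XV (inv_into V \<psi>)"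
    using \<theta>(1) by (rule continuous_map_eq) (use \<theta>(2) inj in \<open>auto simp: inv_into_f_f\<close>)
  then show "continuous_map ?EV X (inv_into V \<psi>)"
    by (simp add: continuous_map_in_subtopology)
qed

text \<open>
  The charts in which multiplication is known to be smooth may differ for the two factors and for the
  product, so lengths measured in them have to be compared; a change of charts is Lipschitz near \<open>x\<close>.
\<close>

lemma chart_comparison:
  assumes M: "smooth_manifold M" and c: "(V, \<psi>) \<in> atlas M" "(V', \<psi>') \<in> atlas M" and x: "x \<in> V" "x \<in> V'"
  shows "\<exists>\<delta>>0. \<exists>B\<ge>0. \<forall>y\<in>V \<inter> V'. (\<Sum>i<mdim M. \<bar>\<psi> y i - \<psi> x i\<bar>) < \<delta> \<longrightarrow>
           (\<Sum>i<mdim M. \<bar>\<psi>' y i - \<psi>' x i\<bar>) \<le> B * (\<Sum>i<mdim M. \<bar>\<psi> y i - \<psi> x i\<bar>)"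
proof -
  let ?n = "mdim M" and ?X = "mtop M"
  have ch: "chart_on ?X ?n (V, \<psi>)" "chart_on ?X ?n (V', \<psi>')"
    using M c by (auto simp: smooth_manifold_def)
  let ?S = "\<psi> ` (V \<inter> V')"
  have S: "openin (Euclidean_space ?n) ?S" "\<psi> x \<in> ?S"
    using chart_open[OF ch(1) chart_domain[OF ch(2)]] x by auto
  have sm: "Ck_on ?n (Suc 0) ?S (\<lambda>y. \<psi>' (inv_into V \<psi> y) j)" if "j < ?n" for j
  proof -
    have "smooth_vec_on ?n ?n ?S (\<lambda>y. \<psi>' (inv_into V \<psi> y))"
      using M c unfolding smooth_manifold_def by fast
    then show ?thesis using that by (simp only: smooth_vec_on_def smooth_on_def)
  qed
  have "\<forall>j. \<exists>\<delta>. j < ?n \<longrightarrow> \<delta> > 0 \<and> (\<exists>B\<ge>0. \<forall>z\<in>coord_box ?n (\<psi> x) \<delta>. \<forall>z'\<in>coord_box ?n (\<psi> x) \<delta>.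
      \<bar>\<psi>' (inv_into V \<psi> z) j - \<psi>' (inv_into V \<psi> z') j\<bar> \<le> B * (\<Sum>i<?n. \<bar>z i - z' i\<bar>))"
    using C1_locally_Lipschitz[OF S sm] by blast
  then obtain d where d: "\<forall>j. j < ?n \<longrightarrow> d j > 0 \<and> (\<exists>B\<ge>0. \<forall>z\<in>coord_box ?n (\<psi> x) (d j). \<forall>z'\<in>coord_box ?n (\<psi> x) (d j).
      \<bar>\<psi>' (inv_into V \<psi> z) j - \<psi>' (inv_into V \<psi> z') j\<bar> \<le> B * (\<Sum>i<?n. \<bar>z i - z' i\<bar>))"
    unfolding choice_iff by blast
  then have "\<forall>j. \<exists>B. j < ?n \<longrightarrow> B \<ge> 0 \<and> (\<forall>z\<in>coord_box ?n (\<psi> x) (d j). \<forall>z'\<in>coord_box ?n (\<psi> x) (d j).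
      \<bar>\<psi>' (inv_into V \<psi> z) j - \<psi>' (inv_into V \<psi> z') j\<bar> \<le> B * (\<Sum>i<?n. \<bar>z i - z' i\<bar>))"
    by blast
  then obtain b where b: "\<forall>j. j < ?n \<longrightarrow> b j \<ge> 0 \<and> (\<forall>z\<in>coord_box ?n (\<psi> x) (d j). \<forall>z'\<in>coord_box ?n (\<psi> x) (d j).
      \<bar>\<psi>' (inv_into V \<psi> z) j - \<psi>' (inv_into V \<psi> z') j\<bar> \<le> b j * (\<Sum>i<?n. \<bar>z i - z' i\<bar>))"
    unfolding choice_iff by blast
  define \<delta> where "\<delta> = Min (insert 1 (d ` {..<?n}))"
  have \<delta>: "\<delta> > 0" "\<And>i. i < ?n \<Longrightarrow> \<delta> \<le> d i"
    using d by (auto simp: \<delta>_def)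
  have "(\<Sum>i<?n. \<bar>\<psi>' y i - \<psi>' x i\<bar>) \<le> (\<Sum>j<?n. b j) * (\<Sum>i<?n. \<bar>\<psi> y i - \<psi> x i\<bar>)"
    if y: "y \<in> V \<inter> V'" "(\<Sum>i<?n. \<bar>\<psi> y i - \<psi> x i\<bar>) < \<delta>" for y
    unfolding sum_distrib_right
  proof (intro sum_mono)
    fix j assume "j \<in> {..<?n}"
    then have j: "j < ?n" by simp
    have E: "\<psi> y \<in> topspace (Euclidean_space ?n)" "\<psi> x \<in> topspace (Euclidean_space ?n)"
      using y x chart_range[OF ch(1)] by auto
    have "\<bar>\<psi> y i - \<psi> x i\<bar> < d j" if "i < ?n" for i
    proof -
      have "\<bar>\<psi> y i - \<psi> x i\<bar> \<le> (\<Sum>i<?n. \<bar>\<psi> y i - \<psi> x i\<bar>)"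
        using that by (intro member_le_sum) auto
      then show ?thesis using y \<delta>(2)[OF j] by linarith
    qed
    then have "\<psi> y \<in> coord_box ?n (\<psi> x) (d j)" "\<psi> x \<in> coord_box ?n (\<psi> x) (d j)"
      using E d j by (auto simp: coord_box_def)
    then have "\<bar>\<psi>' (inv_into V \<psi> (\<psi> y)) j - \<psi>' (inv_into V \<psi> (\<psi> x)) j\<bar> \<le> b j * (\<Sum>i<?n. \<bar>\<psi> y i - \<psi> x i\<bar>)"
      using b j by blast
    then show "\<bar>\<psi>' y j - \<psi>' x j\<bar> \<le> b j * (\<Sum>i<?n. \<bar>\<psi> y i - \<psi> x i\<bar>)"
      using y x chart_inj[OF ch(1)] by (simp add: inv_into_f_f)
  qed
  moreover have "(\<Sum>j<?n. b j) \<ge> 0" using b by (auto intro: sum_nonneg)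
  ultimately show ?thesis using \<delta>(1) by blast
qed

text \<open>
  Written in charts, \<open>\<psi>\<^sub>3(gh)\<close> is a twice differentiable function of the pair \<open>(g, h)\<close>, and since \<open>\<one>\<close> is
  neutral, \<open>\<psi>\<^sub>3(gh) - \<psi>\<^sub>3(g) - \<psi>\<^sub>3(h) + \<psi>\<^sub>3(\<one>)\<close> is its mixed second difference.
\<close>

lemma (in lie_group) multiplication_almost_additive:
  "\<exists>V1 \<psi>1 V2 \<psi>2 V3 \<psi>3. (V1, \<psi>1) \<in> atlas L \<and> (V2, \<psi>2) \<in> atlas L \<and> (V3, \<psi>3) \<in> atlas L \<and>
    \<one> \<in> V1 \<and> \<one> \<in> V2 \<and> \<one> \<in> V3 \<and> (\<exists>\<delta>>0. \<exists>B\<ge>0. \<forall>g\<in>V1 \<inter> V3. \<forall>h\<in>V2 \<inter> V3.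
      (\<Sum>i<mdim L. \<bar>\<psi>1 g i - \<psi>1 \<one> i\<bar>) < \<delta> \<longrightarrow> (\<Sum>i<mdim L. \<bar>\<psi>2 h i - \<psi>2 \<one> i\<bar>) < \<delta> \<longrightarrow>
      (\<Sum>i<mdim L. \<bar>\<psi>3 (g \<otimes> h) i - \<psi>3 g i - \<psi>3 h i + \<psi>3 \<one> i\<bar>) \<le>
        B * (\<Sum>i<mdim L. \<bar>\<psi>1 g i - \<psi>1 \<one> i\<bar>) * (\<Sum>i<mdim L. \<bar>\<psi>2 h i - \<psi>2 \<one> i\<bar>))"
proof -
  let ?n = "mdim L" and ?T = "mtop L"
  have "(\<one>, \<one>) \<in> topspace (mtop (prod_manifold L L))"
    by (simp add: prod_manifold_def one_in_topspace)
  then obtain V12 \<psi>12 V3 \<psi>3 where a: "(V12, \<psi>12) \<in> atlas (prod_manifold L L)" "(V3, \<psi>3) \<in> atlas L"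
    "(\<one>, \<one>) \<in> V12" "\<one> \<in> V3"
    "smooth_vec_on (?n + ?n) ?n (\<psi>12 ` (V12 \<inter> (\<lambda>(g, h). g \<otimes> h) -` V3))
        (\<lambda>y. \<psi>3 ((\<lambda>(g, h). g \<otimes> h) (inv_into V12 \<psi>12 y)))"
    using smooth_mult unfolding smooth_map_def by (fastforce simp: prod_manifold_def)
  obtain V1 V2 \<psi>1 \<psi>2 where b: "(V1, \<psi>1) \<in> atlas L" "(V2, \<psi>2) \<in> atlas L" "V12 = V1 \<times> V2"
    "\<psi>12 = (\<lambda>(x, y) i. if i < ?n then \<psi>1 x i else \<psi>2 y (i - ?n))"
    using a(1) by (auto simp: prod_manifold_def)
  have ch: "chart_on ?T ?n (V1, \<psi>1)" "chart_on ?T ?n (V2, \<psi>2)" "chart_on ?T ?n (V3, \<psi>3)"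
    using manifold_L a b by (auto simp: smooth_manifold_def)
  have one: "\<one> \<in> V1" "\<one> \<in> V2" using a(3) b(3) by auto
  have van: "\<psi>1 x i = 0" if "x \<in> V1" "?n \<le> i" for x i
    using that chart_range[OF ch(1)] by (auto simp: topspace_Euclidean_space)
  have van2: "\<psi>2 x i = 0" if "x \<in> V2" "?n \<le> i" for x i
    using that chart_range[OF ch(2)] by (auto simp: topspace_Euclidean_space)
  let ?D = "\<psi>12 ` (V12 \<inter> (\<lambda>(g, h). g \<otimes> h) -` V3)"
  let ?E = "Euclidean_space (?n + ?n)"
  define hd where "hd = (\<lambda>(y::nat \<Rightarrow> real) i. if i < ?n then y i else 0)"
  define tl where "tl = (\<lambda>(y::nat \<Rightarrow> real) i. if i < ?n then y (?n + i) else 0)"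
  have hdtl: "hd (\<psi>12 (g, h)) = \<psi>1 g" "tl (\<psi>12 (g, h)) = \<psi>2 h" if "g \<in> V1" "h \<in> V2" for g h
    using that van van2 by (auto simp: hd_def tl_def b(4) fun_eq_iff)
  have inj12: "inj_on \<psi>12 V12"
  proof (rule inj_onI)
    fix p q assume "p \<in> V12" "q \<in> V12" "\<psi>12 p = \<psi>12 q"
    then show "p = q"
      using hdtl chart_inj[OF ch(1)] chart_inj[OF ch(2)] unfolding b(3) inj_on_def
      by (metis SigmaE)
  qed
  have co: "continuous_map ?E euclideanreal (\<lambda>y. y i)" for i
    unfolding Euclidean_space_def
    by (intro continuous_map_from_subtopology continuous_map_product_coordinates[of i UNIV "\<lambda>_. euclideanreal"]) simp
  have hdc: "continuous_map ?E (Euclidean_space ?n) hd" "continuous_map ?E (Euclidean_space ?n) tl"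
    unfolding hd_def tl_def continuous_map_componentwise_Euclidean_space using co by auto
  define Y where "Y = {y \<in> topspace ?E. hd y \<in> \<psi>1 ` V1} \<inter> {y \<in> topspace ?E. tl y \<in> \<psi>2 ` V2}"
  have op12: "openin (Euclidean_space ?n) (\<psi>1 ` V1)" "openin (Euclidean_space ?n) (\<psi>2 ` V2)"
    using ch by (auto simp: chart_on_def)
  have Y: "openin ?E Y"
    unfolding Y_def using openin_continuous_map_preimage[OF hdc(1) op12(1)]
      openin_continuous_map_preimage[OF hdc(2) op12(2)] by (rule openin_Int)
  have cY: "continuous_map (subtopology ?E Y) ?T (\<lambda>y. inv_into V1 \<psi>1 (hd y) \<otimes> inv_into V2 \<psi>2 (tl y))"
  proof (rule continuous_mult)
    have "continuous_map (subtopology ?E Y) (subtopology (Euclidean_space ?n) (\<psi>1 ` V1)) hd"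
      using hdc(1) by (auto simp: continuous_map_in_subtopology Y_def intro: continuous_map_from_subtopology)
    from continuous_map_compose[OF this chart_inv_continuous[OF ch(1)]]
    show "continuous_map (subtopology ?E Y) ?T (\<lambda>y. inv_into V1 \<psi>1 (hd y))" by (simp add: o_def)
    have "continuous_map (subtopology ?E Y) (subtopology (Euclidean_space ?n) (\<psi>2 ` V2)) tl"
      using hdc(2) by (auto simp: continuous_map_in_subtopology Y_def intro: continuous_map_from_subtopology)
    from continuous_map_compose[OF this chart_inv_continuous[OF ch(2)]]
    show "continuous_map (subtopology ?E Y) ?T (\<lambda>y. inv_into V2 \<psi>2 (tl y))" by (simp add: o_def)
  qed
  \<comment> \<open>the set of coordinates of pairs with product in \<open>V\<^sub>3\<close> is described as a preimage to see that it is open\<close>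
  have Deq: "?D = {y \<in> topspace (subtopology ?E Y). inv_into V1 \<psi>1 (hd y) \<otimes> inv_into V2 \<psi>2 (tl y) \<in> V3}"
  proof (intro subset_antisym subsetI)
    fix y assume "y \<in> ?D"
    then obtain g h where gh: "g \<in> V1" "h \<in> V2" "g \<otimes> h \<in> V3" "y = \<psi>12 (g, h)"
      by (auto simp: b(3))
    then have "y \<in> topspace ?E"
      using van2 by (auto simp: topspace_Euclidean_space b(4))
    then show "y \<in> {y \<in> topspace (subtopology ?E Y). inv_into V1 \<psi>1 (hd y) \<otimes> inv_into V2 \<psi>2 (tl y) \<in> V3}"
      using gh hdtl chart_inj[OF ch(1)] chart_inj[OF ch(2)] by (auto simp: Y_def inv_into_f_f)
  next
    fix y assume "y \<in> {y \<in> topspace (subtopology ?E Y). inv_into V1 \<psi>1 (hd y) \<otimes> inv_into V2 \<psi>2 (tl y) \<in> V3}"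
    then obtain g h where gh: "y \<in> topspace ?E" "g \<in> V1" "h \<in> V2" "hd y = \<psi>1 g" "tl y = \<psi>2 h" "g \<otimes> h \<in> V3"
      using chart_inj[OF ch(1)] chart_inj[OF ch(2)] by (auto simp: Y_def inv_into_f_f)
    have "y i = \<psi>12 (g, h) i" for i
    proof -
      consider "i < ?n" | "?n \<le> i" "i < ?n + ?n" | "?n + ?n \<le> i" by linarith
      then show ?thesis
      proof cases
        case 1 then show ?thesis using fun_cong[OF gh(4), of i] by (simp add: hd_def b(4))
      next
        case 2
        then obtain k where "i = ?n + k" using le_Suc_ex by blast
        then show ?thesis using 2 fun_cong[OF gh(5), of k] by (simp add: tl_def b(4))
      next
        case 3 then show ?thesis using gh(1,3) van2[of h "i - ?n"]
          by (simp add: topspace_Euclidean_space b(4))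
      qed
    qed
    then have "y = \<psi>12 (g, h)" by auto
    then show "y \<in> ?D" using gh by (auto simp: b(3))
  qed
  have "openin (subtopology ?E Y) ?D"
    unfolding Deq by (rule openin_continuous_map_preimage[OF cY chart_domain[OF ch(3)]])
  then have D: "openin ?E ?D" using Y openin_trans_full by blast
  define c where "c = \<psi>12 (\<one>, \<one>)"
  have cD: "c \<in> ?D" using one a(4) by (auto simp: c_def b(3))
  define f where "f = (\<lambda>j y. \<psi>3 ((\<lambda>(g, h). g \<otimes> h) (inv_into V12 \<psi>12 y)) j)"
  have f_eq: "f j (\<psi>12 (g, h)) = \<psi>3 (g \<otimes> h) j" if "g \<in> V1" "h \<in> V2" for g h j
    using that inj12 by (simp add: f_def b(3) inv_into_f_f)
  have sm: "Ck_on (?n + ?n) (Suc (Suc 0)) ?D (f j)" if "j < ?n" for j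
    using a(5) that by (simp only: smooth_vec_on_def smooth_on_def f_def)
  define \<Delta> where "\<Delta> = (\<lambda>j z. \<bar>f j z - f j (\<lambda>i. if i < ?n then z i else c i)
      - f j (\<lambda>i. if i < ?n then c i else z i) + f j c\<bar>)"
  have "\<forall>j. \<exists>\<delta>. j < ?n \<longrightarrow> \<delta> > 0 \<and> (\<exists>B\<ge>0. \<forall>z\<in>coord_box (?n + ?n) c \<delta>.
      \<Delta> j z \<le> B * (\<Sum>i<?n. \<bar>z i - c i\<bar>) * (\<Sum>i<?n. \<bar>z (?n + i) - c (?n + i)\<bar>))"
    using C2_mixed_second_difference[OF D cD sm] unfolding \<Delta>_def by blast
  then obtain d where d: "\<forall>j. j < ?n \<longrightarrow> d j > 0 \<and> (\<exists>B\<ge>0. \<forall>z\<in>coord_box (?n + ?n) c (d j).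
      \<Delta> j z \<le> B * (\<Sum>i<?n. \<bar>z i - c i\<bar>) * (\<Sum>i<?n. \<bar>z (?n + i) - c (?n + i)\<bar>))"
    unfolding choice_iff by blast
  then have "\<forall>j. \<exists>B. j < ?n \<longrightarrow> B \<ge> 0 \<and> (\<forall>z\<in>coord_box (?n + ?n) c (d j).
      \<Delta> j z \<le> B * (\<Sum>i<?n. \<bar>z i - c i\<bar>) * (\<Sum>i<?n. \<bar>z (?n + i) - c (?n + i)\<bar>))"
    by blast
  then obtain B where B: "\<forall>j. j < ?n \<longrightarrow> B j \<ge> 0 \<and> (\<forall>z\<in>coord_box (?n + ?n) c (d j).
      \<Delta> j z \<le> B j * (\<Sum>i<?n. \<bar>z i - c i\<bar>) * (\<Sum>i<?n. \<bar>z (?n + i) - c (?n + i)\<bar>))"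
    unfolding choice_iff by blast
  define \<delta> where "\<delta> = Min (insert 1 (d ` {..<?n}))"
  have \<delta>: "\<delta> > 0" "\<And>i. i < ?n \<Longrightarrow> \<delta> \<le> d i"
    using d by (auto simp: \<delta>_def)
  let ?a = "\<lambda>g. \<Sum>i<?n. \<bar>\<psi>1 g i - \<psi>1 \<one> i\<bar>" and ?b = "\<lambda>h. \<Sum>i<?n. \<bar>\<psi>2 h i - \<psi>2 \<one> i\<bar>"
  have "(\<Sum>i<?n. \<bar>\<psi>3 (g \<otimes> h) i - \<psi>3 g i - \<psi>3 h i + \<psi>3 \<one> i\<bar>) \<le> (\<Sum>j<?n. B j) * ?a g * ?b h"
    if gh: "g \<in> V1 \<inter> V3" "h \<in> V2 \<inter> V3" "?a g < \<delta>" "?b h < \<delta>" for g h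
    unfolding sum_distrib_right[of B] sum_distrib_right[of "\<lambda>j. B j * ?a g"]
  proof (intro sum_mono)
    fix j assume "j \<in> {..<?n}"
    then have j: "j < ?n" by simp
    let ?z = "\<psi>12 (g, h)"
    have G: "g \<in> carrier G" "h \<in> carrier G"
      using gh openin_subset[OF chart_domain[OF ch(3)]] topspace_L by auto
    have "\<bar>\<psi>1 g i - \<psi>1 \<one> i\<bar> \<le> ?a g" "\<bar>\<psi>2 h i - \<psi>2 \<one> i\<bar> \<le> ?b h" if "i < ?n" for i
      using that member_le_sum[of i "{..<?n}" "\<lambda>i. \<bar>\<psi>1 g i - \<psi>1 \<one> i\<bar>"]
        member_le_sum[of i "{..<?n}" "\<lambda>i. \<bar>\<psi>2 h i - \<psi>2 \<one> i\<bar>"] by auto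
    then have near: "\<bar>\<psi>1 g i - \<psi>1 \<one> i\<bar> < d j" "\<bar>\<psi>2 h i - \<psi>2 \<one> i\<bar> < d j" if "i < ?n" for i
      using that gh \<delta>(2)[OF j] by (meson le_less_trans less_le_trans)+
    have "?z \<in> topspace ?E"
      using gh van2 by (auto simp: topspace_Euclidean_space b(4))
    then have "?z \<in> coord_box (?n + ?n) c (d j)"
      using near by (auto simp: coord_box_def c_def b(4))
    then have "\<Delta> j ?z \<le> B j * (\<Sum>i<?n. \<bar>?z i - c i\<bar>) * (\<Sum>i<?n. \<bar>?z (?n + i) - c (?n + i)\<bar>)"
      using B j by blast
    moreover have "(\<Sum>i<?n. \<bar>?z i - c i\<bar>) = ?a g" "(\<Sum>i<?n. \<bar>?z (?n + i) - c (?n + i)\<bar>) = ?b h"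
      by (simp_all add: c_def b(4))
    moreover have "(\<lambda>i. if i < ?n then ?z i else c i) = \<psi>12 (g, \<one>)"
      "(\<lambda>i. if i < ?n then c i else ?z i) = \<psi>12 (\<one>, h)"
      by (auto simp: c_def b(4))
    ultimately show "\<bar>\<psi>3 (g \<otimes> h) j - \<psi>3 g j - \<psi>3 h j + \<psi>3 \<one> j\<bar> \<le> B j * ?a g * ?b h"
      using gh one G by (simp add: \<Delta>_def f_eq c_def)
  qed
  moreover have "(\<Sum>j<?n. B j) \<ge> 0" using B by (auto intro: sum_nonneg)
  ultimately show ?thesis
    using a(2,4) b(1,2) one \<delta>(1) by blast
qed

lemma (in lie_group) local_norm_exists: "\<exists>n P V \<rho> A. local_norm G L n P V \<rho> A"
proof -
  let ?n = "mdim L" and ?T = "mtop L"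
  obtain V1 \<psi>1 V2 \<psi>2 V3 \<psi>3 \<delta> B where at: "(V1, \<psi>1) \<in> atlas L" "(V2, \<psi>2) \<in> atlas L" "(V3, \<psi>3) \<in> atlas L"
    and one: "\<one> \<in> V1" "\<one> \<in> V2" "\<one> \<in> V3" and \<delta>: "\<delta> > 0" "B \<ge> 0"
    and mult: "\<And>g h. g \<in> V1 \<inter> V3 \<Longrightarrow> h \<in> V2 \<inter> V3 \<Longrightarrow>
      (\<Sum>i<?n. \<bar>\<psi>1 g i - \<psi>1 \<one> i\<bar>) < \<delta> \<Longrightarrow> (\<Sum>i<?n. \<bar>\<psi>2 h i - \<psi>2 \<one> i\<bar>) < \<delta> \<Longrightarrow>
      (\<Sum>i<?n. \<bar>\<psi>3 (g \<otimes> h) i - \<psi>3 g i - \<psi>3 h i + \<psi>3 \<one> i\<bar>) \<le>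
        B * (\<Sum>i<?n. \<bar>\<psi>1 g i - \<psi>1 \<one> i\<bar>) * (\<Sum>i<?n. \<bar>\<psi>2 h i - \<psi>2 \<one> i\<bar>)"
    using multiplication_almost_additive by (elim exE conjE bexE) blast
  have ch: "chart_on ?T ?n (V1, \<psi>1)" "chart_on ?T ?n (V2, \<psi>2)" "chart_on ?T ?n (V3, \<psi>3)"
    using manifold_L at by (auto simp: smooth_manifold_def)
  define P where "P = (\<lambda>g i. \<psi>3 g i - \<psi>3 \<one> i)"
  define V where "V = V1 \<inter> V2 \<inter> V3"
  define len where "len = (\<lambda>g. \<Sum>i<?n. \<bar>P g i\<bar>)"
  have V: "openin ?T V" "\<one> \<in> V"
    using chart_domain[OF ch(1)] chart_domain[OF ch(2)] chart_domain[OF ch(3)] one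
    by (auto simp: V_def)
  have small: "\<exists>r>0. {g \<in> V. len g < r} \<subseteq> W" if W: "openin ?T W" "\<one> \<in> W" for W
  proof -
    obtain r where r: "r > 0" "coord_box ?n (\<psi>3 \<one>) r \<subseteq> \<psi>3 ` (V3 \<inter> W)"
      using coord_box_in_open[OF chart_open[OF ch(3) W(1)], of "\<psi>3 \<one>"] one W(2) by auto
    have "g \<in> W" if g: "g \<in> V" "len g < r" for g
    proof -
      have "\<bar>\<psi>3 g i - \<psi>3 \<one> i\<bar> < r" if "i < ?n" for i
        using that g(2) member_le_sum[of i "{..<?n}" "\<lambda>i. \<bar>\<psi>3 g i - \<psi>3 \<one> i\<bar>"]
        by (auto simp: len_def P_def)
      then have "\<psi>3 g \<in> coord_box ?n (\<psi>3 \<one>) r"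
        using g chart_range[OF ch(3)] by (auto simp: coord_box_def V_def)
      then obtain g' where "g' \<in> V3 \<inter> W" "\<psi>3 g = \<psi>3 g'" using r(2) by blast
      then show ?thesis using chart_inj[OF ch(3)] g by (auto simp: V_def inj_on_def)
    qed
    then show ?thesis using r(1) by blast
  qed
  obtain \<delta>1 B1 where c1: "\<delta>1 > 0" "B1 \<ge> 0" "\<And>y. y \<in> V \<Longrightarrow> len y < \<delta>1 \<Longrightarrow>
      (\<Sum>i<?n. \<bar>\<psi>1 y i - \<psi>1 \<one> i\<bar>) \<le> B1 * len y"
    using chart_comparison[OF manifold_L at(3,1) one(3,1)] by (auto simp: len_def P_def V_def)
  obtain \<delta>2 B2 where c2: "\<delta>2 > 0" "B2 \<ge> 0" "\<And>y. y \<in> V \<Longrightarrow> len y < \<delta>2 \<Longrightarrow>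
      (\<Sum>i<?n. \<bar>\<psi>2 y i - \<psi>2 \<one> i\<bar>) \<le> B2 * len y"
    using chart_comparison[OF manifold_L at(3,2) one(3,2)] by (auto simp: len_def P_def V_def)
  have "openin (prod_topology ?T ?T) {z \<in> topspace (prod_topology ?T ?T). fst z \<otimes> snd z \<in> V}"
    by (intro openin_continuous_map_preimage[OF _ V(1)] continuous_mult continuous_map_fst continuous_map_snd)
  moreover have "(\<one>, \<one>) \<in> {z \<in> topspace (prod_topology ?T ?T). fst z \<otimes> snd z \<in> V}"
    using V(2) by (simp add: one_in_topspace)
  ultimately obtain O1 O2 where O: "openin ?T O1" "openin ?T O2" "\<one> \<in> O1" "\<one> \<in> O2"
    "O1 \<times> O2 \<subseteq> {z \<in> topspace (prod_topology ?T ?T). fst z \<otimes> snd z \<in> V}"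
    unfolding openin_prod_topology_alt by meson
  obtain a where a: "a > 0" "{g \<in> V. len g < a} \<subseteq> O1" using small[OF O(1,3)] by blast
  obtain b where b: "b > 0" "{g \<in> V. len g < b} \<subseteq> O2" using small[OF O(2,4)] by blast
  \<comment> \<open>the first two bounds keep products in \<open>V\<close>, the next two make the charts comparable, and the last two
    then ensure that the coordinates in the other charts are below \<open>\<delta>\<close>\<close>
  define \<rho> where "\<rho> = Min {a, b, \<delta>1, \<delta>2, \<delta> / (B1 + 1), \<delta> / (B2 + 1)}"
  have \<rho>: "0 < \<rho>" "\<rho> \<le> a" "\<rho> \<le> b" "\<rho> \<le> \<delta>1" "\<rho> \<le> \<delta>2" "\<rho> \<le> \<delta> / (B1 + 1)" "\<rho> \<le> \<delta> / (B2 + 1)"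
  proof -
    have "0 < \<delta> / (B1 + 1)" "0 < \<delta> / (B2 + 1)" using \<delta>(1) c1(2) c2(2) by simp_all
    then show "0 < \<rho>" using a(1) b(1) c1(1) c2(1) by (simp add: \<rho>_def)
  qed (unfold \<rho>_def, (rule Min_le; simp)+)
  have nonneg: "len g \<ge> 0" for g by (auto simp: len_def intro: sum_nonneg)
  have "local_norm G L ?n P V \<rho> (B * B1 * B2)"
  proof unfold_locales
    show "openin ?T V" "\<one> \<in> V" "0 < \<rho>" by (fact V \<rho>)+
    show "0 \<le> B * B1 * B2" using \<delta> c1 c2 by simp
    show "P \<one> i = 0" for i by (simp add: P_def)
    show "continuous_map (subtopology ?T V) euclideanreal (\<lambda>g. P g i)" for i
    proof -
      have "continuous_map (subtopology ?T V) euclideanreal (\<lambda>g. \<psi>3 g i)"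
        by (rule continuous_map_from_subtopology_mono[OF chart_coord_continuous[OF ch(3)]])
           (auto simp: V_def)
      then show ?thesis unfolding P_def by (intro continuous_map_diff) auto
    qed
    show "\<exists>r>0. {g \<in> V. (\<Sum>i<?n. \<bar>P g i\<bar>) < r} \<subseteq> W" if "openin ?T W" "\<one> \<in> W" for W
      using small[OF that] by (simp add: len_def)
    fix g h assume gh: "g \<in> V" "h \<in> V" "(\<Sum>i<?n. \<bar>P g i\<bar>) < \<rho>" "(\<Sum>i<?n. \<bar>P h i\<bar>) < \<rho>"
    then have l: "len g < \<rho>" "len h < \<rho>" by (simp_all add: len_def)
    have "g \<in> O1" "h \<in> O2" using gh l \<rho> a b by auto
    then have "g \<otimes> h \<in> V" using O(5) by auto
    let ?a = "\<Sum>i<?n. \<bar>\<psi>1 g i - \<psi>1 \<one> i\<bar>" and ?b = "\<Sum>i<?n. \<bar>\<psi>2 h i - \<psi>2 \<one> i\<bar>"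
    have ab: "?a \<le> B1 * len g" "?b \<le> B2 * len h"
      using c1(3)[OF gh(1)] c2(3)[OF gh(2)] l \<rho> by auto
    have "B1 * len g \<le> (B1 + 1) * len g" "B2 * len h \<le> (B2 + 1) * len h"
      using nonneg by (simp_all add: algebra_simps)
    moreover have "(B1 + 1) * len g < (B1 + 1) * \<rho>" "(B2 + 1) * len h < (B2 + 1) * \<rho>"
      using l c1(2) c2(2) by simp_all
    moreover have "(B1 + 1) * \<rho> \<le> \<delta>" "(B2 + 1) * \<rho> \<le> \<delta>"
      using \<rho>(6,7) c1(2) c2(2) by (simp_all add: field_simps)
    ultimately have "?a < \<delta>" "?b < \<delta>" using ab by linarith+
    then have "(\<Sum>i<?n. \<bar>\<psi>3 (g \<otimes> h) i - \<psi>3 g i - \<psi>3 h i + \<psi>3 \<one> i\<bar>) \<le> B * ?a * ?b"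
      using mult[of g h] gh by (auto simp: V_def)
    also have "\<dots> \<le> B * (B1 * len g) * (B2 * len h)"
      using ab \<delta>(2) c1(2) nonneg by (intro mult_mono mult_left_mono) (auto intro: sum_nonneg)
    finally have "(\<Sum>i<?n. \<bar>P (g \<otimes> h) i - P g i - P h i\<bar>) \<le> B * B1 * B2 * len g * len h"
      by (simp add: P_def algebra_simps)
    then show "g \<otimes> h \<in> V \<and> (\<Sum>i<?n. \<bar>P (g \<otimes> h) i - P g i - P h i\<bar>)
        \<le> B * B1 * B2 * (\<Sum>i<?n. \<bar>P g i\<bar>) * (\<Sum>i<?n. \<bar>P h i\<bar>)"
      using \<open>g \<otimes> h \<in> V\<close> by (simp add: len_def)
  qed
  then show ?thesis by blast
qed

section \<open>Stabilizers\<close>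

context proper_G_manifold
begin

lemma act_closed: "g \<in> carrier G \<Longrightarrow> x \<in> topspace (mtop M) \<Longrightarrow> \<phi> g x \<in> topspace (mtop M)"
  by (rule element_image) auto

lemma act_one: "x \<in> topspace (mtop M) \<Longrightarrow> \<phi> \<one> x = x"
  by (metis id_eq_one restrict_apply')

lemma act_inv: "g \<in> carrier G \<Longrightarrow> x \<in> topspace (mtop M) \<Longrightarrow> \<phi> (inv g) (\<phi> g x) = x"
  by (rule orbit_sym_aux) auto

lemma act_inv': "g \<in> carrier G \<Longrightarrow> x \<in> topspace (mtop M) \<Longrightarrow> \<phi> g (\<phi> (inv g) x) = x"
  using act_inv[of "inv g" x] by simp

lemma continuous_action:
  "continuous_map Y (mtop L) f \<Longrightarrow> continuous_map Y (mtop M) h \<Longrightarrow> continuous_map Y (mtop M) (\<lambda>y. \<phi> (f y) (h y))"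
  using continuous_map_compose[of Y "prod_topology (mtop L) (mtop M)" "\<lambda>x. (f x, h x)" "mtop M" "\<lambda>(g, x). \<phi> g x"]
    smooth_action by (simp add: smooth_map_def prod_manifold_def continuous_map_paired o_def)

lemma stabilizer_compact:
  assumes "x \<in> topspace (mtop M)"
  shows "compactin (mtop L) (stabilizer G \<phi> x)"
proof -
  let ?P = "{z \<in> topspace (prod_topology (mtop L) (mtop M)). (case z of (g, y) \<Rightarrow> (\<phi> g y, y)) = (x, x)}"
  have "compactin (prod_topology (mtop L) (mtop M)) ?P"
    using proper_action assms by (auto simp: proper_map_def)
  then have "compactin (mtop L) (fst ` ?P)"
    using continuous_map_fst image_compactin by blast
  moreover have "fst ` ?P = stabilizer G \<phi> x"
    using assms by (force simp: stabilizer_def topspace_L)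
  ultimately show ?thesis by simp
qed

lemma stabilizer_act_mono:
  assumes "g \<in> carrier G" "x \<in> topspace (mtop M)" "y \<in> topspace (mtop M)"
    and "stabilizer G \<phi> x \<subseteq> stabilizer G \<phi> y"
  shows "stabilizer G \<phi> (\<phi> g x) \<subseteq> stabilizer G \<phi> (\<phi> g y)"
proof
  fix h assume "h \<in> stabilizer G \<phi> (\<phi> g x)"
  then have h: "h \<in> carrier G" "\<phi> h (\<phi> g x) = \<phi> g x" by (auto simp: stabilizer_def)
  have "\<phi> (inv g \<otimes> h \<otimes> g) x = x"
    using assms h by (simp add: composition_rule act_closed act_inv)
  then have "inv g \<otimes> h \<otimes> g \<in> stabilizer G \<phi> x"
    using assms(1) h(1) by (simp add: stabilizer_def)
  then have "inv g \<otimes> h \<otimes> g \<in> stabilizer G \<phi> y"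
    by (rule subsetD[OF assms(4)])
  then have "\<phi> (inv g \<otimes> h \<otimes> g) y = y" by (simp add: stabilizer_def)
  then have "\<phi> (inv g) (\<phi> h (\<phi> g y)) = y"
    using assms(1-3) h by (simp add: composition_rule act_closed)
  then have "\<phi> h (\<phi> g y) = \<phi> g y"
    using act_inv'[of g "\<phi> h (\<phi> g y)"] assms h by (simp add: act_closed)
  then show "h \<in> stabilizer G \<phi> (\<phi> g y)" using h by (simp add: stabilizer_def)
qed

text \<open>
  The stabilizers of \<open>x\<close>, \<open>g\<^sup>-\<^sup>1x\<close>, \<open>g\<^sup>-\<^sup>2x\<close> and so on form a decreasing chain of compact groups. It becomes
  stationary, and two equal consecutive members are carried by powers of \<open>g\<close> to the first two. For
  compact subgroups of arbitrary topological groups this may fail: multiplication by \<open>p\<close> maps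
  the \<open>p\<close>-adic integers properly into themselves, and it is a conjugation in the semidirect product of
  the \<open>p\<close>-adic numbers with the powers of \<open>p\<close>.
\<close>

lemma stabilizer_not_properly_in_conjugate:
  assumes g: "g \<in> carrier G" and x: "x \<in> topspace (mtop M)"
    and sub: "stabilizer G \<phi> x \<subseteq> stabilizer G \<phi> (\<phi> g x)"
  shows "stabilizer G \<phi> (\<phi> g x) = stabilizer G \<phi> x"
proof -
  define y where "y = (\<lambda>j. (\<phi> (inv g) ^^ j) x)"
  have y: "y j \<in> topspace (mtop M)" for j
    using g x by (induction j) (auto simp: y_def act_closed)
  have ySuc: "y (Suc j) = \<phi> (inv g) (y j)" for j by (simp add: y_def)
  have undo: "\<phi> g (y (Suc j)) = y j" for j using g y act_inv' by (simp add: ySuc)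
  have down: "stabilizer G \<phi> (y (Suc j)) \<subseteq> stabilizer G \<phi> (y j)" for j
  proof (induction j)
    case 0
    have "stabilizer G \<phi> (\<phi> (inv g) x) \<subseteq> stabilizer G \<phi> (\<phi> (inv g) (\<phi> g x))"
      using g x sub by (intro stabilizer_act_mono) (auto simp: act_closed)
    then show ?case using g x by (simp add: y_def act_inv)
  next
    case (Suc j)
    then show ?case using stabilizer_act_mono[OF _ y y Suc, of "inv g"] g by (simp only: ySuc inv_closed)
  qed
  obtain n P V \<rho> A where "local_norm G L n P V \<rho> A" using local_norm_exists by blast
  then obtain j where j: "stabilizer G \<phi> (y j) = (\<Inter>i. stabilizer G \<phi> (y i))"
    using local_norm.descending_chain_condition[of G L n P V \<rho> A "\<lambda>j. stabilizer G \<phi> (y j)"]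
      stabilizer_subgroup[OF y] stabilizer_compact[OF y] down by blast
  then have "stabilizer G \<phi> (y j) \<subseteq> stabilizer G \<phi> (y (Suc j))" by blast
  then have "stabilizer G \<phi> (y 0) \<subseteq> stabilizer G \<phi> (y (Suc 0))"
  proof (induction j)
    case (Suc j)
    then show ?case using stabilizer_act_mono[OF g y y, of "Suc j" "Suc (Suc j)"] by (simp only: undo)
  qed
  then have "stabilizer G \<phi> (\<phi> g (y 0)) \<subseteq> stabilizer G \<phi> (\<phi> g (y (Suc 0)))"
    by (rule stabilizer_act_mono[OF g y y])
  then have "stabilizer G \<phi> (\<phi> g x) \<subseteq> stabilizer G \<phi> x"
    unfolding undo by (simp add: y_def)
  then show ?thesis using sub by blast
qed

end

section \<open>Contraction of tubes\<close>

lemma topspace_quotient_top: "topspace (quotient_top X \<pi>) = \<pi> ` topspace X"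
proof -
  have "{x \<in> topspace X. \<pi> x \<in> \<pi> ` topspace X} = topspace X" by auto
  then have "openin (quotient_top X \<pi>) (\<pi> ` topspace X)"
    by (simp add: openin_quotient_top)
  moreover have "topspace (quotient_top X \<pi>) \<subseteq> \<pi> ` topspace X"
    using openin_quotient_top[of X \<pi> "topspace (quotient_top X \<pi>)"] by simp
  ultimately show ?thesis
    using openin_subset by blast
qed

lemma quotient_map_quotient_top: "quotient_map X (quotient_top X \<pi>) \<pi>"
  unfolding quotient_map_def topspace_quotient_top by (simp add: openin_quotient_top)

lemma differential_scale: "differential M M' F (c *\<^sub>R v) = c *\<^sub>R differential M M' F v"
  by (simp add: differential_def scaleR_fun_def fun_eq_iff)

text \<open>
  Scaling the fibre commutes with the linear action of the stabilizer, so it maps classes to classes;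
  this makes the radial contraction of the tube well defined.
\<close>

lemma tube_class_scale:
  "tube_class G M \<phi> m (g, c *\<^sub>R \<nu>) = (\<lambda>(g, \<nu>). (g, c *\<^sub>R \<nu>)) ` tube_class G M \<phi> m (g, \<nu>)"
  by (auto simp: tube_class_def differential_scale image_iff)

lemma continuous_map_scale_tangent:
  fixes N\<^sub>0 :: "'a tangent set"
  assumes "\<And>\<nu> t. \<nu> \<in> N\<^sub>0 \<Longrightarrow> t \<in> {0..1} \<Longrightarrow> (1 - t) *\<^sub>R \<nu> \<in> N\<^sub>0"
  shows "continuous_map (prod_topology (top_of_set N\<^sub>0) (top_of_set {0..1::real})) (top_of_set N\<^sub>0)
           (\<lambda>(\<nu>, t). (1 - t) *\<^sub>R \<nu>)"
proof -
  let ?Y = "prod_topology (top_of_set N\<^sub>0) (top_of_set {0..1::real})"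
  have fst: "continuous_map ?Y euclidean fst"
    using continuous_map_fst[of "top_of_set N\<^sub>0" "top_of_set {0..1::real}"]
    by (simp add: continuous_map_in_subtopology)
  have snd: "continuous_map ?Y euclideanreal snd"
    using continuous_map_snd[of "top_of_set N\<^sub>0" "top_of_set {0..1::real}"]
    by (simp add: continuous_map_in_subtopology)
  have "continuous_map ?Y euclideanreal (\<lambda>z. fst z f)" for f
  proof -
    have "continuous_map euclidean euclideanreal (\<lambda>\<nu>::'a tangent. \<nu> f)"
      by (simp add: continuous_on_product_coordinates)
    from continuous_map_compose[OF fst this] show ?thesis by (simp add: o_def)
  qed
  then have "continuous_map ?Y euclideanreal (\<lambda>z. (1 - snd z) * fst z f)" for f
    by (intro continuous_map_real_mult continuous_map_diff snd) auto
  then have "continuous_map ?Y (powertop_real UNIV) (\<lambda>z f. (1 - snd z) * fst z f)"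
    by (simp add: continuous_map_componentwise_UNIV)
  then have "continuous_map ?Y euclidean (\<lambda>z f. (1 - snd z) * fst z f)"
    by (simp only: euclidean_product_topology)
  then have "continuous_map ?Y euclidean (\<lambda>(\<nu>, t). (1 - t) *\<^sub>R (\<nu>::'a tangent))"
    by (rule continuous_map_eq) (auto simp: scaleR_fun_def)
  then show ?thesis
    using assms by (auto simp: continuous_map_in_subtopology)
qed

context proper_G_manifold
begin

lemma orbit_invariant: "x \<in> topspace (mtop M) \<Longrightarrow> G_invariant G \<phi> (orbit G \<phi> x)"
  unfolding G_invariant_def orbit_def by clarify (metis (mono_tags, lifting) composition_rule m_closed mem_Collect_eq)

lemma retract_stabilizer_mono:
  assumes "G_deformation_retract G \<phi> X U B H" "y \<in> U" "t \<in> {0..1}"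
  shows "stabilizer G \<phi> y \<subseteq> stabilizer G \<phi> (H (y, t))"
proof
  fix g assume "g \<in> stabilizer G \<phi> y"
  then have g: "g \<in> carrier G" "\<phi> g y = y" by (auto simp: stabilizer_def)
  have "\<forall>g\<in>carrier G. \<forall>a\<in>U. \<forall>t\<in>{0..1}. H (\<phi> g a, t) = \<phi> g (H (a, t))"
    using assms(1) unfolding G_deformation_retract_def by (elim conjE)
  then have "\<phi> g (H (y, t)) = H (y, t)" using g assms(2,3) by metis
  then show "g \<in> stabilizer G \<phi> (H (y, t))" using g(1) by (simp add: stabilizer_def)
qed

text \<open>
  The radial contraction \<open>F\<close> of the tube is continuous because the product of a quotient map with the
  identity of the locally compact interval is again a quotient map, so that continuity may be checked on
  the product of \<open>G\<close>, the fibre and the interval. Stabilizers do not change before time \<open>1\<close>: there the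
  contraction is injective on classes, so whatever fixes the contracted class fixes the class.
\<close>

lemma tubular_deformation_retract:
  assumes "G_tubular G L M \<phi> U"
  shows "\<exists>m\<in>U. \<exists>H. G_deformation_retract G \<phi> (mtop M) U (orbit G \<phi> m) H \<and>
           (\<forall>p\<in>U. \<forall>t\<in>{0..<1}. stabilizer G \<phi> (H (p, t)) = stabilizer G \<phi> p)"
proof -
  obtain m N N\<^sub>0 \<Phi> where U: "openin (mtop M) U" "G_invariant G \<phi> U" "m \<in> U"
    and N0: "tube_nhd G M \<phi> m N N\<^sub>0"
    and dif: "diffeomorphism (tube G L M \<phi> m N N\<^sub>0) (open_submanifold M U) \<Phi>"
    and equi: "\<And>h g \<nu>. h \<in> carrier G \<Longrightarrow> g \<in> carrier G \<Longrightarrow> \<nu> \<in> N\<^sub>0 \<Longrightarrow>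
      \<Phi> (tube_class G M \<phi> m (h \<otimes> g, \<nu>)) = \<phi> h (\<Phi> (tube_class G M \<phi> m (g, \<nu>)))"
    and centre: "\<Phi> (tube_class G M \<phi> m (\<one>, 0)) = m"
    using assms unfolding G_tubular_def by blast
  define \<pi> where "\<pi> = tube_class G M \<phi> m"
  define Y where "Y = prod_topology (mtop L) (top_of_set N\<^sub>0)"
  define Q where "Q = quotient_top Y \<pi>"
  define I where "I = top_of_set {0..1::real}"
  have Utop: "U \<subseteq> topspace (mtop M)" using U openin_subset by blast
  have mE: "m \<in> topspace (mtop M)" using U Utop by blast
  have scN: "(1 - t) *\<^sub>R \<nu> \<in> N\<^sub>0" if "\<nu> \<in> N\<^sub>0" "t \<in> {0..1}" for \<nu> t
    using N0 that by (simp add: tube_nhd_def)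
  have zeroN: "0 \<in> N\<^sub>0" using N0 by (simp add: tube_nhd_def)
  have Qt: "mtop (tube G L M \<phi> m N N\<^sub>0) = Q"
    by (simp add: tube_def quotient_manifold_def prod_manifold_def vector_manifold_def Q_def Y_def \<pi>_def)
  have Ut: "mtop (open_submanifold M U) = subtopology (mtop M) U" "topspace (subtopology (mtop M) U) = U"
    using Utop by (auto simp: open_submanifold_def)
  have Ytop: "topspace Y = carrier G \<times> N\<^sub>0" by (simp add: Y_def topspace_L)
  have Qtop: "topspace Q = \<pi> ` (carrier G \<times> N\<^sub>0)" by (simp add: Q_def topspace_quotient_top Ytop)
  have \<Phi>: "bij_betw \<Phi> (topspace Q) U" "continuous_map Q (subtopology (mtop M) U) \<Phi>"
    "continuous_map (subtopology (mtop M) U) Q (inv_into (topspace Q) \<Phi>)"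
    using dif Ut(2) unfolding diffeomorphism_def smooth_map_def Qt Ut(1) by auto
  define \<Psi> where "\<Psi> = inv_into (topspace Q) \<Phi>"
  define F where "F = (\<lambda>(S, t). (\<lambda>(g::'g, \<nu>::'a tangent). (g, (1 - t) *\<^sub>R \<nu>)) ` S)"
  have F: "F (\<pi> (g, \<nu>), t) = \<pi> (g, (1 - t) *\<^sub>R \<nu>)" for g \<nu> t
    by (simp add: F_def \<pi>_def tube_class_scale)
  have contF: "continuous_map (prod_topology Q I) Q F"
  proof (rule continuous_compose_quotient_map)
    have "compactin euclidean {0..1::real}" by simp
    then have "locally_compact_space I" "Hausdorff_space I"
      unfolding I_def
      by (intro compact_imp_locally_compact_space compact_space_subtopology,
          auto simp: Hausdorff_space_subtopology)
    then show "quotient_map (prod_topology Y I) (prod_topology Q I) (\<lambda>(y, t). (\<pi> y, t))"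
      unfolding Q_def by (intro quotient_map_prod_left quotient_map_quotient_top) auto
    let ?S = "\<lambda>z. (fst (fst z), (1 - snd z) *\<^sub>R snd (fst z))"
    have "continuous_map (prod_topology Y I) Y ?S"
      unfolding Y_def
    proof (rule continuous_map_pairedI)
      let ?Z = "prod_topology (prod_topology (mtop L) (top_of_set N\<^sub>0)) I"
      show "continuous_map ?Z (mtop L) (\<lambda>z. fst (fst z))"
        using continuous_map_compose[OF continuous_map_fst continuous_map_fst] by (simp add: o_def)
      have "continuous_map ?Z (top_of_set N\<^sub>0) (\<lambda>z. snd (fst z))"
        using continuous_map_compose[OF continuous_map_fst continuous_map_snd] by (simp add: o_def)
      then have "continuous_map ?Z (prod_topology (top_of_set N\<^sub>0) I) (\<lambda>z. (snd (fst z), snd z))"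
        by (intro continuous_map_pairedI continuous_map_snd)
      from continuous_map_compose[OF this continuous_map_scale_tangent[OF scN, folded I_def]]
      show "continuous_map ?Z (top_of_set N\<^sub>0) (\<lambda>z. (1 - snd z) *\<^sub>R snd (fst z))" by (simp add: o_def)
    qed
    moreover have "continuous_map Y Q \<pi>"
      unfolding Q_def by (rule quotient_imp_continuous_map[OF quotient_map_quotient_top])
    ultimately have "continuous_map (prod_topology Y I) Q (\<pi> \<circ> ?S)" by (rule continuous_map_compose)
    moreover have "\<pi> \<circ> ?S = F \<circ> (\<lambda>(y, t). (\<pi> y, t))" by (auto simp: F fun_eq_iff)
    ultimately show "continuous_map (prod_topology Y I) Q (F \<circ> (\<lambda>(y, t). (\<pi> y, t)))" by simp
  qed
  define H where "H = (\<lambda>(p, t). \<Phi> (F (\<Psi> p, t)))"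
  have contH: "continuous_map (prod_topology (subtopology (mtop M) U) I) (subtopology (mtop M) U) H"
  proof -
    let ?Z = "prod_topology (subtopology (mtop M) U) I"
    have "continuous_map ?Z Q (\<lambda>z. \<Psi> (fst z))"
      using continuous_map_compose[OF continuous_map_fst \<Phi>(3)] by (simp add: o_def \<Psi>_def)
    then have "continuous_map ?Z (prod_topology Q I) (\<lambda>z. (\<Psi> (fst z), snd z))"
      by (intro continuous_map_pairedI continuous_map_snd)
    from continuous_map_compose[OF continuous_map_compose[OF this contF] \<Phi>(2)]
    show ?thesis by (simp add: o_def H_def case_prod_beta')
  qed
  have \<pi>Q: "\<pi> a \<in> topspace Q" if "a \<in> carrier G \<times> N\<^sub>0" for a
    unfolding Qtop using that by (rule imageI)
  have inj: "\<pi> a = \<pi> b" if "\<Phi> (\<pi> a) = \<Phi> (\<pi> b)" "a \<in> carrier G \<times> N\<^sub>0" "b \<in> carrier G \<times> N\<^sub>0" for a b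
    by (rule inj_onD[OF bij_betw_imp_inj_on[OF \<Phi>(1)] that(1) \<pi>Q[OF that(2)] \<pi>Q[OF that(3)]])
  have \<Psi>: "\<Psi> (\<Phi> (\<pi> a)) = \<pi> a" if "a \<in> carrier G \<times> N\<^sub>0" for a
    unfolding \<Psi>_def by (rule bij_betw_inv_into_left[OF \<Phi>(1) \<pi>Q[OF that]])
  have H: "H (\<Phi> (\<pi> (g, \<nu>)), t) = \<Phi> (\<pi> (g, (1 - t) *\<^sub>R \<nu>))" if "g \<in> carrier G" "\<nu> \<in> N\<^sub>0" for g \<nu> t
    using that by (simp add: H_def \<Psi> F)
  have param: "\<exists>g\<in>carrier G. \<exists>\<nu>\<in>N\<^sub>0. p = \<Phi> (\<pi> (g, \<nu>))" if "p \<in> U" for p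
  proof -
    have "p \<in> \<Phi> ` \<pi> ` (carrier G \<times> N\<^sub>0)"
      using bij_betw_imp_surj_on[OF \<Phi>(1)] that unfolding Qtop by simp
    then show ?thesis by auto
  qed
  have equi': "\<phi> h (\<Phi> (\<pi> (g, \<nu>))) = \<Phi> (\<pi> (h \<otimes> g, \<nu>))"
    if "h \<in> carrier G" "g \<in> carrier G" "\<nu> \<in> N\<^sub>0" for h g \<nu>
    using equi[OF that] by (simp add: \<pi>_def)
  have zero_section: "\<Phi> (\<pi> (g, 0)) = \<phi> g m" if "g \<in> carrier G" for g
    using equi'[OF that one_closed zeroN] centre that by (simp add: \<pi>_def)
  have "G_deformation_retract G \<phi> (mtop M) U (orbit G \<phi> m) H"
    unfolding G_deformation_retract_def
  proof (intro conjI ballI)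
    show "orbit G \<phi> m \<subseteq> U" using U by (auto simp: orbit_def G_invariant_def)
    show "U \<subseteq> topspace (mtop M)" "G_invariant G \<phi> U" by (fact Utop U(2))+
    show "G_invariant G \<phi> (orbit G \<phi> m)" by (rule orbit_invariant[OF mE])
    show "continuous_map (prod_topology (subtopology (mtop M) U) (top_of_set {0..1})) (subtopology (mtop M) U) H"
      using contH by (simp add: I_def)
    show "H (\<phi> h p, t) = \<phi> h (H (p, t))" if ht: "h \<in> carrier G" "p \<in> U" "t \<in> {0..1}" for h p t
    proof -
      obtain g \<nu> where p: "g \<in> carrier G" "\<nu> \<in> N\<^sub>0" "p = \<Phi> (\<pi> (g, \<nu>))" using param[OF ht(2)] by blast
      then show ?thesis using ht scN[OF p(2) ht(3)] by (simp add: equi' H)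
    qed
    show "H (p, 0) = p" if "p \<in> U" for p using param[OF that] by (auto simp: H)
    show "H (p, 1) \<in> orbit G \<phi> m" if "p \<in> U" for p
      using param[OF that] by (auto simp: H zero_section orbit_def)
    show "H (b, 1) = b" if b: "b \<in> orbit G \<phi> m" for b
    proof -
      obtain g where g: "g \<in> carrier G" "b = \<Phi> (\<pi> (g, 0))"
        using b zero_section by (auto simp: orbit_def)
      then show ?thesis using zeroN by (simp add: H)
    qed
  qed
  moreover have "stabilizer G \<phi> (H (p, t)) = stabilizer G \<phi> p" if pt: "p \<in> U" "t \<in> {0..<1}" for p t
  proof (intro subset_antisym subsetI)
    obtain g \<nu> where p: "g \<in> carrier G" "\<nu> \<in> N\<^sub>0" "p = \<Phi> (\<pi> (g, \<nu>))" using param[OF pt(1)] by blast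
    have scNt: "(1 - t) *\<^sub>R \<nu> \<in> N\<^sub>0" using scN[OF p(2)] pt(2) by auto
    fix h assume "h \<in> stabilizer G \<phi> (H (p, t))"
    then have h: "h \<in> carrier G" "\<phi> h (H (p, t)) = H (p, t)" by (auto simp: stabilizer_def)
    then have "\<Phi> (\<pi> (h \<otimes> g, (1 - t) *\<^sub>R \<nu>)) = \<Phi> (\<pi> (g, (1 - t) *\<^sub>R \<nu>))"
      using p scNt by (simp add: H equi')
    then have "\<pi> (h \<otimes> g, (1 - t) *\<^sub>R \<nu>) = \<pi> (g, (1 - t) *\<^sub>R \<nu>)"
      using h p scNt by (intro inj) auto
    then have "(\<lambda>(g, \<nu>). (g, (1 - t) *\<^sub>R \<nu>)) ` \<pi> (h \<otimes> g, \<nu>) = (\<lambda>(g, \<nu>). (g, (1 - t) *\<^sub>R \<nu>)) ` \<pi> (g, \<nu>)"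
      by (simp add: \<pi>_def tube_class_scale)
    moreover have "inj (\<lambda>(g::'g, \<nu>::'a tangent). (g, (1 - t) *\<^sub>R \<nu>))"
      using pt(2) by (auto simp: inj_on_def)
    ultimately have "\<pi> (h \<otimes> g, \<nu>) = \<pi> (g, \<nu>)" by (simp add: inj_image_eq_iff)
    then show "h \<in> stabilizer G \<phi> p"
      using h p by (simp add: stabilizer_def equi')
  next
    fix h assume "h \<in> stabilizer G \<phi> p"
    then show "h \<in> stabilizer G \<phi> (H (p, t))"
      using retract_stabilizer_mono[OF calculation, of p t] pt by auto
  qed
  ultimately show ?thesis using U(3) by blast
qed

end

section \<open>Orbit-type strata\<close>

context proper_G_manifold
begin

lemma subgroup_in_conj_class:
  assumes "subgroup H G"
  shows "H \<in> conj_class G H"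
proof -
  have "\<one> <# H #> inv \<one> = H"
    using subgroup.subset[OF assms] by (simp add: lcos_mult_one)
  then show ?thesis
    unfolding conj_class_def by (metis (mono_tags, lifting) mem_Collect_eq one_closed)
qed

lemma saturation_member: "y \<in> G_saturation G \<phi> A \<longleftrightarrow> (\<exists>g\<in>carrier G. \<exists>a\<in>A. y = \<phi> g a)"
  by (auto simp: G_saturation_def orbit_def)

lemma stratum_index_cases:
  assumes "\<beta> \<in> strata_index G L M \<phi>"
  obtains H b where "b \<in> connected_components_of (subtopology (mtop M) (fixed_type G M \<phi> H))"
    "stratum G \<phi> \<beta> = G_saturation G \<phi> b"
    "b \<noteq> {}" "b \<subseteq> topspace (mtop M)" "\<And>y. y \<in> b \<Longrightarrow> stabilizer G \<phi> y = H"
proof -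
  obtain H b where \<beta>: "\<beta> = (conj_class G H, component_class G M \<phi> H b)" "subgroup H G"
    and b: "b \<in> connected_components_of (subtopology (mtop M) (fixed_type G M \<phi> H))"
    using assms unfolding strata_index_def by blast
  have "b \<in> component_class G M \<phi> H b"
    using b subgroup_in_conj_class[OF \<beta>(2)] unfolding component_class_def by blast
  then have "stratum G \<phi> \<beta> = G_saturation G \<phi> b"
    unfolding stratum_def \<beta>(1) by (auto simp: component_class_def)
  moreover have "b \<subseteq> topspace (mtop M) \<inter> fixed_type G M \<phi> H"
    using connected_components_of_subset[OF b] by simp
  ultimately show ?thesis
    using that[OF b] nonempty_connected_components_of[OF b] by (auto simp: fixed_type_def)
qed

lemma stratum_subset: "\<beta> \<in> strata_index G L M \<phi> \<Longrightarrow> stratum G \<phi> \<beta> \<subseteq> topspace (mtop M)"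
  by (erule stratum_index_cases) (auto simp: saturation_member subset_iff act_closed)

lemma stratum_nonempty:
  assumes "\<beta> \<in> strata_index G L M \<phi>"
  shows "stratum G \<phi> \<beta> \<noteq> {}"
proof -
  obtain H b where b: "stratum G \<phi> \<beta> = G_saturation G \<phi> b" "b \<noteq> {}"
    using stratum_index_cases[OF assms] by metis
  then obtain y where "y \<in> b" by blast
  then have "\<phi> \<one> y \<in> stratum G \<phi> \<beta>" unfolding b(1) saturation_member using one_closed by blast
  then show ?thesis by blast
qed

lemma stratum_invariant:
  assumes "\<beta> \<in> strata_index G L M \<phi>" "g \<in> carrier G" "y \<in> stratum G \<phi> \<beta>"
  shows "\<phi> g y \<in> stratum G \<phi> \<beta>"
proof -
  obtain H b where b: "stratum G \<phi> \<beta> = G_saturation G \<phi> b" "b \<subseteq> topspace (mtop M)"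
    using stratum_index_cases[OF assms(1)] by metis
  then obtain h a where "h \<in> carrier G" "a \<in> b" "y = \<phi> h a" using assms(3) saturation_member by auto
  then have "\<phi> g y = \<phi> (g \<otimes> h) a" "g \<otimes> h \<in> carrier G"
    using assms(2) b(2) composition_rule[of a g h] by auto
  then show ?thesis unfolding b(1) saturation_member using \<open>a \<in> b\<close> by blast
qed

lemma strata_cover:
  assumes x: "x \<in> topspace (mtop M)"
  shows "\<exists>\<beta>\<in>strata_index G L M \<phi>. x \<in> stratum G \<phi> \<beta>"
proof -
  let ?H = "stabilizer G \<phi> x"
  have H: "subgroup ?H G" "closedin (mtop L) ?H"
    by (rule stabilizer_subgroup[OF x], rule compactin_imp_closedin[OF Hausdorff_L stabilizer_compact[OF x]])
  have "x \<in> topspace (subtopology (mtop M) (fixed_type G M \<phi> ?H))"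
    using x by (simp add: fixed_type_def)
  then obtain b where b: "b \<in> connected_components_of (subtopology (mtop M) (fixed_type G M \<phi> ?H))" "x \<in> b"
    unfolding Union_connected_components_of[symmetric] by (rule UnionE)
  let ?\<beta> = "(conj_class G ?H, component_class G M \<phi> ?H b)"
  have "?\<beta> \<in> strata_index G L M \<phi>"
    unfolding strata_index_def using H b(1) by blast
  moreover have "x \<in> stratum G \<phi> ?\<beta>"
  proof -
    have "b \<in> component_class G M \<phi> ?H b"
      using b subgroup_in_conj_class[OF H(1)] unfolding component_class_def by blast
    moreover have "x \<in> G_saturation G \<phi> b"
      unfolding saturation_member using b(2) act_one[OF x] one_closed by metis
    ultimately show ?thesis unfolding stratum_def by auto
  qed
  ultimately show ?thesis by blast
qed

lemma stabilizers_conjugate_in_stratum: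
  assumes "\<beta> \<in> strata_index G L M \<phi>" "y \<in> stratum G \<phi> \<beta>" "z \<in> stratum G \<phi> \<beta>"
  shows "\<exists>g\<in>carrier G. stabilizer G \<phi> z = stabilizer G \<phi> (\<phi> g y)"
proof -
  obtain H b where b: "stratum G \<phi> \<beta> = G_saturation G \<phi> b" "b \<subseteq> topspace (mtop M)"
    "\<And>y. y \<in> b \<Longrightarrow> stabilizer G \<phi> y = H"
    using stratum_index_cases[OF assms(1)] by metis
  obtain g1 y0 where y: "g1 \<in> carrier G" "y0 \<in> b" "y = \<phi> g1 y0" using assms(2) b(1) saturation_member by auto
  obtain g2 z0 where z: "g2 \<in> carrier G" "z0 \<in> b" "z = \<phi> g2 z0" using assms(3) b(1) saturation_member by auto
  have E: "y0 \<in> topspace (mtop M)" "z0 \<in> topspace (mtop M)" using y z b(2) by auto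
  have "stabilizer G \<phi> z = stabilizer G \<phi> (\<phi> g2 y0)"
    unfolding z(3) using b(3) y(2) z E by (intro subset_antisym stabilizer_act_mono) auto
  moreover have "\<phi> g2 y0 = \<phi> (g2 \<otimes> inv g1) y"
    using y(1) z(1) E by (simp add: y(3) composition_rule act_closed act_inv)
  ultimately show ?thesis using y(1) z(1) by (metis inv_closed m_closed)
qed

text \<open>
  A translate of \<open>S\<close> is a connected subset of some \<open>M\<^sub>H\<close> that meets the component from which the stratum
  is generated, hence is contained in it.
\<close>

lemma connected_in_stratum:
  assumes \<beta>: "\<beta> \<in> strata_index G L M \<phi>" and y: "y \<in> stratum G \<phi> \<beta>" "y \<in> S"
    and S: "connectedin (mtop M) S" "\<And>p. p \<in> S \<Longrightarrow> stabilizer G \<phi> p = stabilizer G \<phi> y"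
  shows "S \<subseteq> stratum G \<phi> \<beta>"
proof -
  obtain H b where b: "b \<in> connected_components_of (subtopology (mtop M) (fixed_type G M \<phi> H))"
    "stratum G \<phi> \<beta> = G_saturation G \<phi> b" "b \<subseteq> topspace (mtop M)"
    "\<And>y. y \<in> b \<Longrightarrow> stabilizer G \<phi> y = H"
    using stratum_index_cases[OF \<beta>] by metis
  obtain g y0 where g: "g \<in> carrier G" "y0 \<in> b" "y = \<phi> g y0" using y(1) b(2) saturation_member by auto
  have E: "S \<subseteq> topspace (mtop M)" "y \<in> topspace (mtop M)" "y0 \<in> topspace (mtop M)"
    using connectedin_subset_topspace[OF S(1)] y(2) b(3) g(2) by auto
  let ?S = "\<phi> (inv g) ` S"
  have "continuous_map (mtop M) (mtop M) (\<lambda>x. \<phi> (inv g) x)"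
    using g(1) by (intro continuous_action) (auto simp: topspace_L)
  then have "connectedin (mtop M) ?S"
    using connectedin_continuous_map_image S(1) by blast
  moreover have y0: "\<phi> (inv g) y = y0" using g E by (simp add: act_inv)
  have "stabilizer G \<phi> (\<phi> (inv g) p) = H" if p: "p \<in> S" for p
  proof -
    have "stabilizer G \<phi> (\<phi> (inv g) p) = stabilizer G \<phi> (\<phi> (inv g) y)"
      using S(2)[OF p] p g(1) E by (intro subset_antisym stabilizer_act_mono) auto
    then show ?thesis using y0 b(4)[OF g(2)] by simp
  qed
  then have "?S \<subseteq> fixed_type G M \<phi> H"
    using E g(1) by (auto simp: fixed_type_def intro: act_closed)
  ultimately have "connectedin (subtopology (mtop M) (fixed_type G M \<phi> H)) ?S"
    by (simp add: connectedin_subtopology)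
  moreover have "\<not> disjnt b ?S"
    using y0 y(2) g(2) by (force simp: disjnt_iff)
  ultimately have sub: "?S \<subseteq> b"
    by (rule connected_components_of_maximal[OF b(1)])
  show ?thesis
  proof
    fix p assume "p \<in> S"
    then have "p = \<phi> g (\<phi> (inv g) p)" "\<phi> (inv g) p \<in> b"
      using act_inv'[OF g(1)] E(1) sub by auto
    then show "p \<in> stratum G \<phi> \<beta>" unfolding b(2) saturation_member using g(1) by blast
  qed
qed

lemma minimal_index_in_index: "\<beta> \<in> minimal_index G L M \<phi> \<Longrightarrow> \<beta> \<in> strata_index G L M \<phi>"
  by (simp add: minimal_index_def)

text \<open>
  Any other stratum through a point of the closure would be strictly smaller.
\<close>

lemma minimal_stratum_closed:
  assumes \<beta>: "\<beta> \<in> minimal_index G L M \<phi>"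
  shows "closedin (mtop M) (stratum G \<phi> \<beta>)"
proof -
  let ?S = "stratum G \<phi> \<beta>"
  have "mtop M closure_of ?S \<subseteq> ?S"
  proof
    fix x assume x: "x \<in> mtop M closure_of ?S"
    then have "x \<in> topspace (mtop M)" using closure_of_subset_topspace by fastforce
    then obtain \<alpha> where \<alpha>: "\<alpha> \<in> strata_index G L M \<phi>" "x \<in> stratum G \<phi> \<alpha>"
      using strata_cover by blast
    have "\<not> strata_less G M \<phi> \<alpha> \<beta>" using \<beta> \<alpha>(1) unfolding minimal_index_def by blast
    then have "\<alpha> = \<beta>" using x \<alpha>(2) unfolding strata_less_def by blast
    then show "x \<in> ?S" using \<alpha>(2) by simp
  qed
  moreover have "?S \<subseteq> mtop M closure_of ?S"
    using stratum_subset[OF minimal_index_in_index[OF \<beta>]] by (rule closure_of_subset)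
  ultimately show ?thesis using closedin_closure_of by (metis subset_antisym)
qed

lemma minimal_strata_disjoint:
  assumes "\<alpha> \<in> minimal_index G L M \<phi>" "\<beta> \<in> minimal_index G L M \<phi>"
    and "x \<in> stratum G \<phi> \<alpha>" "x \<in> stratum G \<phi> \<beta>"
  shows "\<alpha> = \<beta>"
proof (rule ccontr)
  assume "\<alpha> \<noteq> \<beta>"
  moreover have "stratum G \<phi> \<beta> \<subseteq> mtop M closure_of stratum G \<phi> \<beta>"
    using stratum_subset[OF minimal_index_in_index[OF assms(2)]] by (rule closure_of_subset)
  ultimately have "strata_less G M \<phi> \<alpha> \<beta>" using assms(3,4) unfolding strata_less_def by blast
  then show False using assms(1,2) unfolding minimal_index_def by blast
qed

section \<open>Equivariant retractions and minimal strata\<close>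

lemma retractD:
  assumes "G_deformation_retract G \<phi> X U B H"
  shows "B \<subseteq> U" "U \<subseteq> topspace X" "G_invariant G \<phi> U" "G_invariant G \<phi> B"
    "continuous_map (prod_topology (subtopology X U) (top_of_set {0..1})) (subtopology X U) H"
    "\<And>g a t. g \<in> carrier G \<Longrightarrow> a \<in> U \<Longrightarrow> t \<in> {0..1} \<Longrightarrow> H (\<phi> g a, t) = \<phi> g (H (a, t))"
    "\<And>a. a \<in> U \<Longrightarrow> H (a, 0) = a" "\<And>a. a \<in> U \<Longrightarrow> H (a, 1) \<in> B" "\<And>b. b \<in> B \<Longrightarrow> H (b, 1) = b"
  using assms unfolding G_deformation_retract_def by blast+

lemma retract_path_continuous:
  assumes H: "G_deformation_retract G \<phi> (mtop M) U B H" and y: "y \<in> U"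
  shows "continuous_map (top_of_set {0..1}) (mtop M) (\<lambda>t. H (y, t))"
    and "\<And>t. t \<in> {0..1} \<Longrightarrow> H (y, t) \<in> U"
proof -
  have "y \<in> topspace (mtop M)" using retractD(2)[OF H] y by blast
  then have "continuous_map (top_of_set {0..1}) (prod_topology (subtopology (mtop M) U) (top_of_set {0..1})) (\<lambda>t. (y, t))"
    using y by (intro continuous_map_pairedI) auto
  from continuous_map_compose[OF this retractD(5)[OF H]]
  have c: "continuous_map (top_of_set {0..1}) (subtopology (mtop M) U) (\<lambda>t. H (y, t))" by (simp add: o_def)
  then show "continuous_map (top_of_set {0..1}) (mtop M) (\<lambda>t. H (y, t))"
    by (simp add: continuous_map_in_subtopology)
  show "H (y, t) \<in> U" if "t \<in> {0..1}" for t
    using c that unfolding continuous_map_in_subtopology by auto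
qed

text \<open>
  The tube need not be centred at \<open>y\<close>, but its core orbit lies in the stratum of \<open>y\<close>: the retraction
  moves \<open>y\<close> with constant stabilizer, hence inside the stratum, and the endpoint stays there as the
  stratum is closed. So the stabilizer of every point of the tube is contained in a stabilizer of a
  point of the core orbit, which is a conjugate of the stabilizer of \<open>y\<close>. This replaces the existence of a
  slice at \<open>y\<close>.
\<close>

lemma stabilizer_locally_constant_in_tube:
  assumes \<beta>: "\<beta> \<in> minimal_index G L M \<phi>" and U: "G_tubular G L M \<phi> U"
    and y: "y \<in> U" "y \<in> stratum G \<phi> \<beta>" and w: "w \<in> U" "stabilizer G \<phi> y \<subseteq> stabilizer G \<phi> w"
  shows "stabilizer G \<phi> w = stabilizer G \<phi> y"
proof -
  have \<beta>i: "\<beta> \<in> strata_index G L M \<phi>" using \<beta> by (rule minimal_index_in_index)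
  obtain m H where mU: "m \<in> U" and H: "G_deformation_retract G \<phi> (mtop M) U (orbit G \<phi> m) H"
    and stab: "\<And>p t. p \<in> U \<Longrightarrow> t \<in> {0..<1} \<Longrightarrow> stabilizer G \<phi> (H (p, t)) = stabilizer G \<phi> p"
    using tubular_deformation_retract[OF U] by blast
  have UE: "U \<subseteq> topspace (mtop M)" by (rule retractD(2)[OF H])
  let ?c = "\<lambda>t. H (y, t)"
  note c = retract_path_continuous[OF H y(1)]
  \<comment> \<open>for \<open>t < 1\<close> the stabilizer along the retraction of \<open>y\<close> is constant, hence the path stays in the stratum\<close>
  have "?c ` {0..<1} \<subseteq> stratum G \<phi> \<beta>"
  proof (rule connected_in_stratum[OF \<beta>i y(2)])
    show "y \<in> ?c ` {0..<1}" using retractD(7)[OF H y(1)] by (force simp: image_iff)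
    have "connectedin (top_of_set {0..1::real}) {0..<1}"
      by (simp add: connectedin_subtopology) auto
    then show "connectedin (mtop M) (?c ` {0..<1})"
      using c(1) connectedin_continuous_map_image by blast
    show "stabilizer G \<phi> p = stabilizer G \<phi> y" if "p \<in> ?c ` {0..<1}" for p
      using that stab[OF y(1)] by auto
  qed
  moreover have "closedin (top_of_set {0..1}) {t \<in> topspace (top_of_set {0..1}). ?c t \<in> stratum G \<phi> \<beta>}"
    using closedin_continuous_map_preimage[OF c(1) minimal_stratum_closed[OF \<beta>]] .
  then have "closed {t \<in> {0..1}. ?c t \<in> stratum G \<phi> \<beta>}"
    by (simp add: closedin_closed_eq)
  ultimately have "closure {0..<1} \<subseteq> {t \<in> {0..1::real}. ?c t \<in> stratum G \<phi> \<beta>}"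
    by (intro closure_minimal) auto
  moreover have "(1::real) \<in> closure {0..<1}" by simp
  ultimately have "H (y, 1) \<in> stratum G \<phi> \<beta>" by blast
  moreover obtain g where g: "g \<in> carrier G" "H (y, 1) = \<phi> g m"
    using retractD(8)[OF H y(1)] by (auto simp: orbit_def)
  ultimately have "\<phi> (inv g) (\<phi> g m) \<in> stratum G \<phi> \<beta>"
    using stratum_invariant[OF \<beta>i] by auto
  then have m: "m \<in> stratum G \<phi> \<beta>" using g(1) mU UE by (auto simp: act_inv)
  obtain h where h: "h \<in> carrier G" "H (w, 1) = \<phi> h m"
    using retractD(8)[OF H w(1)] by (auto simp: orbit_def)
  then have "H (w, 1) \<in> stratum G \<phi> \<beta>" using stratum_invariant[OF \<beta>i] m by auto
  then obtain a where a: "a \<in> carrier G" "stabilizer G \<phi> (H (w, 1)) = stabilizer G \<phi> (\<phi> a y)"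
    using stabilizers_conjugate_in_stratum[OF \<beta>i y(2)] by blast
  have "stabilizer G \<phi> w \<subseteq> stabilizer G \<phi> (\<phi> a y)"
    using retract_stabilizer_mono[OF H w(1), of 1] a(2) by auto
  moreover have "stabilizer G \<phi> (\<phi> a y) = stabilizer G \<phi> y"
    using y(1) UE calculation w(2) by (intro stabilizer_not_properly_in_conjugate[OF a(1)]) auto
  ultimately show ?thesis using w(2) by blast
qed

text \<open>
  The times at which the path of \<open>y\<close> is in the stratum form a closed set, since the stratum is closed.
  The set is also open: while in the stratum, the path has the same stabilizer as \<open>y\<close>, because its
  stabilizer contains that of \<open>y\<close> and is conjugate to it; by the previous lemma the stabilizer is still
  the same shortly before and afterwards, and connectedness keeps the path in the stratum.
\<close>

lemma retraction_preserves_minimal_stratum: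
  assumes tubes: "G_tubular_cover G L M \<phi> \<U>" and \<beta>: "\<beta> \<in> minimal_index G L M \<phi>"
    and H: "G_deformation_retract G \<phi> (mtop M) U B H"
    and y: "y \<in> U" "y \<in> stratum G \<phi> \<beta>" and t: "t \<in> {0..1}"
  shows "H (y, t) \<in> stratum G \<phi> \<beta>"
proof -
  have \<beta>i: "\<beta> \<in> strata_index G L M \<phi>" using \<beta> by (rule minimal_index_in_index)
  let ?c = "\<lambda>t. H (y, t)"
  note c = retract_path_continuous[OF H y(1)]
  have yE: "y \<in> topspace (mtop M)" using retractD(2)[OF H] y by blast
  define T where "T = {t \<in> {0..1}. ?c t \<in> stratum G \<phi> \<beta>}"
  have "closedin (top_of_set {0..1}) T"
    using closedin_continuous_map_preimage[OF c(1) minimal_stratum_closed[OF \<beta>]] by (simp add: T_def)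
  moreover have "openin (top_of_set {0..1}) T"
    unfolding openin_euclidean_subtopology_iff
  proof (intro conjI ballI)
    show "T \<subseteq> {0..1}" by (auto simp: T_def)
    fix s assume "s \<in> T"
    then have s: "s \<in> {0..1}" "?c s \<in> stratum G \<phi> \<beta>" by (auto simp: T_def)
    have "?c s \<in> topspace (mtop M)" using s(2) stratum_subset[OF \<beta>i] by blast
    then obtain W where W: "G_tubular G L M \<phi> W" "?c s \<in> W"
      using tubes unfolding G_tubular_cover_def by blast
    have Wo: "openin (mtop M) W" using W(1) by (simp add: G_tubular_def)
    have "openin (top_of_set {0..1}) {t \<in> topspace (top_of_set {0..1}). ?c t \<in> W}"
      by (rule openin_continuous_map_preimage[OF c(1) Wo])
    then obtain e where e: "e > 0" "\<And>t. t \<in> {0..1} \<Longrightarrow> dist t s < e \<Longrightarrow> ?c t \<in> W"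
      using s W(2) unfolding openin_euclidean_subtopology_iff by auto
    obtain a where a: "a \<in> carrier G" "stabilizer G \<phi> (?c s) = stabilizer G \<phi> (\<phi> a y)"
      using stabilizers_conjugate_in_stratum[OF \<beta>i y(2) s(2)] by blast
    have "stabilizer G \<phi> y \<subseteq> stabilizer G \<phi> (\<phi> a y)"
      using retract_stabilizer_mono[OF H y(1) s(1)] a(2) by simp
    then have stab_s: "stabilizer G \<phi> (?c s) = stabilizer G \<phi> y"
      using stabilizer_not_properly_in_conjugate[OF a(1) yE] a(2) by simp
    let ?J = "{0..1} \<inter> ball s e"
    have "?c ` ?J \<subseteq> stratum G \<phi> \<beta>"
    proof (rule connected_in_stratum[OF \<beta>i s(2)])
      show "?c s \<in> ?c ` ?J" using s(1) e(1) by auto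
      have "connected ?J" by (intro convex_connected convex_Int convex_ball) auto
      then have "connectedin (top_of_set {0..1}) ?J" by (simp add: connectedin_subtopology)
      then show "connectedin (mtop M) (?c ` ?J)"
        using c(1) connectedin_continuous_map_image by blast
      show "stabilizer G \<phi> p = stabilizer G \<phi> (?c s)" if p: "p \<in> ?c ` ?J" for p
      proof -
        obtain r where r: "r \<in> {0..1}" "dist r s < e" "p = ?c r"
          using p by (auto simp: dist_commute)
        have "stabilizer G \<phi> (?c s) \<subseteq> stabilizer G \<phi> p"
          unfolding r(3) stab_s by (rule retract_stabilizer_mono[OF H y(1) r(1)])
        then show ?thesis
          using stabilizer_locally_constant_in_tube[OF \<beta> W(1) W(2) s(2)] e(2)[OF r(1,2)] r(3) by blast
      qed
    qed
    then show "\<exists>e>0. \<forall>t\<in>{0..1}. dist t s < e \<longrightarrow> t \<in> T"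
      using e(1) by (intro exI[of _ e]) (auto simp: T_def dist_commute)
  qed
  ultimately have "T = {} \<or> T = {0..1}"
    using connected_clopen[of "{0..1::real}"] by simp
  moreover have "0 \<in> T" using retractD(7)[OF H y(1)] y(2) by (simp add: T_def)
  ultimately have "t \<in> T" using t by blast
  then show ?thesis unfolding T_def by blast
qed

lemma categorical_centre_in_minimal_stratum:
  assumes tubes: "G_tubular_cover G L M \<phi> \<U>" and \<beta>: "\<beta> \<in> minimal_index G L M \<phi>"
    and H: "G_deformation_retract G \<phi> (mtop M) U (orbit G \<phi> x) H" and x: "x \<in> U"
    and meets: "U \<inter> stratum G \<phi> \<beta> \<noteq> {}"
  shows "x \<in> stratum G \<phi> \<beta>"
proof -
  have \<beta>i: "\<beta> \<in> strata_index G L M \<phi>" using \<beta> by (rule minimal_index_in_index)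
  obtain y where y: "y \<in> U" "y \<in> stratum G \<phi> \<beta>" using meets by blast
  have "H (y, 1) \<in> stratum G \<phi> \<beta>"
    using retraction_preserves_minimal_stratum[OF tubes \<beta> H y, of 1] by simp
  moreover obtain g where g: "g \<in> carrier G" "H (y, 1) = \<phi> g x"
    using retractD(8)[OF H y(1)] by (auto simp: orbit_def)
  ultimately have "\<phi> (inv g) (\<phi> g x) \<in> stratum G \<phi> \<beta>"
    using stratum_invariant[OF \<beta>i] by auto
  then show ?thesis using g(1) x retractD(2)[OF H] by (auto simp: act_inv)
qed

lemma categorical_meets_one_minimal_stratum:
  assumes tubes: "G_tubular_cover G L M \<phi> \<U>" and U: "G_categorical G \<phi> (mtop M) U"
    and "\<alpha> \<in> minimal_index G L M \<phi>" "U \<inter> stratum G \<phi> \<alpha> \<noteq> {}"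
    and "\<beta> \<in> minimal_index G L M \<phi>" "U \<inter> stratum G \<phi> \<beta> \<noteq> {}"
  shows "\<alpha> = \<beta>"
proof -
  obtain x H where "x \<in> U" "G_deformation_retract G \<phi> (mtop M) U (orbit G \<phi> x) H"
    using U unfolding G_categorical_def by blast
  then show ?thesis
    using categorical_centre_in_minimal_stratum[OF tubes] assms(3-6) minimal_strata_disjoint by meson
qed

lemma categorical_restricts_to_minimal_stratum:
  assumes tubes: "G_tubular_cover G L M \<phi> \<U>" and U: "G_categorical G \<phi> (mtop M) U"
    and \<beta>: "\<beta> \<in> minimal_index G L M \<phi>" and meets: "U \<inter> stratum G \<phi> \<beta> \<noteq> {}"
  shows "G_categorical G \<phi> (subtopology (mtop M) (stratum G \<phi> \<beta>)) (U \<inter> stratum G \<phi> \<beta>)"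
proof -
  let ?S = "stratum G \<phi> \<beta>"
  let ?A = "U \<inter> ?S"
  have \<beta>i: "\<beta> \<in> strata_index G L M \<phi>" using \<beta> by (rule minimal_index_in_index)
  obtain x H where x: "x \<in> U" and H: "G_deformation_retract G \<phi> (mtop M) U (orbit G \<phi> x) H"
    using U unfolding G_categorical_def by blast
  have xS: "x \<in> ?S" by (rule categorical_centre_in_minimal_stratum[OF tubes \<beta> H x meets])
  have sub: "subtopology (subtopology (mtop M) ?S) ?A = subtopology (mtop M) ?A"
    by (simp add: subtopology_subtopology) (metis inf.commute inf.left_idem)
  have "G_deformation_retract G \<phi> (subtopology (mtop M) ?S) ?A (orbit G \<phi> x) H"
    unfolding G_deformation_retract_def sub
  proof (intro conjI ballI)
    show "orbit G \<phi> x \<subseteq> ?A"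
      using retractD(1)[OF H] stratum_invariant[OF \<beta>i _ xS] by (auto simp: orbit_def)
    show "?A \<subseteq> topspace (subtopology (mtop M) ?S)"
      using stratum_subset[OF \<beta>i] by auto
    show "G_invariant G \<phi> ?A"
      using retractD(3)[OF H] stratum_invariant[OF \<beta>i] by (auto simp: G_invariant_def)
    show "G_invariant G \<phi> (orbit G \<phi> x)" by (rule retractD(4)[OF H])
    have "continuous_map (prod_topology (subtopology (mtop M) ?A) (top_of_set {0..1})) (subtopology (mtop M) U) H"
    proof -
      let ?Z = "prod_topology (subtopology (mtop M) ?A) (top_of_set {0..1::real})"
      have "continuous_map ?Z (mtop M) fst" "fst ` topspace ?Z \<subseteq> U"
        using continuous_map_fst[of "subtopology (mtop M) ?A" "top_of_set {0..1::real}"]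
        by (simp add: continuous_map_in_subtopology) auto
      then have "continuous_map ?Z (subtopology (mtop M) U) fst"
        by (auto simp: continuous_map_in_subtopology)
      then have "continuous_map ?Z (prod_topology (subtopology (mtop M) U) (top_of_set {0..1})) (\<lambda>z. (fst z, snd z))"
        by (intro continuous_map_pairedI continuous_map_snd)
      from continuous_map_compose[OF this retractD(5)[OF H]] show ?thesis by (simp add: o_def)
    qed
    moreover have "H (y, t) \<in> ?A" if "y \<in> ?A" "t \<in> {0..1}" for y t
      using that retraction_preserves_minimal_stratum[OF tubes \<beta> H, of y t]
        retract_path_continuous(2)[OF H, of y t] by blast
    ultimately show "continuous_map (prod_topology (subtopology (mtop M) ?A) (top_of_set {0..1})) (subtopology (mtop M) ?A) H"
      by (auto simp: continuous_map_in_subtopology)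
  qed (use retractD(6-9)[OF H] in auto)
  then show ?thesis using x xS unfolding G_categorical_def by blast
qed

end

section \<open>Comparison of categories\<close>

lemma finite_card_le_lepoll:
  assumes "A \<lesssim> B" "finite B"
  shows "finite A \<and> card A \<le> card B"
  using assms by (metis finite_surj lepoll_iff lepoll_iff_card_le)

context proper_G_manifold
begin

text \<open>The empty trace is removed because a categorical set contains a point.\<close>

definition trace_cover :: "'a set set \<Rightarrow> 'g set set \<times> 'a set set \<Rightarrow> 'a set set" where
  "trace_cover \<C> \<beta> = {U \<inter> stratum G \<phi> \<beta> | U. U \<in> \<C>} - {{}}"

lemma trace_cover_categorical:
  assumes tubes: "G_tubular_cover G L M \<phi> \<U>" and \<beta>: "\<beta> \<in> minimal_index G L M \<phi>"
    and \<C>: "G_categorical_open_cover G \<phi> (mtop M) \<C>"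
  shows "G_categorical_open_cover G \<phi> (subtopology (mtop M) (stratum G \<phi> \<beta>)) (trace_cover \<C> \<beta>)"
proof -
  let ?S = "stratum G \<phi> \<beta>"
  have S: "?S \<subseteq> topspace (mtop M)" by (rule stratum_subset[OF minimal_index_in_index[OF \<beta>]])
  have c: "\<And>U. U \<in> \<C> \<Longrightarrow> openin (mtop M) U" "\<And>U. U \<in> \<C> \<Longrightarrow> G_categorical G \<phi> (mtop M) U"
    "\<Union>\<C> = topspace (mtop M)"
    using \<C> unfolding G_categorical_open_cover_def by auto
  have "openin (subtopology (mtop M) ?S) A \<and> G_categorical G \<phi> (subtopology (mtop M) ?S) A"
    if A: "A \<in> trace_cover \<C> \<beta>" for A
  proof -
    obtain U where U: "U \<in> \<C>" "A = U \<inter> ?S" "A \<noteq> {}" using A by (auto simp: trace_cover_def)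
    then show ?thesis
      using categorical_restricts_to_minimal_stratum[OF tubes c(2)[OF U(1)] \<beta>] c(1)[OF U(1)]
      by (auto simp: openin_subtopology)
  qed
  moreover have "\<Union>(trace_cover \<C> \<beta>) = ?S"
  proof -
    have "\<Union>(trace_cover \<C> \<beta>) = \<Union>\<C> \<inter> ?S" by (auto simp: trace_cover_def)
    then show ?thesis unfolding c(3) using S by blast
  qed
  ultimately show ?thesis
    using S unfolding G_categorical_open_cover_def by (simp add: inf_absorb2)
qed

text \<open>
  Sending each minimal stratum to the members of a categorical open cover of \<open>M\<close> that meet it gives
  pairwise disjoint subfamilies, and the traces of each subfamily cover the stratum by categorical sets.
\<close>

lemma sum_Cat_strata_le:
  assumes tubes: "G_tubular_cover G L M \<phi> \<U>"
  shows "(\<Sum>\<^sub>\<infinity>\<beta>\<in>minimal_index G L M \<phi>. Cat_G G \<phi> (subtopology (mtop M) (stratum G \<phi> \<beta>)))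
           \<le> Cat_G G \<phi> (mtop M)"
proof -
  let ?B = "minimal_index G L M \<phi>"
  let ?cat = "\<lambda>\<beta>. Cat_G G \<phi> (subtopology (mtop M) (stratum G \<phi> \<beta>))"
  have "(\<Sum>\<beta>\<in>F. ?cat \<beta>) \<le> enat (card \<C>)"
    if F: "finite F" "F \<subseteq> ?B" and \<C>: "G_categorical_open_cover G \<phi> (mtop M) \<C>" "finite \<C>" for F \<C>
  proof -
    define D where "D = (\<lambda>\<beta>. {U \<in> \<C>. U \<inter> stratum G \<phi> \<beta> \<noteq> {}})"
    have "?cat \<beta> \<le> enat (card (D \<beta>))" if "\<beta> \<in> F" for \<beta>
    proof -
      have \<beta>: "\<beta> \<in> ?B" using that F by blast
      have eq: "trace_cover \<C> \<beta> = (\<lambda>U. U \<inter> stratum G \<phi> \<beta>) ` D \<beta>"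
        by (auto simp: trace_cover_def D_def)
      have fin: "finite (D \<beta>)" using \<C>(2) by (simp add: D_def)
      have "?cat \<beta> \<le> (if finite (trace_cover \<C> \<beta>) then enat (card (trace_cover \<C> \<beta>)) else \<infinity>)"
        unfolding Cat_G_def using trace_cover_categorical[OF tubes \<beta> \<C>(1)] by (intro INF_lower) simp
      also have "\<dots> \<le> enat (card (D \<beta>))" using fin by (simp add: eq card_image_le)
      finally show ?thesis .
    qed
    then have "(\<Sum>\<beta>\<in>F. ?cat \<beta>) \<le> (\<Sum>\<beta>\<in>F. enat (card (D \<beta>)))" by (rule sum_mono)
    also have "\<dots> = enat (\<Sum>\<beta>\<in>F. card (D \<beta>))" by (simp add: of_nat_eq_enat[symmetric])
    also have "(\<Sum>\<beta>\<in>F. card (D \<beta>)) = card (\<Union>\<beta>\<in>F. D \<beta>)"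
    proof (rule card_UN_disjoint[symmetric])
      show "\<forall>\<alpha>\<in>F. \<forall>\<beta>\<in>F. \<alpha> \<noteq> \<beta> \<longrightarrow> D \<alpha> \<inter> D \<beta> = {}"
      proof (intro ballI impI)
        fix \<alpha> \<beta> assume ab: "\<alpha> \<in> F" "\<beta> \<in> F" "\<alpha> \<noteq> \<beta>"
        have False if "U \<in> D \<alpha> \<inter> D \<beta>" for U
        proof -
          have U: "G_categorical G \<phi> (mtop M) U"
            using that \<C>(1) by (auto simp: D_def G_categorical_open_cover_def)
          show False
            using categorical_meets_one_minimal_stratum[OF tubes U, of \<alpha> \<beta>] that ab F(2)
            by (auto simp: D_def)
        qed
        then show "D \<alpha> \<inter> D \<beta> = {}" by blast
      qed
    qed (use F \<C> in \<open>auto simp: D_def\<close>)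
    also have "card (\<Union>\<beta>\<in>F. D \<beta>) \<le> card \<C>"
      using \<C>(2) by (intro card_mono) (auto simp: D_def)
    finally show ?thesis by simp
  qed
  then have "infsum ?cat ?B \<le> (if finite \<C> then enat (card \<C>) else \<infinity>)"
    if "G_categorical_open_cover G \<phi> (mtop M) \<C>" for \<C>
    using that by (auto simp: nonneg_infsum_complete intro!: SUP_least)
  then show ?thesis
    unfolding Cat_G_def[of G \<phi> "mtop M"] by (intro INF_greatest) auto
qed

text \<open>
  The traces of the minimal tubular cover \<open>\<V>\<close> on the minimal strata realize the categories of these
  strata. Choosing one member of \<open>\<V>\<close> for every trace gives a family that covers all minimal strata and
  is no larger than the sum of these categories; by minimality \<open>\<V>\<close> is no larger than this family. The
  members of \<open>\<V>\<close> are categorical and cover \<open>M\<close>. If the sum is infinite, there is nothing to show; it is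
  infinite as soon as there are infinitely many minimal strata, because each has category at least \<open>1\<close>.
\<close>

lemma Cat_le_sum_Cat_strata:
  assumes "minimal_G_tubular_cover G L M \<phi> \<V>"
  shows "Cat_G G \<phi> (mtop M)
           \<le> (\<Sum>\<^sub>\<infinity>\<beta>\<in>minimal_index G L M \<phi>. Cat_G G \<phi> (subtopology (mtop M) (stratum G \<phi> \<beta>)))"
proof -
  let ?B = "minimal_index G L M \<phi>"
  let ?cat = "\<lambda>\<beta>. Cat_G G \<phi> (subtopology (mtop M) (stratum G \<phi> \<beta>))"
  note cover = assms[unfolded minimal_G_tubular_cover_def Let_def]
  obtain \<U> where "G_tubular_cover G L M \<phi> \<U> \<and> \<V> \<subseteq> \<U> \<and> (\<Union>\<beta>\<in>?B. stratum G \<phi> \<beta>) \<subseteq> \<Union>\<V> \<and>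
      (\<forall>\<W>. \<W> \<subseteq> \<U> \<and> (\<Union>\<beta>\<in>?B. stratum G \<phi> \<beta>) \<subseteq> \<Union>\<W> \<longrightarrow> \<V> \<lesssim> \<W>)"
    using cover[THEN conjunct1] by (rule exE)
  then have \<U>: "G_tubular_cover G L M \<phi> \<U>" "\<V> \<subseteq> \<U>"
    and small: "\<W> \<subseteq> \<U> \<Longrightarrow> (\<Union>\<beta>\<in>?B. stratum G \<phi> \<beta>) \<subseteq> \<Union>\<W> \<Longrightarrow> \<V> \<lesssim> \<W>" for \<W>
    by simp_all
  have cov: "\<Union>\<V> = topspace (mtop M)"
    using cover[THEN conjunct2, THEN conjunct1] .
  have "\<forall>\<beta>\<in>?B. G_categorical_open_cover G \<phi> (subtopology (mtop M) (stratum G \<phi> \<beta>)) (trace_cover \<V> \<beta>) \<and>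
      (\<forall>\<C>. G_categorical_open_cover G \<phi> (subtopology (mtop M) (stratum G \<phi> \<beta>)) \<C> \<longrightarrow> trace_cover \<V> \<beta> \<lesssim> \<C>)"
    using cover[THEN conjunct2, THEN conjunct2] unfolding trace_cover_def .
  then have tr: "G_categorical_open_cover G \<phi> (subtopology (mtop M) (stratum G \<phi> \<beta>)) (trace_cover \<V> \<beta>)"
    "G_categorical_open_cover G \<phi> (subtopology (mtop M) (stratum G \<phi> \<beta>)) \<C> \<Longrightarrow> trace_cover \<V> \<beta> \<lesssim> \<C>"
    if "\<beta> \<in> ?B" for \<beta> \<C>
    using that by blast+
  have Vcat: "G_categorical_open_cover G \<phi> (mtop M) \<V>"
    unfolding G_categorical_open_cover_def
  proof (intro conjI ballI)
    fix U assume "U \<in> \<V>"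
    then have U: "G_tubular G L M \<phi> U" using \<U> unfolding G_tubular_cover_def by blast
    then show "openin (mtop M) U" by (simp add: G_tubular_def)
    show "G_categorical G \<phi> (mtop M) U"
      using tubular_deformation_retract[OF U] unfolding G_categorical_def by blast
  qed (rule cov)
  define v where "v = (\<lambda>\<beta>. if finite (trace_cover \<V> \<beta>) then enat (card (trace_cover \<V> \<beta>)) else \<infinity>)"
  have v_le: "v \<beta> \<le> ?cat \<beta>" if "\<beta> \<in> ?B" for \<beta>
    unfolding Cat_G_def v_def
    using finite_card_le_lepoll[OF tr(2)[OF that]] by (intro INF_greatest) auto
  have v_ge: "1 \<le> v \<beta>" if \<beta>: "\<beta> \<in> ?B" for \<beta>
  proof -
    have "\<Union>(trace_cover \<V> \<beta>) = topspace (subtopology (mtop M) (stratum G \<phi> \<beta>))"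
      using tr(1)[OF \<beta>] unfolding G_categorical_open_cover_def by blast
    also have "\<dots> \<noteq> {}"
      using stratum_nonempty[OF minimal_index_in_index[OF \<beta>]]
        stratum_subset[OF minimal_index_in_index[OF \<beta>]] by (simp add: inf_absorb2)
    finally have "trace_cover \<V> \<beta> \<noteq> {}" by auto
    then show ?thesis by (auto simp: v_def one_enat_def Suc_le_eq card_gt_0_iff)
  qed
  have infsum_v: "infsum v ?B \<le> infsum ?cat ?B"
    using v_le by (intro infsum_mono) auto
  have "Cat_G G \<phi> (mtop M) \<le> infsum v ?B"
  proof (cases "finite ?B \<and> (\<forall>\<beta>\<in>?B. finite (trace_cover \<V> \<beta>))")
    case True
    let ?P = "Sigma ?B (trace_cover \<V>)"
    define pick where "pick = (\<lambda>(\<beta>, S). SOME U. U \<in> \<V> \<and> U \<inter> stratum G \<phi> \<beta> = S)"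
    have pick: "pick (\<beta>, S) \<in> \<V> \<and> pick (\<beta>, S) \<inter> stratum G \<phi> \<beta> = S" if "(\<beta>, S) \<in> ?P" for \<beta> S
    proof -
      have "S \<in> trace_cover \<V> \<beta>" using that by (simp only: mem_Sigma_iff)
      then have "\<exists>U. U \<in> \<V> \<and> U \<inter> stratum G \<phi> \<beta> = S" unfolding trace_cover_def by blast
      then show ?thesis unfolding pick_def prod.case by (rule someI_ex)
    qed
    have "\<V> \<lesssim> pick ` ?P"
    proof (rule small)
      show "pick ` ?P \<subseteq> \<U>"
        by (intro image_subsetI) (metis pick \<U>(2) subsetD surj_pair)
      show "(\<Union>\<beta>\<in>?B. stratum G \<phi> \<beta>) \<subseteq> \<Union>(pick ` ?P)"
      proof
        fix x assume "x \<in> (\<Union>\<beta>\<in>?B. stratum G \<phi> \<beta>)"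
        then obtain \<beta> where \<beta>: "\<beta> \<in> ?B" "x \<in> stratum G \<phi> \<beta>" by blast
        then have "x \<in> \<Union>\<V>"
          unfolding cov using stratum_subset[OF minimal_index_in_index[OF \<beta>(1)]] by blast
        then obtain U where "U \<in> \<V>" "x \<in> U" by blast
        then have "(\<beta>, U \<inter> stratum G \<phi> \<beta>) \<in> ?P" "x \<in> U \<inter> stratum G \<phi> \<beta>"
          using \<beta> by (auto simp: trace_cover_def)
        then show "x \<in> \<Union>(pick ` ?P)"
          using pick[of \<beta> "U \<inter> stratum G \<phi> \<beta>"] by blast
      qed
    qed
    moreover have finP: "finite ?P" using True by blast
    ultimately have V: "finite \<V>" "card \<V> \<le> card (pick ` ?P)"
      using finite_card_le_lepoll by blast+
    have "Cat_G G \<phi> (mtop M) \<le> (if finite \<V> then enat (card \<V>) else \<infinity>)"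
      unfolding Cat_G_def using Vcat by (intro INF_lower) simp
    also have "\<dots> \<le> enat (card ?P)"
      using V card_image_le[OF finP, of pick] by simp
    also have "card ?P = (\<Sum>\<beta>\<in>?B. card (trace_cover \<V> \<beta>))"
      using True by (intro card_SigmaI) auto
    also have "enat \<dots> = (\<Sum>\<beta>\<in>?B. v \<beta>)"
      using True by (simp add: v_def of_nat_eq_enat[symmetric])
    also have "\<dots> = infsum v ?B" using True by simp
    finally show ?thesis .
  next
    case False
    have "infsum v ?B = \<infinity>"
    proof (cases "finite ?B")
      case True
      then obtain \<beta> where "\<beta> \<in> ?B" "v \<beta> = \<infinity>" using False by (auto simp: v_def)
      then have "(\<Sum>\<beta>\<in>?B. v \<beta>) = \<infinity>"
        using True member_le_sum[of \<beta> ?B v] by simp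
      then show ?thesis using True by simp
    next
      case False
      then show ?thesis using infsum_superconst_infinite_enat[of ?B 1 v] v_ge by simp
    qed
    then show ?thesis by simp
  qed
  then show ?thesis using infsum_v by (rule order_trans)
qed

end

theorem corollary5p2:
  fixes G :: "('g, 'z) monoid_scheme" and L :: "'g manifold"
    and M :: "'a manifold" and \<phi> :: "'g \<Rightarrow> 'a \<Rightarrow> 'a"
  assumes "proper_G_manifold G L M \<phi>"
    and "\<exists>\<V>. minimal_G_tubular_cover G L M \<phi> \<V>"
  shows "Cat_G G \<phi> (mtop M) =
    (\<Sum>\<^sub>\<infinity>\<beta>\<in>minimal_index G L M \<phi>. Cat_G G \<phi> (subtopology (mtop M) (stratum G \<phi> \<beta>)))"
proof -
  interpret proper_G_manifold G L M \<phi> by (rule assms(1))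
  obtain \<V> where \<V>: "minimal_G_tubular_cover G L M \<phi> \<V>" using assms(2) by blast
  then obtain \<U> where "G_tubular_cover G L M \<phi> \<U>"
    unfolding minimal_G_tubular_cover_def by blast
  then show ?thesis
    using Cat_le_sum_Cat_strata[OF \<V>] sum_Cat_strata_le by (intro antisym)
qed

end
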